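(* Let $\mathcal{F}(\Omega)$ be a locally convex Hausdorff space of $\mathbb{K}$-valued functions on a non-empty set $\Omega$, let $(\delta,Y,T)$ be a strong linearisation of $\mathcal{F}(\Omega)$ such that $Y$ is quasi-barrelled, and let $E$ be a complete locally convex Hausdorff space over the field $\mathbb{K}$. Then the map \[ \chi\colon L_{b}(Y,E)\to\mathcal{F}(\Omega,E)_{\sigma,b},\quad \chi(u):= u\circ \delta, \] is a topological isomorphism and its inverse fulfils \[ e'\bigl(\chi^{-1}(f)(y)\bigr)=T(e'\circ f)(y),\quad f\in \mathcal{F}(\Omega,E)_{\sigma,b},\ y\in Y,\ e'\in E'. \] In particular, $\mathcal{F}(\Omega,E)_{\sigma,b}$ is quasi-complete. If $Y$ is even bornological, then the space $\mathcal{F}(\Omega,E)_{\sigma,b}$ is complete.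
   Context: $\mathbb{K}=\mathbb{R}$ or $\mathbb{C}$. For a locally convex Hausdorff space $Y$, $Y'$ is the topological dual and $Y_{b}'$ is $Y'$ with the topology of uniform convergence on bounded subsets of $Y$. A topological isomorphism is a linear homeomorphism. A locally convex Hausdorff space $\mathcal{F}(\Omega)$ of $\mathbb{K}$-valued functions on $\Omega$ is a linear subspace of $\mathbb{K}^{\Omega}$ equipped with some locally convex Hausdorff topology. A strong linearisation of $\mathcal{F}(\Omega)$ is a triple $(\delta,Y,T)$ of a locally convex Hausdorff space $Y$ over $\mathbb{K}$, a map $\delta\colon\Omega\to Y$ and a topological isomorphism $T\colon\mathcal{F}(\Omega)\to Y_{b}'$ such that $T(f)\circ\delta=f$ for all $f\in\mathcal{F}(\Omega)$. Let $\Gamma_{\mathcal{F}(\Omega)}$ and $\Gamma_{E}$ be fundamental systems of seminorms of $\mathcal{F}(\Omega)$ and $E$. Set $\mathcal{F}(\Omega,E)_{\sigma}:=\{f\colon\Omega\to E\;|\;\forall e'\in E':\ e'\circ f\in\mathcal{F}(\Omega)\}$. For $p\in\Gamma_{E}$ let $U_{p}:=\{x\in E\;|\;p(x)<1\}$ and $U_{p}^{\circ}:=\{e'\in E'\;|\;|e'(x)|\leq 1\ \forall x\in U_{p}\}$. Set \[ \mathcal{F}(\Omega,E)_{\sigma,b}:=\{f\in\mathcal{F}(\Omega,E)_{\sigma}\;|\;\forall q\in\Gamma_{\mathcal{F}(\Omega)},\,p\in\Gamma_{E}:\ \|f\|_{\sigma,q,p}:=\sup_{e'\in U_{p}^{\circ}}q(e'\circ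 f)<\infty\}, \] equipped with the locally convex Hausdorff topology given by the seminorms $\|\cdot\|_{\sigma,q,p}$. $L(Y,E)$ is the space of continuous linear maps from $Y$ to $E$, and $L_{b}(Y,E)$ is this space with the topology of uniform convergence on bounded subsets of $Y$. *)

theory Defs
  imports "HOL-Analysis.Analysis" "HOL-Library.Function_Algebras"
begin

text \<open>The scalar field: every instance of this class is isomorphic, as a normed field, to the
  real or to the complex numbers.\<close>

class real_or_complex = real_normed_field +
  assumes real_or_complex:
    "(\<forall>z. \<exists>a. z = a *\<^sub>R 1) \<or>
     (\<exists>i. i * i = - 1 \<and>
        (\<forall>z. \<exists>a b. z = a *\<^sub>R 1 + b *\<^sub>R i \<and> norm z = sqrt (a\<^sup>2 + b\<^sup>2)))"

instance real :: real_or_complex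
  by standard auto

instance complex :: real_or_complex
proof
  have "\<forall>z. \<exists>a b. z = a *\<^sub>R 1 + b *\<^sub>R \<i> \<and> norm z = sqrt (a\<^sup>2 + b\<^sup>2)"
  proof
    fix z
    have "z = Re z *\<^sub>R 1 + Im z *\<^sub>R \<i>" by (simp add: complex_eq_iff)
    then show "\<exists>a b. z = a *\<^sub>R 1 + b *\<^sub>R \<i> \<and> norm z = sqrt (a\<^sup>2 + b\<^sup>2)"
      using cmod_def by blast
  qed
  moreover have "\<i> * \<i> = - 1" by simp
  ultimately show "(\<forall>z::complex. \<exists>a. z = a *\<^sub>R 1) \<or>
     (\<exists>i::complex. i * i = - 1 \<and>
        (\<forall>z. \<exists>a b. z = a *\<^sub>R 1 + b *\<^sub>R i \<and> norm z = sqrt (a\<^sup>2 + b\<^sup>2)))"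
    by blast
qed


section \<open>Locally convex Hausdorff spaces\<close>

text \<open>A space is given by a scalar multiplication \<open>s\<close> on an abelian group and a topology \<open>X\<close>
  whose underlying set \<open>topspace X\<close> is a linear subspace. The spaces of functions
  below are proper subspaces of a full function type with the pointwise operations.\<close>

definition fun_scale :: "('k \<Rightarrow> 'v \<Rightarrow> 'v) \<Rightarrow> 'k \<Rightarrow> ('x \<Rightarrow> 'v) \<Rightarrow> 'x \<Rightarrow> 'v"
  where "fun_scale s a f = (\<lambda>x. s a (f x))"

definition convex_wrt :: "('k::real_or_complex \<Rightarrow> 'v::ab_group_add \<Rightarrow> 'v) \<Rightarrow> 'v set \<Rightarrow> bool"
  where "convex_wrt s C \<longleftrightarrow>
    (\<forall>x\<in>C. \<forall>y\<in>C. \<forall>t. 0 \<le> t \<and> t \<le> 1 \<longrightarrow> s (of_real (1 - t)) x + s (of_real t) y \<in> C)"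

definition absolutely_convex :: "('k::real_or_complex \<Rightarrow> 'v::ab_group_add \<Rightarrow> 'v) \<Rightarrow> 'v set \<Rightarrow> bool"
  where "absolutely_convex s C \<longleftrightarrow>
    (\<forall>x\<in>C. \<forall>y\<in>C. \<forall>a b. norm a + norm b \<le> 1 \<longrightarrow> s a x + s b y \<in> C)"

definition zero_nhd :: "'v::ab_group_add topology \<Rightarrow> 'v set \<Rightarrow> bool"
  where "zero_nhd X V \<longleftrightarrow> V \<subseteq> topspace X \<and> (\<exists>U. openin X U \<and> 0 \<in> U \<and> U \<subseteq> V)"

definition lc_hausdorff_space ::
    "('k::real_or_complex \<Rightarrow> 'v::ab_group_add \<Rightarrow> 'v) \<Rightarrow> 'v topology \<Rightarrow> bool"
  where "lc_hausdorff_space s X \<longleftrightarrow>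
    vector_space s \<and> module.subspace s (topspace X) \<and>
    continuous_map (prod_topology X X) X (\<lambda>(x, y). x + y) \<and>
    continuous_map (prod_topology euclidean X) X (\<lambda>(a, x). s a x) \<and>
    Hausdorff_space X \<and>
    (\<forall>U. zero_nhd X U \<longrightarrow> (\<exists>C. zero_nhd X C \<and> convex_wrt s C \<and> C \<subseteq> U))"

definition absorbs :: "('k::real_or_complex \<Rightarrow> 'v \<Rightarrow> 'v) \<Rightarrow> 'v set \<Rightarrow> 'v set \<Rightarrow> bool"
  where "absorbs s A B \<longleftrightarrow> (\<exists>r>0. \<forall>c. r \<le> norm c \<longrightarrow> B \<subseteq> s c ` A)"

definition bounded_in ::
    "('k::real_or_complex \<Rightarrow> 'v::ab_group_add \<Rightarrow> 'v) \<Rightarrow> 'v topology \<Rightarrow> 'v set \<Rightarrow> bool"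
  where "bounded_in s X B \<longleftrightarrow> B \<subseteq> topspace X \<and> (\<forall>U. zero_nhd X U \<longrightarrow> absorbs s U B)"

definition bornivorous ::
    "('k::real_or_complex \<Rightarrow> 'v::ab_group_add \<Rightarrow> 'v) \<Rightarrow> 'v topology \<Rightarrow> 'v set \<Rightarrow> bool"
  where "bornivorous s X A \<longleftrightarrow>
    A \<subseteq> topspace X \<and> (\<forall>B. bounded_in s X B \<longrightarrow> absorbs s A B)"

definition barrel ::
    "('k::real_or_complex \<Rightarrow> 'v::ab_group_add \<Rightarrow> 'v) \<Rightarrow> 'v topology \<Rightarrow> 'v set \<Rightarrow> bool"
  where "barrel s X A \<longleftrightarrow>
    closedin X A \<and> absolutely_convex s A \<and> (\<forall>x\<in>topspace X. absorbs s A {x})"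

definition quasi_barrelled ::
    "('k::real_or_complex \<Rightarrow> 'v::ab_group_add \<Rightarrow> 'v) \<Rightarrow> 'v topology \<Rightarrow> bool"
  where "quasi_barrelled s X \<longleftrightarrow> (\<forall>A. barrel s X A \<and> bornivorous s X A \<longrightarrow> zero_nhd X A)"

definition bornological ::
    "('k::real_or_complex \<Rightarrow> 'v::ab_group_add \<Rightarrow> 'v) \<Rightarrow> 'v topology \<Rightarrow> bool"
  where "bornological s X \<longleftrightarrow>
    (\<forall>A. absolutely_convex s A \<and> bornivorous s X A \<longrightarrow> zero_nhd X A)"

definition cauchy_filter_in :: "'v::ab_group_add topology \<Rightarrow> 'v filter \<Rightarrow> bool"
  where "cauchy_filter_in X \<F> \<longleftrightarrow>
    (\<forall>U. zero_nhd X U \<longrightarrow> (\<forall>\<^sub>F (x, y) in \<F> \<times>\<^sub>F \<F>. x - y \<in> U))"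

definition complete_in :: "'v::ab_group_add topology \<Rightarrow> 'v set \<Rightarrow> bool"
  where "complete_in X A \<longleftrightarrow>
    (\<forall>\<F>. \<F> \<noteq> bot \<and> \<F> \<le> principal A \<and> cauchy_filter_in X \<F> \<longrightarrow>
      (\<exists>x\<in>A. limitin X (\<lambda>z. z) x \<F>))"

definition complete_lcs :: "'v::ab_group_add topology \<Rightarrow> bool"
  where "complete_lcs X \<longleftrightarrow> complete_in X (topspace X)"

definition quasi_complete_lcs ::
    "('k::real_or_complex \<Rightarrow> 'v::ab_group_add \<Rightarrow> 'v) \<Rightarrow> 'v topology \<Rightarrow> bool"
  where "quasi_complete_lcs s X \<longleftrightarrow>
    (\<forall>A. closedin X A \<and> bounded_in s X A \<longrightarrow> complete_in X A)"


section \<open>Seminorms\<close>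

definition seminorm_on ::
    "('k::real_or_complex \<Rightarrow> 'v::ab_group_add \<Rightarrow> 'v) \<Rightarrow> 'v set \<Rightarrow> ('v \<Rightarrow> real) \<Rightarrow> bool"
  where "seminorm_on s V p \<longleftrightarrow>
    (\<forall>x\<in>V. 0 \<le> p x) \<and> (\<forall>x\<in>V. \<forall>y\<in>V. p (x + y) \<le> p x + p y) \<and>
    (\<forall>a. \<forall>x\<in>V. p (s a x) = norm a * p x)"

text \<open>The topology on the linear subspace \<open>V\<close> given by a family \<open>P\<close> of seminorms, with the
  seminorm balls as a subbase. Inserting \<open>V\<close> only matters for empty \<open>P\<close>.\<close>

definition seminorm_topology :: "'v::ab_group_add set \<Rightarrow> ('v \<Rightarrow> real) set \<Rightarrow> 'v topology"
  where "seminorm_topology V P =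
    topology_generated_by
      (insert V {{y \<in> V. p (y - x) < \<epsilon>} | p x \<epsilon>. p \<in> P \<and> x \<in> V \<and> 0 < \<epsilon>})"

text \<open>No directedness is required; a fundamental system whose unit balls form a base of zero
  neighbourhoods up to scaling is a special case.\<close>

definition fundamental_system ::
    "('k::real_or_complex \<Rightarrow> 'v::ab_group_add \<Rightarrow> 'v) \<Rightarrow> 'v topology \<Rightarrow> ('v \<Rightarrow> real) set \<Rightarrow> bool"
  where "fundamental_system s X \<Gamma> \<longleftrightarrow>
    (\<forall>p\<in>\<Gamma>. seminorm_on s (topspace X) p) \<and> X = seminorm_topology (topspace X) \<Gamma>"


section \<open>Spaces of continuous linear maps\<close>

definition topological_isomorphism ::
    "('k::real_or_complex \<Rightarrow> 'v::ab_group_add \<Rightarrow> 'v) \<Rightarrow> 'v topology \<Rightarrow>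
     ('k \<Rightarrow> 'w::ab_group_add \<Rightarrow> 'w) \<Rightarrow> 'w topology \<Rightarrow> ('v \<Rightarrow> 'w) \<Rightarrow> bool"
  where "topological_isomorphism s X t Y h \<longleftrightarrow>
    homeomorphic_map X Y h \<and>
    (\<forall>x\<in>topspace X. \<forall>y\<in>topspace X. h (x + y) = h x + h y) \<and>
    (\<forall>a. \<forall>x\<in>topspace X. h (s a x) = t a (h x))"

text \<open>From here on the domain and codomain of a linear map are spaces whose underlying set is
  the whole type.\<close>

definition cont_linear_maps ::
    "('k::real_or_complex \<Rightarrow> 'y::ab_group_add \<Rightarrow> 'y) \<Rightarrow> 'y topology \<Rightarrow>
     ('k \<Rightarrow> 'e::ab_group_add \<Rightarrow> 'e) \<Rightarrow> 'e topology \<Rightarrow> ('y \<Rightarrow> 'e) set"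
  where "cont_linear_maps sY Y sE E = {u. Vector_Spaces.linear sY sE u \<and> continuous_map Y E u}"

text \<open>Uniform convergence on bounded sets. Only nonempty sets are used, since the real
  supremum of the empty set is unspecified.\<close>

definition L_b ::
    "('k::real_or_complex \<Rightarrow> 'y::ab_group_add \<Rightarrow> 'y) \<Rightarrow> 'y topology \<Rightarrow>
     ('k \<Rightarrow> 'e::ab_group_add \<Rightarrow> 'e) \<Rightarrow> 'e topology \<Rightarrow> ('y \<Rightarrow> 'e) topology"
  where "L_b sY Y sE E =
    seminorm_topology (cont_linear_maps sY Y sE E)
      {\<lambda>u. SUP y\<in>B. p (u y) | B p. B \<noteq> {} \<and> bounded_in sY Y B \<and>
         seminorm_on sE (topspace E) p \<and> continuous_map E euclidean p}"

definition dual ::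
    "('k::real_or_complex \<Rightarrow> 'y::ab_group_add \<Rightarrow> 'y) \<Rightarrow> 'y topology \<Rightarrow> ('y \<Rightarrow> 'k) set"
  where "dual sY Y = cont_linear_maps sY Y (*) euclidean"

definition dual_b ::
    "('k::real_or_complex \<Rightarrow> 'y::ab_group_add \<Rightarrow> 'y) \<Rightarrow> 'y topology \<Rightarrow> ('y \<Rightarrow> 'k) topology"
  where "dual_b sY Y = L_b sY Y (*) euclidean"

definition polar ::
    "('k::real_or_complex \<Rightarrow> 'e::ab_group_add \<Rightarrow> 'e) \<Rightarrow> 'e topology \<Rightarrow> 'e set \<Rightarrow> ('e \<Rightarrow> 'k) set"
  where "polar sE E U = {e' \<in> dual sE E. \<forall>x\<in>U. norm (e' x) \<le> 1}"


section \<open>Strong linearisations and weak vector-valued functions\<close>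

text \<open>A locally convex Hausdorff space of scalar-valued functions on the set \<open>\<Omega>\<close>, given by the
  type \<open>'x\<close>, is a topology \<open>F\<close> on a subset of \<open>'x \<Rightarrow> 'k\<close>.\<close>

definition strong_linearisation ::
    "('x \<Rightarrow> 'k::real_or_complex) topology \<Rightarrow> ('x \<Rightarrow> 'y) \<Rightarrow>
     ('k \<Rightarrow> 'y::ab_group_add \<Rightarrow> 'y) \<Rightarrow> 'y topology \<Rightarrow> (('x \<Rightarrow> 'k) \<Rightarrow> 'y \<Rightarrow> 'k) \<Rightarrow> bool"
  where "strong_linearisation F \<delta> sY Y T \<longleftrightarrow>
    lc_hausdorff_space sY Y \<and> topspace Y = UNIV \<and>
    topological_isomorphism (fun_scale (*)) F (fun_scale (*)) (dual_b sY Y) T \<and>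
    (\<forall>f\<in>topspace F. T f \<circ> \<delta> = f)"

definition F_sigma ::
    "('x \<Rightarrow> 'k::real_or_complex) topology \<Rightarrow>
     ('k \<Rightarrow> 'e::ab_group_add \<Rightarrow> 'e) \<Rightarrow> 'e topology \<Rightarrow> ('x \<Rightarrow> 'e) set"
  where "F_sigma F sE E = {f. \<forall>e'\<in>dual sE E. e' \<circ> f \<in> topspace F}"

definition U_polar ::
    "('k::real_or_complex \<Rightarrow> 'e::ab_group_add \<Rightarrow> 'e) \<Rightarrow> 'e topology \<Rightarrow> ('e \<Rightarrow> real) \<Rightarrow> ('e \<Rightarrow> 'k) set"
  where "U_polar sE E p = polar sE E {x \<in> topspace E. p x < 1}"

definition sigma_seminorm ::
    "('k::real_or_complex \<Rightarrow> 'e::ab_group_add \<Rightarrow> 'e) \<Rightarrow> 'e topology \<Rightarrow>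
     (('x \<Rightarrow> 'k) \<Rightarrow> real) \<Rightarrow> ('e \<Rightarrow> real) \<Rightarrow> ('x \<Rightarrow> 'e) \<Rightarrow> real"
  where "sigma_seminorm sE E q p f = (SUP e'\<in>U_polar sE E p. q (e' \<circ> f))"

text \<open>Finiteness of the supremum is expressed by \<open>bdd_above\<close>.\<close>

definition F_sigma_b ::
    "('x \<Rightarrow> 'k::real_or_complex) topology \<Rightarrow> (('x \<Rightarrow> 'k) \<Rightarrow> real) set \<Rightarrow>
     ('k \<Rightarrow> 'e::ab_group_add \<Rightarrow> 'e) \<Rightarrow> 'e topology \<Rightarrow> ('e \<Rightarrow> real) set \<Rightarrow> ('x \<Rightarrow> 'e) topology"
  where "F_sigma_b F \<Gamma>\<^sub>F sE E \<Gamma>\<^sub>E =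
    seminorm_topology
      {f \<in> F_sigma F sE E. \<forall>q\<in>\<Gamma>\<^sub>F. \<forall>p\<in>\<Gamma>\<^sub>E. bdd_above ((\<lambda>e'. q (e' \<circ> f)) ` U_polar sE E p)}
      {sigma_seminorm sE E q p | q p. q \<in> \<Gamma>\<^sub>F \<and> p \<in> \<Gamma>\<^sub>E}"

end

theory Submission
  imports Defs
begin

text \<open>By Hahn--Banach, \<open>p x\<close> is the maximum of \<open>\<bar>e' x\<bar>\<close> over the polar of the unit ball of \<open>p\<close>.
  Since \<open>T (e' \<circ> u \<circ> \<delta>) = e' \<circ> u\<close>, interchanging the suprema over this polar and over a bounded set
  identifies the seminorms of the two spaces up to domination, in both directions.

  For surjectivity let \<open>f\<close> be given. The functionals \<open>T (e' \<circ> f)\<close> with \<open>e'\<close> in a polar are bounded in the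
  strong dual, hence equicontinuous because \<open>Y\<close> is quasi-barrelled. The set of all \<open>y\<close> for
  which some \<open>x\<close> in \<open>E\<close> satisfies \<open>e' x = T (e' \<circ> f) y\<close> for all \<open>e'\<close> is a subspace containing the
  points \<open>\<delta> x\<close>. It is dense, as a functional \<open>g\<close> vanishing on it satisfies \<open>g \<circ> \<delta> = 0\<close> and
  \<open>g = T (g \<circ> \<delta>)\<close>. By equicontinuity and the completeness of \<open>E\<close> it is closed, so it is \<open>Y\<close>, and
  \<open>y \<mapsto> x\<close> is the required map.

  A Cauchy filter of continuous linear maps converges uniformly on bounded sets to a linear map; this
  is continuous if \<open>Y\<close> is bornological, or if the filter lives on a bounded set and \<open>Y\<close> is
  quasi-barrelled.\<close>

section \<open>The Hahn--Banach theorem\<close>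

text \<open>\<open>L_b\<close> admits every continuous seminorm of \<open>E\<close>,
  \<open>F_sigma_b\<close> only the given families, and no family is assumed directed. Continuity of
  linear maps is therefore always expressed by \<open>dominated\<close>: a bound by a constant times
  a finite sum of members. In this form the homeomorphism \<open>T\<close> becomes two estimates
  whose constants do not depend on the functional inserted, and this uniformity over a polar is what
  interchanging the suprema needs.

  The obstacle to surjectivity is that \<open>e' \<mapsto> T (e' \<circ> f) y\<close> is at first
  only a function on the dual of \<open>E\<close>, and it has to be evaluation at a point of
  \<open>E\<close>. Norming functionals bound the distance between the points found for
  \<open>z\<close> and \<open>z'\<close> by values \<open>T (e' \<circ> f) (z - z')\<close>;
  equicontinuity makes these uniformly small, so approximating \<open>y\<close> yields a Cauchy
  filter in \<open>E\<close>.

  For \<open>Y\<close> only a topology is given. Density there goes through gauges of convex sets,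
  which may fail to be symmetric; hence Hahn-Banach is proved for positively homogeneous
  functionals, over real and complex scalars at once.\<close>

lemma real_or_complex_cases:
  fixes thesis :: bool
  assumes "(\<forall>z::'k::real_or_complex. \<exists>a. z = of_real a) \<Longrightarrow> thesis"
    and "\<And>i::'k. i * i = - 1 \<Longrightarrow> \<forall>z. \<exists>a b. z = of_real a + of_real b * i \<Longrightarrow>
      \<forall>a b. norm (of_real a + of_real b * i) = sqrt (a\<^sup>2 + b\<^sup>2) \<Longrightarrow> thesis"
  shows thesis
  using real_or_complex[where 'a='k]
proof
  assume "\<forall>z::'k. \<exists>a. z = a *\<^sub>R 1"
  then show thesis using assms(1) by (simp add: of_real_def)
next
  assume "\<exists>i::'k. i * i = - 1 \<and>
        (\<forall>z. \<exists>a b. z = a *\<^sub>R 1 + b *\<^sub>R i \<and> norm z = sqrt (a\<^sup>2 + b\<^sup>2))"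
  then obtain i :: 'k where i: "i * i = - 1"
    and rep: "\<And>z. \<exists>a b. z = of_real a + of_real b * i \<and> norm z = sqrt (a\<^sup>2 + b\<^sup>2)"
    by (auto simp: of_real_def)
  \<comment> \<open>The class axiom gives the norm for one representation of each scalar only. The
    representation is unique: squaring the difference of two of them and using
    \<open>i * i = - 1\<close> makes a sum of two real squares vanish.\<close>
  have "norm (of_real a + of_real b * i) = sqrt (a\<^sup>2 + b\<^sup>2)" for a b
  proof -
    obtain a' b' where e: "of_real a + of_real b * i = of_real a' + of_real b' * i"
      "norm (of_real a + of_real b * i) = sqrt (a'\<^sup>2 + b'\<^sup>2)"
      using rep by blast
    then have d: "of_real (a - a') = of_real (b' - b) * i"
      by (simp add: algebra_simps)
    then have "of_real (a - a') * of_real (a - a') = (of_real (b' - b) * i) * (of_real (b' - b) * i)"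
      by simp
    also have "\<dots> = of_real (b' - b) * of_real (b' - b) * (i * i)"
      by (simp only: ac_simps)
    finally have "(of_real ((a - a')\<^sup>2 + (b' - b)\<^sup>2) :: 'k) = of_real 0"
      using i by (simp add: power2_eq_square)
    then have "(a - a')\<^sup>2 + (b' - b)\<^sup>2 = 0"
      by (simp only: of_real_eq_iff)
    then have "a = a'" "b = b'"
      by (simp_all add: sum_power2_eq_zero_iff)
    then show ?thesis using e by simp
  qed
  then show thesis using assms(2) i rep by blast
qed

lemma linear_mapI:
  fixes s1 :: "'k::field \<Rightarrow> 'v::ab_group_add \<Rightarrow> 'v" and s2 :: "'k \<Rightarrow> 'w::ab_group_add \<Rightarrow> 'w"
  assumes "vector_space s1" "vector_space s2"
    "\<And>x y. f (x + y) = f x + f y" "\<And>a x. f (s1 a x) = s2 a (f x)"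
  shows "Vector_Spaces.linear s1 s2 f"
  unfolding linear_iff_module_hom module_hom_iff using assms
  by (auto simp: module_iff_vector_space)

lemma linear_mapD:
  assumes "Vector_Spaces.linear s1 s2 f"
  shows "f (x + y) = f x + f y" "f (s1 a x) = s2 a (f x)" "f (x - y) = f x - f y" "f 0 = 0"
    "f (- x) = - f x"
proof -
  interpret Vector_Spaces.linear s1 s2 f by fact
  show "f (x + y) = f x + f y" "f (s1 a x) = s2 a (f x)" "f (x - y) = f x - f y" "f 0 = 0"
     "f (- x) = - f x"
    by (auto simp: add scale diff zero neg)
qed

lemma vector_space_mult: "vector_space ((*) :: 'k::field \<Rightarrow> 'k \<Rightarrow> 'k)"
  by unfold_locales (auto simp: algebra_simps)

text \<open>In the complex case \<open>g z = f z - i f (i z)\<close>, so \<open>f\<close> is the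
  real part of \<open>g\<close>. Since \<open>norm (g z)\<close> is the value of \<open>f\<close> at
  a rotation of \<open>z\<close> by a unit scalar, upper bounds for \<open>f\<close> that are
  invariant under such rotations pass to \<open>norm (g z)\<close>.\<close>

lemma real_linear_imp_linear:
  fixes s :: "'k::real_or_complex \<Rightarrow> 'v::ab_group_add \<Rightarrow> 'v" and f :: "'v \<Rightarrow> real"
  assumes vs: "vector_space s"
    and add: "\<And>x y. f (x + y) = f x + f y"
    and scale: "\<And>r x. f (s (of_real r) x) = r * f x"
  obtains g where "Vector_Spaces.linear s (*) g"
    "\<And>z. \<exists>c. norm c = 1 \<and> norm (g z) = f (s c z)" "\<And>z. f z \<le> norm (g z)"
proof -
  interpret vector_space s by fact
  \<comment> \<open>\<open>R\<close> is the real part of a scalar; the remaining argument uses only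
    the listed properties of \<open>g\<close> and \<open>R\<close> and so does not distinguish the
    two fields.\<close>
  obtain g and R :: "'k \<Rightarrow> real" where g: "Vector_Spaces.linear s (*) g" and R: "\<And>r. R (of_real r) = r"
    and Rg: "\<And>z. R (g z) = f z" and R_le: "\<And>k. R k \<le> norm k"
  proof (rule real_or_complex_cases)
    assume a: "\<forall>z::'k. \<exists>a. z = of_real a"
    define R :: "'k \<Rightarrow> real" where "R z = (SOME a. z = of_real a)" for z
    have z: "of_real (R z) = z" for z
      unfolding R_def using a by (metis (mono_tags, lifting) someI_ex)
    show thesis
    proof (rule that[of "\<lambda>z. of_real (f z)" R])
      show R: "R (of_real r) = r" for r
        using z[of "of_real r"] by simp
      then show "R (of_real (f z)) = f z" for z .
      show "R k \<le> norm k" for k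
        by (metis abs_ge_self norm_of_real z)
      show "Vector_Spaces.linear s (*) (\<lambda>z. of_real (f z) :: 'k)"
      proof (rule linear_mapI[OF vs vector_space_mult])
        show "(of_real (f (s a x)) :: 'k) = a * of_real (f x)" for a x
          using scale[of "R a" x] by (simp add: z)
      qed (simp add: add)
    qed
  next
    fix i :: 'k
    assume i: "i * i = - 1" and rep: "\<forall>z. \<exists>a b. z = of_real a + of_real b * i"
      and nm: "\<forall>a b. norm (of_real a + of_real b * i) = sqrt (a\<^sup>2 + b\<^sup>2)"
    define R :: "'k \<Rightarrow> real" where "R z = (SOME a. \<exists>b. z = of_real a + of_real b * i)" for z
    define g where "g z = of_real (f z) - i * of_real (f (s i z))" for z
    have Rz: "R (of_real a + of_real b * i) = a" for a b
      unfolding R_def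
    proof (rule some_equality)
      fix a' assume "\<exists>b'. of_real a + of_real b * i = of_real a' + of_real b' * i"
      then obtain b' where "of_real (a - a') + of_real (b - b') * i = 0"
        by (auto simp: algebra_simps)
      then have "sqrt ((a - a')\<^sup>2 + (b - b')\<^sup>2) = 0" using nm by (metis norm_zero)
      then show "a' = a" by (simp add: sum_power2_eq_zero_iff)
    qed auto
    show thesis
    proof (rule that[of g R])
      show "R (of_real r) = r" for r using Rz[of r 0] by simp
      show "R (g z) = f z" for z
        using Rz[of "f z" "- f (s i z)"] by (simp add: g_def algebra_simps)
      show "R k \<le> norm k" for k
      proof -
        obtain a b where k: "k = of_real a + of_real b * i" using rep by blast
        have "a \<le> sqrt (a\<^sup>2 + b\<^sup>2)"
          by (meson abs_ge_self dual_order.trans real_sqrt_sum_squares_ge1)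
        then show ?thesis by (simp add: k Rz nm)
      qed
      show "Vector_Spaces.linear s (*) g"
      proof (rule linear_mapI[OF vs vector_space_mult])
        show gadd: "g (x + y) = g x + g y" for x y
          by (simp add: g_def add scale_right_distrib algebra_simps)
        have gr: "g (s (of_real r) x) = of_real r * g x" for r x
          using scale[of r "s i x"]
          by (simp add: g_def scale algebra_simps)
        have gi: "g (s i x) = i * g x" for x
        proof -
          have "f (s (- 1) x) = - f x" using scale[of "-1" x] by simp
          then have "g (s i x) = of_real (f (s i x)) + i * of_real (f x)"
            by (simp add: g_def i)
          also have "\<dots> = i * of_real (f x) - (i * i) * of_real (f (s i x))"
            by (simp add: i)
          finally show ?thesis by (simp add: g_def algebra_simps)
        qed
        show "g (s a x) = a * g x" for a x
        proof -
          obtain r t where a: "a = of_real r + of_real t * i" using rep by blast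
          have "s a x = s (of_real r) x + s (of_real t) (s i x)"
            by (simp add: a scale_left_distrib)
          then have "g (s a x) = of_real r * g x + of_real t * (i * g x)"
            by (simp only: gadd gr gi)
          then show ?thesis by (simp add: a algebra_simps)
        qed
      qed
    qed
  qed
  show thesis
  proof (rule that[OF g])
    show "f z \<le> norm (g z)" for z using R_le[of "g z"] by (simp add: Rg)
    show "\<exists>c. norm c = 1 \<and> norm (g z) = f (s c z)" for z
    proof (cases "g z = 0")
      case True
      then show ?thesis
        using R[of 0] Rg[of z] by (intro exI[of _ 1]) simp
    next
      case False
      \<comment> \<open>The phase that rotates \<open>g z\<close> onto the nonnegative real axis,
        where the real part equals the norm.\<close>
      define c where "c = of_real (norm (g z)) / g z"
      have "g (s c z) = of_real (norm (g z))"
        using False by (simp add: linear_mapD(2)[OF g] c_def)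
      then have "f (s c z) = norm (g z)" using R Rg by metis
      moreover have "norm c = 1" using False by (simp add: c_def norm_divide)
      ultimately show ?thesis by auto
    qed
  qed
qed

text \<open>Homogeneity is asked for positive reals only, so that gauges of convex sets that are not
  balanced are included.\<close>

definition sublinear :: "('k::real_or_complex \<Rightarrow> 'v::ab_group_add \<Rightarrow> 'v) \<Rightarrow> ('v \<Rightarrow> real) \<Rightarrow> bool"
  where "sublinear s p \<longleftrightarrow>
    (\<forall>x y. p (x + y) \<le> p x + p y) \<and> (\<forall>r x. 0 < r \<longrightarrow> p (s (of_real r) x) = r * p x)"

text \<open>The inequality for the factor \<open>1 / r\<close>, applied to the vector already scaled
  by \<open>r\<close>, is the reverse inequality.\<close>

lemma sublinear_scaleI:
  assumes vs: "vector_space s"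
    and le: "\<And>r x. 0 < r \<Longrightarrow> p (s (of_real r) x) \<le> r * p x"
    and "0 < r"
  shows "p (s (of_real r) x) = r * (p x :: real)"
proof (rule antisym)
  interpret vector_space s by fact
  have "p (s (of_real (1 / r)) (s (of_real r) x)) \<le> 1 / r * p (s (of_real r) x)"
    using le \<open>0 < r\<close> by (metis zero_less_divide_1_iff)
  moreover have "s (of_real (1 / r)) (s (of_real r) x) = x"
    using \<open>0 < r\<close> by (simp flip: of_real_mult)
  ultimately show "r * p x \<le> p (s (of_real r) x)"
    using \<open>0 < r\<close> by (simp add: field_simps)
qed (use le \<open>0 < r\<close> in simp)

lemma sublinear_zero:
  assumes "vector_space s" "sublinear s p"
  shows "p 0 = 0"
proof -
  interpret vector_space s by fact
  have "p (s (of_real 2) 0) = 2 * p 0"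
    using assms(2) unfolding sublinear_def by (metis zero_less_numeral)
  then show ?thesis by simp
qed

lemma sublinear_ge:
  assumes "vector_space s" "sublinear s p"
  shows "- p (- x) \<le> p x"
proof -
  have "p (x + - x) \<le> p x + p (- x)" using assms(2) unfolding sublinear_def by blast
  then show ?thesis using sublinear_zero[OF assms] by simp
qed

text \<open>The Hahn--Banach theorem is obtained by applying Zorn's lemma to everywhere defined sublinear
  functionals rather than to partial linear ones: the functional
  \<open>q x = inf {p (x + t y) - t p y | t \<ge> 0}\<close> below \<open>p\<close> shows that a minimal \<open>p\<close> is odd,
  hence linear.\<close>

lemma sublinear_reflect:
  fixes s :: "'k::real_or_complex \<Rightarrow> 'v::ab_group_add \<Rightarrow> 'v"
  assumes vs: "vector_space s" and p: "sublinear s p"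
  obtains q where "sublinear s q" "\<And>x. q x \<le> p x" "q (- y) \<le> - p y"
proof -
  interpret vector_space s by fact
  have padd: "p (a + b) \<le> p a + p b" for a b using p by (simp add: sublinear_def)
  have psc: "0 \<le> r \<Longrightarrow> p (s (of_real r) x) = r * p x" for r x
    using p sublinear_zero[OF vs p] by (cases "r = 0") (auto simp: sublinear_def)
  define S where "S x = (\<lambda>t. p (x + s (of_real t) y) - t * p y) ` {0..}" for x
  define q where "q x = Inf (S x)" for x
  have bdd: "bdd_below (S x)" for x
  proof (rule bdd_belowI)
    fix a assume "a \<in> S x"
    then obtain t where t: "0 \<le> t" "a = p (x + s (of_real t) y) - t * p y" by (auto simp: S_def)
    \<comment> \<open>Since \<open>t y = (x + t y) + (- x)\<close>, subadditivity bounds every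
      member of \<open>S x\<close> below by \<open>- p (- x)\<close>, so the infimum is
      finite.\<close>
    have "p ((x + s (of_real t) y) + (- x)) \<le> p (x + s (of_real t) y) + p (- x)" by (rule padd)
    then show "- p (- x) \<le> a" using t psc by simp
  qed
  have ne: "S x \<noteq> {}" for x by (auto simp: S_def)
  have q_le: "q x \<le> p (x + s (of_real t) y) - t * p y" if "0 \<le> t" for x t
    unfolding q_def using that by (intro cInf_lower bdd) (auto simp: S_def)
  have q_ge: "b \<le> q x" if "\<And>t. 0 \<le> t \<Longrightarrow> b \<le> p (x + s (of_real t) y) - t * p y" for x b
    unfolding q_def using that by (intro cInf_greatest ne) (auto simp: S_def)
  show thesis
  proof (rule that[of q])
    show "q x \<le> p x" for x using q_le[of 0 x] by simp
    show "q (- y) \<le> - p y" using q_le[of 1 "- y"] sublinear_zero[OF vs p] by simp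
    have "q (a + b) \<le> q a + q b" for a b
    proof -
      \<comment> \<open>Admissible parameters add up: \<open>t\<close> for \<open>a\<close> and
        \<open>u\<close> for \<open>b\<close> give \<open>t + u\<close> for \<open>a + b\<close>.
        The infima over \<open>t\<close> and over \<open>u\<close> are then taken one after the
        other.\<close>
      have "q (a + b) - (p (b + s (of_real u) y) - u * p y) \<le> q a" if "0 \<le> u" for u
      proof (rule q_ge)
        fix t :: real assume "0 \<le> t"
        have "q (a + b) \<le> p (a + b + s (of_real (t + u)) y) - (t + u) * p y"
          using \<open>0 \<le> t\<close> \<open>0 \<le> u\<close> by (intro q_le) simp
        also have "a + b + s (of_real (t + u)) y = (a + s (of_real t) y) + (b + s (of_real u) y)"
          by (simp add: scale_left_distrib algebra_simps)
        also have "p \<dots> \<le> p (a + s (of_real t) y) + p (b + s (of_real u) y)" by (rule padd)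
        finally show "q (a + b) - (p (b + s (of_real u) y) - u * p y)
            \<le> p (a + s (of_real t) y) - t * p y"
          by (simp add: algebra_simps)
      qed
      then have "q (a + b) - q a \<le> q b" by (intro q_ge) (simp add: algebra_simps)
      then show ?thesis by simp
    qed
    moreover have "q (s (of_real r) x) = r * q x" if "0 < r" for r x
      using _ that
    proof (rule sublinear_scaleI[OF vs])
      fix r x assume r: "0 < (r::real)"
      have "q (s (of_real r) x) / r \<le> q x"
      proof (rule q_ge)
        fix t :: real assume "0 \<le> t"
        have "q (s (of_real r) x) \<le> p (s (of_real r) x + s (of_real (r * t)) y) - (r * t) * p y"
          using \<open>0 \<le> t\<close> r by (intro q_le) simp
        also have "s (of_real r) x + s (of_real (r * t)) y = s (of_real r) (x + s (of_real t) y)"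
          by (simp add: scale_right_distrib)
        also have "p (s (of_real r) (x + s (of_real t) y)) = r * p (x + s (of_real t) y)"
          using r psc by simp
        finally show "q (s (of_real r) x) / r \<le> p (x + s (of_real t) y) - t * p y"
          using r by (simp add: field_simps)
      qed
      then show "q (s (of_real r) x) \<le> r * q x" using r by (simp add: field_simps)
    qed
    ultimately show "sublinear s q" by (simp add: sublinear_def)
  qed
qed

text \<open>A chain has its pointwise infimum as lower bound. It is finite because each member
  \<open>a\<close> below \<open>p0\<close> satisfies
  \<open>- p0 (- x) \<le> - a (- x) \<le> a x\<close>, and subadditive because any two members of a
  chain are comparable.\<close>

lemma ex_minimal_sublinear:
  fixes s :: "'k::real_or_complex \<Rightarrow> 'v::ab_group_add \<Rightarrow> 'v"
  assumes vs: "vector_space s" and p0: "sublinear s p0"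
  obtains p where "sublinear s p" "p \<le> p0" "\<And>q. sublinear s q \<Longrightarrow> q \<le> p \<Longrightarrow> q = p"
proof -
  define A where "A = {p. sublinear s p \<and> p \<le> p0}"
  have "\<exists>m\<in>A. \<forall>a\<in>A. a \<le> m \<longrightarrow> a = m"
  proof (rule predicate_Zorn[where P = "\<lambda>p q. q \<le> p"])
    show "partial_order_on A (relation_of (\<lambda>p q. q \<le> p) A)"
      by (rule partial_order_on_relation_ofI) auto
    fix C assume C: "C \<in> Chains (relation_of (\<lambda>p q. q \<le> p) A)"
    show "\<exists>u\<in>A. \<forall>a\<in>C. u \<le> a"
    proof (cases "C = {}")
      case True
      then show ?thesis using p0 by (auto simp: A_def)
    next
      case False
      have CA: "C \<subseteq> A" and total: "\<And>a b. a \<in> C \<Longrightarrow> b \<in> C \<Longrightarrow> a \<le> b \<or> b \<le> a"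
        using C by (auto simp: Chains_def relation_of_def)
      define u where "u x = (INF a\<in>C. a x)" for x
      have bdd: "bdd_below ((\<lambda>a. a x) ` C)" for x
      proof (rule bdd_belowI2)
        fix a assume "a \<in> C"
        then have "sublinear s a" "a \<le> p0" using CA by (auto simp: A_def)
        then show "- p0 (- x) \<le> a x"
          using sublinear_ge[OF vs, of a x] by (meson le_funD neg_le_iff_le order_trans)
      qed
      have u_le: "u x \<le> a x" if "a \<in> C" for a x
        unfolding u_def using that by (intro cINF_lower bdd)
      have u_ge: "b \<le> u x" if "\<And>a. a \<in> C \<Longrightarrow> b \<le> a x" for x b
        unfolding u_def using that by (intro cINF_greatest False)
      have "u (x + y) \<le> u x + u y" for x y
      proof -
        have *: "u (x + y) - b y \<le> u x" if b: "b \<in> C" for b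
        proof (rule u_ge)
          fix a assume a: "a \<in> C"
          have sub: "sublinear s a" "sublinear s b" using CA a b by (auto simp: A_def)
          \<comment> \<open>The smaller of \<open>a\<close> and \<open>b\<close> is subadditive and
            lies below both, so it estimates \<open>u (x + y)\<close> by the mixed sum.\<close>
          from total[OF a b] have "u (x + y) \<le> a x + b y"
          proof
            assume "a \<le> b"
            then have "a (x + y) \<le> a x + b y"
              using sub(1) unfolding sublinear_def by (smt (verit, best) le_funD)
            then show ?thesis using u_le[OF a, of "x + y"] by simp
          next
            assume "b \<le> a"
            then have "b (x + y) \<le> a x + b y"
              using sub(2) unfolding sublinear_def by (smt (verit, best) le_funD)
            then show ?thesis using u_le[OF b, of "x + y"] by simp
          qed
          then show "u (x + y) - b y \<le> a x" by simp
        qed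
        have "u (x + y) - u x \<le> u y"
          by (rule u_ge) (use * in \<open>fastforce simp: algebra_simps\<close>)
        then show ?thesis by simp
      qed
      moreover have "u (s (of_real r) x) = r * u x" if "0 < r" for r x
        using _ that
      proof (rule sublinear_scaleI[OF vs])
        fix r x assume r: "0 < (r::real)"
        have "u (s (of_real r) x) / r \<le> u x"
        proof (rule u_ge)
          fix a assume a: "a \<in> C"
          then have "sublinear s a" using CA by (auto simp: A_def)
          then have "u (s (of_real r) x) \<le> r * a x"
            using u_le[OF a, of "s (of_real r) x"] r by (simp add: sublinear_def)
          then show "u (s (of_real r) x) / r \<le> a x" using r by (simp add: field_simps)
        qed
        then show "u (s (of_real r) x) \<le> r * u x" using r by (simp add: field_simps)
      qed
      ultimately have "sublinear s u" by (simp add: sublinear_def)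
      moreover have "u \<le> p0"
      proof -
        obtain a where "a \<in> C" using False by blast
        then have "u x \<le> a x" "a x \<le> p0 x" for x
          using u_le CA by (auto simp: A_def le_fun_def)
        then show ?thesis unfolding le_fun_def by (meson order_trans)
      qed
      ultimately show ?thesis using u_le by (auto simp: A_def le_fun_def)
    qed
  qed
  then show thesis using that by (auto simp: A_def) 
qed

text \<open>Equality at the prescribed point comes from reflecting \<open>p\<close> in
  \<open>y\<close> before minimising: the minimal \<open>f\<close> inherits
  \<open>f (- y) \<le> - p y\<close>, and oddness turns this into
  \<open>p y \<le> f y\<close>.\<close>

lemma hahn_banach_sublinear:
  fixes s :: "'k::real_or_complex \<Rightarrow> 'v::ab_group_add \<Rightarrow> 'v"
  assumes vs: "vector_space s" and p: "sublinear s p"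
  obtains f where "\<And>x y. f (x + y) = f x + f y" "\<And>r x. f (s (of_real r) x) = r * f x"
    "\<And>x. f x \<le> p x" "f y = p y"
proof -
  interpret vector_space s by fact
  obtain q where q: "sublinear s q" "\<And>x. q x \<le> p x" "q (- y) \<le> - p y"
    using sublinear_reflect[OF vs p] by metis
  obtain f where f: "sublinear s f" "f \<le> q" "\<And>q. sublinear s q \<Longrightarrow> q \<le> f \<Longrightarrow> q = f"
    using ex_minimal_sublinear[OF vs q(1)] by metis
  have minus: "f (- x) = - f x" for x
  proof (rule antisym)
    obtain g where g: "sublinear s g" "\<And>z. g z \<le> f z" "g (- x) \<le> - f x"
      using sublinear_reflect[OF vs f(1)] by metis
    then have "g = f" using f(3) by (simp add: le_fun_def)
    then show "f (- x) \<le> - f x" using g by simp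
    show "- f x \<le> f (- x)" using sublinear_ge[OF vs f(1), of "- x"] by simp
  qed
  have le: "f (x + y) \<le> f x + f y" for x y using f(1) by (simp add: sublinear_def)
  have add: "f (x + y) = f x + f y" for x y
    using le[of x y] le[of "x + y" "- y"] minus[of y] by simp
  have pos: "f (s (of_real r) x) = r * f x" if "0 < r" for r x
    using f(1) that by (simp add: sublinear_def)
  have scale: "f (s (of_real r) x) = r * f x" for r x
  proof -
    consider "0 < r" | "r = 0" | "0 < - r" by linarith
    then show ?thesis
    proof cases
      case 3
      then have "f (s (of_real (- r)) x) = - r * f x" by (rule pos)
      then show ?thesis by (simp add: minus)
    qed (use pos sublinear_zero[OF vs f(1)] in auto)
  qed
  have le_p: "f x \<le> p x" for x using f(2) q(2) by (meson le_funD order_trans)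
  have "f (- y) \<le> - p y" using f(2) q(3) by (meson le_funD order_trans)
  then have "f y = p y" using le_p[of y] minus[of y] by simp
  then show thesis using that add scale le_p by blast
qed

section \<open>Topologies generated by seminorms\<close>

lemma vector_space_fun_scale:
  assumes "vector_space s"
  shows "vector_space (fun_scale s)"
proof -
  interpret vector_space s by fact
  show ?thesis
    by unfold_locales (auto simp: fun_scale_def scale_right_distrib scale_left_distrib)
qed

lemma seminorm_onD:
  assumes "seminorm_on s V p"
  shows "x \<in> V \<Longrightarrow> 0 \<le> p x" "x \<in> V \<Longrightarrow> y \<in> V \<Longrightarrow> p (x + y) \<le> p x + p y"
    "x \<in> V \<Longrightarrow> p (s a x) = norm a * p x"
  using assms by (auto simp: seminorm_on_def)

text \<open>Serves both kinds of suprema, over a bounded set of \<open>Y\<close> and over a polar in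
  the dual of \<open>E\<close>. Nonemptiness and boundedness make the real \<open>SUP\<close> a true
  supremum.\<close>

lemma seminorm_on_SUP:
  fixes r :: "'i \<Rightarrow> 'v::ab_group_add \<Rightarrow> real"
  assumes I: "I \<noteq> {}" and r: "\<And>i. i \<in> I \<Longrightarrow> seminorm_on s V (r i)"
    and bdd: "\<And>x. x \<in> V \<Longrightarrow> bdd_above ((\<lambda>i. r i x) ` I)"
    and scale: "\<And>a x. x \<in> V \<Longrightarrow> s a x \<in> V"
  shows "seminorm_on s V (\<lambda>x. SUP i\<in>I. r i x)"
  unfolding seminorm_on_def
proof (intro conjI ballI allI)
  note upper = cSUP_upper[OF _ bdd]
  note rD = seminorm_onD[OF r]
  {
    fix x assume x: "x \<in> V"
    obtain i where "i \<in> I" using I by blast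
    then show "0 \<le> (SUP i\<in>I. r i x)"
      using rD(1)[of i x] upper[of i x] x by fastforce
  next
    fix x y assume xy: "x \<in> V" "y \<in> V"
    show "(SUP i\<in>I. r i (x + y)) \<le> (SUP i\<in>I. r i x) + (SUP i\<in>I. r i y)"
    proof (rule cSUP_least[OF I])
      fix i assume i: "i \<in> I"
      show "r i (x + y) \<le> (SUP i\<in>I. r i x) + (SUP i\<in>I. r i y)"
        using rD(2)[OF i xy] upper[OF i xy(1)] upper[OF i xy(2)] by simp
    qed
  next
    fix a x assume x: "x \<in> V"
    show "(SUP i\<in>I. r i (s a x)) = norm a * (SUP i\<in>I. r i x)"
    proof (rule antisym)
      show "(SUP i\<in>I. r i (s a x)) \<le> norm a * (SUP i\<in>I. r i x)"
        by (rule cSUP_least[OF I]) (simp add: rD(3) x upper mult_left_mono)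
      show "norm a * (SUP i\<in>I. r i x) \<le> (SUP i\<in>I. r i (s a x))"
      proof (cases "a = 0")
        case True
        obtain i where i: "i \<in> I" using I by blast
        then show ?thesis using True rD(3)[OF i x, of a] upper[OF i scale[OF x], of a] by simp
      next
        case False
        have "(SUP i\<in>I. r i x) \<le> (SUP i\<in>I. r i (s a x)) / norm a"
        proof (rule cSUP_least[OF I])
          fix i assume i: "i \<in> I"
          have "norm a * r i x \<le> (SUP i\<in>I. r i (s a x))"
            using rD(3)[OF i x, of a] upper[OF i scale[OF x], of a] by simp
          then show "r i x \<le> (SUP i\<in>I. r i (s a x)) / norm a"
            using False by (simp add: field_simps)
        qed
        then show ?thesis using False by (simp add: field_simps)
      qed
    qed
  }
qed

text \<open>For a seminorm \<open>q\<close> this is continuity in quantitative form. Finite sums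
  stand in for single members because the families are not assumed directed.\<close>

definition dominated :: "'v set \<Rightarrow> ('v \<Rightarrow> real) set \<Rightarrow> ('v \<Rightarrow> real) \<Rightarrow> bool"
  where "dominated V P q \<longleftrightarrow>
    (\<exists>G C. finite G \<and> G \<subseteq> P \<and> 0 \<le> C \<and> (\<forall>x\<in>V. q x \<le> C * (\<Sum>p\<in>G. p x)))"

locale seminorm_family = vector_space s
  for s :: "'k::real_or_complex \<Rightarrow> 'v::ab_group_add \<Rightarrow> 'v" +
  fixes V :: "'v set" and P :: "('v \<Rightarrow> real) set"
  assumes subspace: "subspace V"
    and seminorm: "p \<in> P \<Longrightarrow> seminorm_on s V p"
begin

lemma topspace [simp]: "topspace (seminorm_topology V P) = V"
  by (auto simp: seminorm_topology_def)

lemma mem [simp]: "0 \<in> V" "x \<in> V \<Longrightarrow> y \<in> V \<Longrightarrow> x - y \<in> V" "x \<in> V \<Longrightarrow> y \<in> V \<Longrightarrow> x + y \<in> V"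
    "x \<in> V \<Longrightarrow> s a x \<in> V"
  using subspace by (auto simp: subspace_0 subspace_diff subspace_add subspace_scale)

lemma seminorm_facts:
  assumes "seminorm_on s V q"
  shows "q 0 = 0" "x \<in> V \<Longrightarrow> y \<in> V \<Longrightarrow> q (x - y) = q (y - x)"
    "x \<in> V \<Longrightarrow> y \<in> V \<Longrightarrow> z \<in> V \<Longrightarrow> q (x - z) \<le> q (x - y) + q (y - z)"
proof -
  show "q 0 = 0" using seminorm_onD(3)[OF assms, of 0 0] by simp
  show "q (x - y) = q (y - x)" if "x \<in> V" "y \<in> V"
    using seminorm_onD(3)[OF assms, of "y - x" "- 1"] that by simp
  show "q (x - z) \<le> q (x - y) + q (y - z)" if "x \<in> V" "y \<in> V" "z \<in> V"
    using seminorm_onD(2)[OF assms, of "x - y" "y - z"] that by simp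
qed

lemma seminorm_zero: "p \<in> P \<Longrightarrow> p 0 = 0"
  using seminorm_facts(1)[OF seminorm] .

lemma center_mem_ball:
  assumes "G \<subseteq> P" "0 < \<epsilon>" "x \<in> V"
  shows "x \<in> {y \<in> V. \<forall>p\<in>G. p (y - x) < \<epsilon>}"
proof -
  have "p (x - x) < \<epsilon>" if "p \<in> G" for p
    using seminorm_zero[of p] that assms by (simp add: subsetD)
  then show ?thesis using assms by blast
qed

lemma openin_ball:
  assumes "finite G" "G \<subseteq> P" "x \<in> V" "0 < \<epsilon>"
  shows "openin (seminorm_topology V P) {y \<in> V. \<forall>p\<in>G. p (y - x) < \<epsilon>}"
  using assms(1,2)
proof induction
  case empty
  have "openin (seminorm_topology V P) V"
    unfolding seminorm_topology_def by (rule topology_generated_by_Basis) simp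
  then show ?case by simp
next
  case (insert p G)
  have "openin (seminorm_topology V P) {y \<in> V. p (y - x) < \<epsilon>}"
    unfolding seminorm_topology_def
    using insert.prems assms(3,4) by (intro topology_generated_by_Basis) blast
  then have "openin (seminorm_topology V P)
      ({y \<in> V. p (y - x) < \<epsilon>} \<inter> {y \<in> V. \<forall>p\<in>G. p (y - x) < \<epsilon>})"
    using insert by blast
  also have "{y \<in> V. p (y - x) < \<epsilon>} \<inter> {y \<in> V. \<forall>p\<in>G. p (y - x) < \<epsilon>}
      = {y \<in> V. \<forall>p\<in>insert p G. p (y - x) < \<epsilon>}" by auto
  finally show ?case .
qed

text \<open>Subbasic balls may have any centre; by the triangle inequality a ball of radius
  \<open>\<epsilon>\<close> about \<open>z\<close> contains one about each of its points
  \<open>x\<close>, of radius \<open>\<epsilon> - p (x - z)\<close>. The empty \<open>G\<close>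
  accounts for the whole space \<open>V\<close>.\<close>

lemma openin_iff:
  "openin (seminorm_topology V P) U \<longleftrightarrow> U \<subseteq> V \<and>
    (\<forall>x\<in>U. \<exists>G \<epsilon>. finite G \<and> G \<subseteq> P \<and> 0 < \<epsilon> \<and> {y \<in> V. \<forall>p\<in>G. p (y - x) < \<epsilon>} \<subseteq> U)"
    (is "_ \<longleftrightarrow> _ \<and> (\<forall>x\<in>U. ?B x U)")
proof (intro iffI conjI ballI)
  assume U: "openin (seminorm_topology V P) U"
  then show "U \<subseteq> V" using openin_subset by force
  fix x assume x: "x \<in> U"
  have "generate_topology_on
      (insert V {{y \<in> V. p (y - x) < \<epsilon>} | p x \<epsilon>. p \<in> P \<and> x \<in> V \<and> 0 < \<epsilon>}) U"
    using U unfolding seminorm_topology_def by (rule openin_topology_generated_by)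
  then show "?B x U" using x
  proof (induction arbitrary: x rule: generate_topology_on.induct[consumes 1])
    case (Empty x)
    then show ?case by simp
  next
    case (Int a b x)
    from Int have "x \<in> a" "x \<in> b" by auto
    obtain G \<epsilon> where G: "finite G" "G \<subseteq> P" "0 < \<epsilon>" "{y \<in> V. \<forall>p\<in>G. p (y - x) < \<epsilon>} \<subseteq> a"
      using Int.IH(1)[OF \<open>x \<in> a\<close>] by (elim exE conjE)
    obtain H \<eta> where H: "finite H" "H \<subseteq> P" "0 < \<eta>" "{y \<in> V. \<forall>p\<in>H. p (y - x) < \<eta>} \<subseteq> b"
      using Int.IH(2)[OF \<open>x \<in> b\<close>] by (elim exE conjE)
    from G H show ?case
      by (intro exI[of _ "G \<union> H"] exI[of _ "min \<epsilon> \<eta>"]) auto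
  next
    case (UN K x)
    obtain k where k: "k \<in> K" "x \<in> k" using UN.prems by blast
    have "k \<subseteq> \<Union>K" using k by blast
    then show ?case using UN.IH[OF k] by (elim exE conjE) (intro exI conjI, auto)
  next
    case (Basis S x)
    then consider "S = V" | p z \<epsilon> where "S = {y \<in> V. p (y - z) < \<epsilon>}" "p \<in> P" "z \<in> V" "0 < \<epsilon>"
      by blast
    then show ?case
    proof cases
      case 1
      then show ?thesis by (intro exI[of _ "{}"] exI[of _ 1]) simp
    next
      case (2 p z \<epsilon>)
      then have "y \<in> S" if "y \<in> V" "p (y - x) < \<epsilon> - p (x - z)" for y
        using that seminorm_facts(3)[OF seminorm, of p y x z] \<open>x \<in> S\<close> by auto
      then show ?thesis
        using 2 \<open>x \<in> S\<close> by (intro exI[of _ "{p}"] exI[of _ "\<epsilon> - p (x - z)"]) auto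
    qed
  qed
next
  assume R: "U \<subseteq> V \<and> (\<forall>x\<in>U. ?B x U)"
  show "openin (seminorm_topology V P) U"
  proof (subst openin_subopen, intro ballI)
    fix x assume x: "x \<in> U"
    then obtain G \<epsilon> where G: "finite G" "G \<subseteq> P" "0 < \<epsilon>" "{y \<in> V. \<forall>p\<in>G. p (y - x) < \<epsilon>} \<subseteq> U"
      using R by blast
    have xV: "x \<in> V" using x R by blast
    show "\<exists>T. openin (seminorm_topology V P) T \<and> x \<in> T \<and> T \<subseteq> U"
      using openin_ball[OF G(1,2) xV G(3)] center_mem_ball[OF G(2,3) xV] G(4)
      by (intro exI[of _ "{y \<in> V. \<forall>p\<in>G. p (y - x) < \<epsilon>}"] conjI)
  qed
qed

lemma zero_nhd_iff:
  "zero_nhd (seminorm_topology V P) U \<longleftrightarrow> U \<subseteq> V \<and>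
    (\<exists>G \<epsilon>. finite G \<and> G \<subseteq> P \<and> 0 < \<epsilon> \<and> {y \<in> V. \<forall>p\<in>G. p y < \<epsilon>} \<subseteq> U)"
proof (intro iffI conjI)
  assume U: "zero_nhd (seminorm_topology V P) U"
  then show "U \<subseteq> V" by (simp add: zero_nhd_def)
  from U obtain W where W: "openin (seminorm_topology V P) W" "0 \<in> W" "W \<subseteq> U"
    by (auto simp: zero_nhd_def)
  from W(1,2) obtain G \<epsilon> where "finite G" "G \<subseteq> P" "0 < \<epsilon>" "{y \<in> V. \<forall>p\<in>G. p (y - 0) < \<epsilon>} \<subseteq> W"
    unfolding openin_iff by blast
  then show "\<exists>G \<epsilon>. finite G \<and> G \<subseteq> P \<and> 0 < \<epsilon> \<and> {y \<in> V. \<forall>p\<in>G. p y < \<epsilon>} \<subseteq> U"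
    using W by (intro exI[of _ G] exI[of _ \<epsilon>]) auto
next
  assume "U \<subseteq> V \<and> (\<exists>G \<epsilon>. finite G \<and> G \<subseteq> P \<and> 0 < \<epsilon> \<and> {y \<in> V. \<forall>p\<in>G. p y < \<epsilon>} \<subseteq> U)"
  then obtain G \<epsilon> where G: "U \<subseteq> V" "finite G" "G \<subseteq> P" "0 < \<epsilon>" "{y \<in> V. \<forall>p\<in>G. p y < \<epsilon>} \<subseteq> U"
    by blast
  then have "openin (seminorm_topology V P) {y \<in> V. \<forall>p\<in>G. p y < \<epsilon>}"
    using openin_ball[of G 0 \<epsilon>] by simp
  moreover have "0 \<in> {y \<in> V. \<forall>p\<in>G. p y < \<epsilon>}"
    using center_mem_ball[OF G(3,4), of 0] by simp
  ultimately show "zero_nhd (seminorm_topology V P) U"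
    using G unfolding zero_nhd_def by auto
qed

lemma zero_nhd_ball: "p \<in> P \<Longrightarrow> 0 < \<epsilon> \<Longrightarrow> zero_nhd (seminorm_topology V P) {y \<in> V. p y < \<epsilon>}"
  unfolding zero_nhd_iff by (intro conjI exI[of _ "{p}"] exI[of _ \<epsilon>]) auto

lemma limitinI:
  assumes "l \<in> V" "\<forall>\<^sub>F x in F. f x \<in> V"
    and "\<And>p \<epsilon>. p \<in> P \<Longrightarrow> 0 < \<epsilon> \<Longrightarrow> \<forall>\<^sub>F x in F. p (f x - l) < \<epsilon>"
  shows "limitin (seminorm_topology V P) f l F"
  unfolding limitin_def
proof (intro conjI allI impI)
  show "l \<in> topspace (seminorm_topology V P)" using assms by simp
  fix U assume "openin (seminorm_topology V P) U \<and> l \<in> U"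
  then obtain G \<epsilon> where G: "finite G" "G \<subseteq> P" "0 < \<epsilon>" "{y \<in> V. \<forall>p\<in>G. p (y - l) < \<epsilon>} \<subseteq> U"
    unfolding openin_iff by blast
  have "\<forall>\<^sub>F x in F. \<forall>p\<in>G. p (f x - l) < \<epsilon>"
    using G assms by (intro eventually_ball_finite) auto
  with assms(2) show "\<forall>\<^sub>F x in F. f x \<in> U"
    by eventually_elim (use G in auto)
qed

lemma limitinD:
  assumes "limitin (seminorm_topology V P) f l F" "p \<in> P" "0 < \<epsilon>"
  shows "\<forall>\<^sub>F x in F. p (f x - l) < \<epsilon>"
proof -
  have l: "l \<in> V" using assms(1) limitin_topspace by fastforce
  have "openin (seminorm_topology V P) {y \<in> V. \<forall>p\<in>{p}. p (y - l) < \<epsilon>}"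
    using assms l by (intro openin_ball) auto
  moreover have "l \<in> {y \<in> V. \<forall>p\<in>{p}. p (y - l) < \<epsilon>}"
    using l assms by (auto simp: seminorm_zero)
  ultimately have "\<forall>\<^sub>F x in F. f x \<in> {y \<in> V. \<forall>p\<in>{p}. p (y - l) < \<epsilon>}"
    using assms(1) unfolding limitin_def by blast
  then show ?thesis by eventually_elim simp
qed

lemma cauchy_filter_inI:
  assumes "\<forall>\<^sub>F (x, y) in F \<times>\<^sub>F F. x - y \<in> V"
    and "\<And>p \<epsilon>. p \<in> P \<Longrightarrow> 0 < \<epsilon> \<Longrightarrow> \<forall>\<^sub>F (x, y) in F \<times>\<^sub>F F. p (x - y) < \<epsilon>"
  shows "cauchy_filter_in (seminorm_topology V P) F"
  unfolding cauchy_filter_in_def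
proof (intro allI impI)
  fix U assume "zero_nhd (seminorm_topology V P) U"
  then obtain G \<epsilon> where G: "finite G" "G \<subseteq> P" "0 < \<epsilon>" "{y \<in> V. \<forall>p\<in>G. p y < \<epsilon>} \<subseteq> U"
    unfolding zero_nhd_iff by blast
  have "\<forall>\<^sub>F z in F \<times>\<^sub>F F. \<forall>p\<in>G. p (fst z - snd z) < \<epsilon>"
    using assms(2)[OF subsetD[OF G(2)] G(3)] G(1)
    by (intro eventually_ball_finite) (auto simp: split_def)
  with assms(1) show "\<forall>\<^sub>F (x, y) in F \<times>\<^sub>F F. x - y \<in> U"
    by eventually_elim (use G in \<open>auto simp: split_def\<close>)
qed

lemma dominated_zero_nhd:
  assumes "dominated V P q" "0 < \<epsilon>"
  shows "zero_nhd (seminorm_topology V P) {x \<in> V. q x < \<epsilon>}"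
proof -
  obtain G C where G: "finite G" "G \<subseteq> P" "0 \<le> C" "\<And>x. x \<in> V \<Longrightarrow> q x \<le> C * (\<Sum>p\<in>G. p x)"
    using assms by (auto simp: dominated_def)
  \<comment> \<open>The summand 1 avoids division by zero and leaves
    \<open>C * card G * \<eta>\<close> strictly below \<open>\<epsilon>\<close>.\<close>
  define \<eta> where "\<eta> = \<epsilon> / (C * card G + 1)"
  have \<eta>: "0 < \<eta>" "(C * card G + 1) * \<eta> = \<epsilon>"
  proof -
    have "0 \<le> C * card G" using G by simp
    then show "0 < \<eta>" "(C * card G + 1) * \<eta> = \<epsilon>" using assms by (auto simp: \<eta>_def)
  qed
  have "q y < \<epsilon>" if y: "y \<in> V" "\<forall>p\<in>G. p y < \<eta>" for y
  proof -
    have "(\<Sum>p\<in>G. p y) \<le> card G * \<eta>"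
      using y sum_bounded_above[of G "\<lambda>p. p y" \<eta>] by (auto simp: less_imp_le)
    then have "C * (\<Sum>p\<in>G. p y) \<le> C * (card G * \<eta>)" using G by (intro mult_left_mono)
    then show ?thesis using G(4)[OF y(1)] \<eta> by (simp add: algebra_simps)
  qed
  then show ?thesis
    unfolding zero_nhd_iff using G \<eta> by (intro conjI exI[of _ G] exI[of _ \<eta>]) auto
qed

text \<open>Homogeneity: for \<open>t\<close> above \<open>1 / \<epsilon>\<close> times the sum,
  \<open>x\<close> divided by \<open>t\<close> lies in the ball, hence \<open>q x < t\<close>.
  Letting \<open>t\<close> decrease, in place of normalising \<open>x\<close>, also covers vectors
  on which the sum vanishes.\<close>

lemma zero_nhd_dominated:
  assumes q: "seminorm_on s V q" and nhd: "zero_nhd (seminorm_topology V P) {x \<in> V. q x < 1}"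
  shows "dominated V P q"
proof -
  obtain G \<epsilon> where G: "finite G" "G \<subseteq> P" "0 < \<epsilon>"
      "{y \<in> V. \<forall>p\<in>G. p y < \<epsilon>} \<subseteq> {x \<in> V. q x < 1}"
    using nhd unfolding zero_nhd_iff by blast
  have "q x \<le> 1 / \<epsilon> * (\<Sum>p\<in>G. p x)" if x: "x \<in> V" for x
  proof (rule dense_ge)
    fix t assume t: "1 / \<epsilon> * (\<Sum>p\<in>G. p x) < t"
    have nonneg: "0 \<le> p x" if "p \<in> G" for p
      using that G x seminorm_onD(1)[OF seminorm] by blast
    then have "0 \<le> (\<Sum>p\<in>G. p x)" by (simp add: sum_nonneg)
    then have "0 < t" using t G(3) by (smt (verit) divide_nonneg_pos mult_nonneg_nonneg)
    have scaled: "r (s (of_real (1 / t)) x) = r x / t" if "seminorm_on s V r" for r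
      using seminorm_onD(3)[OF that x, of "of_real (1 / t)"] \<open>0 < t\<close> by (simp add: norm_divide)
    have "p (s (of_real (1 / t)) x) < \<epsilon>" if p: "p \<in> G" for p
    proof -
      have "p x \<le> (\<Sum>p\<in>G. p x)"
        using nonneg G p by (intro member_le_sum) auto
      also have "\<dots> < t * \<epsilon>" using t G(3) by (simp add: field_simps)
      finally show ?thesis
        using scaled[OF seminorm[OF subsetD[OF G(2) p]]] \<open>0 < t\<close>
        by (simp add: pos_divide_less_eq mult.commute)
    qed
    then have "s (of_real (1 / t)) x \<in> {y \<in> V. \<forall>p\<in>G. p y < \<epsilon>}" using x by simp
    from subsetD[OF G(4) this] have "q (s (of_real (1 / t)) x) < 1" by simp
    then show "q x \<le> t" using scaled[OF q] \<open>0 < t\<close> by simp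
  qed
  then show ?thesis
    unfolding dominated_def using G by (intro exI[of _ G] exI[of _ "1 / \<epsilon>"]) auto
qed

lemma dominated_member: "p \<in> P \<Longrightarrow> dominated V P p"
  unfolding dominated_def by (intro exI[of _ "{p}"] exI[of _ 1]) auto

text \<open>Transitivity of domination: the bounding terms \<open>r i\<close> may themselves be
  merely dominated rather than members of \<open>P\<close>.\<close>

lemma dominated_sum:
  assumes "finite I" "\<And>i. i \<in> I \<Longrightarrow> dominated V P (r i)" "0 \<le> C"
    and "\<And>x. x \<in> V \<Longrightarrow> q x \<le> C * (\<Sum>i\<in>I. r i x)"
  shows "dominated V P q"
proof -
  have "dominated V P (\<lambda>x. \<Sum>i\<in>I. r i x)"
    using assms(1,2)
  proof (induction I)
    case empty
    then show ?case unfolding dominated_def by (intro exI[of _ "{}"] exI[of _ 0]) auto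
  next
    case (insert i I)
    have "dominated V P (r i)" using insert.prems by simp
    then obtain G C where G: "finite G" "G \<subseteq> P" "0 \<le> C"
        "\<And>x. x \<in> V \<Longrightarrow> r i x \<le> C * (\<Sum>p\<in>G. p x)"
      by (auto simp: dominated_def)
    have "dominated V P (\<lambda>x. \<Sum>i\<in>I. r i x)" using insert by blast
    then obtain H D where H: "finite H" "H \<subseteq> P" "0 \<le> D"
        "\<And>x. x \<in> V \<Longrightarrow> (\<Sum>i\<in>I. r i x) \<le> D * (\<Sum>p\<in>H. p x)"
      by (auto simp: dominated_def)
    have "(\<Sum>i\<in>insert i I. r i x) \<le> (C + D) * (\<Sum>p\<in>G \<union> H. p x)" if x: "x \<in> V" for x
    proof -
      have nonneg: "\<forall>p\<in>P. 0 \<le> p x" using seminorm_onD(1)[OF seminorm] x by blast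
      have "(\<Sum>p\<in>G. p x) \<le> (\<Sum>p\<in>G \<union> H. p x)" "(\<Sum>p\<in>H. p x) \<le> (\<Sum>p\<in>G \<union> H. p x)"
        using nonneg G H by (auto intro!: sum_mono2)
      then have "C * (\<Sum>p\<in>G. p x) \<le> C * (\<Sum>p\<in>G \<union> H. p x)"
          "D * (\<Sum>p\<in>H. p x) \<le> D * (\<Sum>p\<in>G \<union> H. p x)"
        using G(3) H(3) by (auto intro: mult_left_mono)
      then show ?thesis
        using G(4)[OF x] H(4)[OF x] insert.hyps by (simp add: algebra_simps)
    qed
    then show ?case
      unfolding dominated_def using G H
      by (intro exI[of _ "G \<union> H"] exI[of _ "C + D"]) auto
  qed
  then obtain G D where G: "finite G" "G \<subseteq> P" "0 \<le> D"
      "\<And>x. x \<in> V \<Longrightarrow> (\<Sum>i\<in>I. r i x) \<le> D * (\<Sum>p\<in>G. p x)"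
    by (auto simp: dominated_def)
  have "q x \<le> (C * D) * (\<Sum>p\<in>G. p x)" if "x \<in> V" for x
    using assms(4)[OF that] mult_left_mono[OF G(4)[OF that] assms(3)] by (simp add: mult.assoc)
  then show ?thesis
    unfolding dominated_def using G assms(3) by (intro exI[of _ G] exI[of _ "C * D"]) auto
qed

lemma dominated_le:
  assumes "dominated V P r" "0 \<le> C" "\<And>x. x \<in> V \<Longrightarrow> q x \<le> C * r x"
  shows "dominated V P q"
  using dominated_sum[of "{()}" "\<lambda>_. r" C q] assms by simp

end

text \<open>This converts topological statements into estimates and back. One direction looks only
  at the preimage of a unit ball at 0; the other moves a zero neighbourhood to \<open>x\<close> by
  \<open>h (y - x) = h y - h x\<close>.\<close>

lemma continuous_map_seminorm_topology_iff:
  fixes h :: "'v::ab_group_add \<Rightarrow> 'w::ab_group_add"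
  assumes X: "seminorm_family s V P" and Y: "seminorm_family t W Q"
    and hW: "h ` V \<subseteq> W" and add: "\<And>x y. x \<in> V \<Longrightarrow> y \<in> V \<Longrightarrow> h (x + y) = h x + h y"
    and scale: "\<And>a x. x \<in> V \<Longrightarrow> h (s a x) = t a (h x)"
  shows "continuous_map (seminorm_topology V P) (seminorm_topology W Q) h \<longleftrightarrow>
    (\<forall>q\<in>Q. dominated V P (\<lambda>x. q (h x)))"
proof -
  interpret X: seminorm_family s V P by fact
  interpret Y: seminorm_family t W Q by fact
  have h_diff: "h (x - y) = h x - h y" if "x \<in> V" "y \<in> V" for x y
  proof -
    have "h (x - y) + h y = h x" using add[of "x - y" y] that by simp
    then show ?thesis by (simp add: algebra_simps)
  qed
  have h0: "h 0 = 0" using h_diff[of 0 0] by simp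
  have sem: "seminorm_on s V (\<lambda>x. q (h x))" if "q \<in> Q" for q
    using Y.seminorm[OF that] hW add scale by (auto simp: seminorm_on_def image_subset_iff)
  show ?thesis
  proof (intro iffI ballI)
    fix q assume cont: "continuous_map (seminorm_topology V P) (seminorm_topology W Q) h" and q: "q \<in> Q"
    have "openin (seminorm_topology W Q) {y \<in> W. \<forall>p\<in>{q}. p (y - 0) < 1}"
      using q by (intro Y.openin_ball) auto
    then have "openin (seminorm_topology V P)
        {x \<in> topspace (seminorm_topology V P). h x \<in> {y \<in> W. \<forall>p\<in>{q}. p (y - 0) < 1}}"
      using cont openin_continuous_map_preimage by blast
    then have "openin (seminorm_topology V P) {x \<in> V. q (h x) < 1}"
      using hW by (simp add: image_subset_iff cong: conj_cong)
    then have "zero_nhd (seminorm_topology V P) {x \<in> V. q (h x) < 1}"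
      using Y.seminorm_zero[OF q] by (auto simp: zero_nhd_def h0)
    then show "dominated V P (\<lambda>x. q (h x))"
      by (rule X.zero_nhd_dominated[OF sem[OF q]])
  next
    assume dom: "\<forall>q\<in>Q. dominated V P (\<lambda>x. q (h x))"
    have "openin (seminorm_topology V P) {x \<in> V. h x \<in> U}" if U: "openin (seminorm_topology W Q) U" for U
      unfolding X.openin_iff
    proof (intro conjI ballI)
      fix x assume x: "x \<in> {x \<in> V. h x \<in> U}"
      then obtain H \<epsilon> where H: "finite H" "H \<subseteq> Q" "0 < \<epsilon>"
          "{y \<in> W. \<forall>q\<in>H. q (y - h x) < \<epsilon>} \<subseteq> U"
        using U unfolding Y.openin_iff by blast
      \<comment> \<open>Treating the sum as one dominated function yields a single ball that
        controls all members of \<open>H\<close>, since the terms are nonnegative.\<close>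
      have "dominated V P (\<lambda>z. \<Sum>q\<in>H. q (h z))"
      proof (rule X.dominated_sum[where C=1 and r="\<lambda>q z. q (h z)", OF H(1)])
        show "dominated V P (\<lambda>z. q (h z))" if "q \<in> H" for q using dom H(2) that by blast
      qed auto
      from X.dominated_zero_nhd[OF this H(3)] obtain G \<eta> where G: "finite G" "G \<subseteq> P" "0 < \<eta>"
          "{y \<in> V. \<forall>p\<in>G. p y < \<eta>} \<subseteq> {z \<in> V. (\<Sum>q\<in>H. q (h z)) < \<epsilon>}"
        unfolding X.zero_nhd_iff by blast
      have "h y \<in> U" if y: "y \<in> V" "\<forall>p\<in>G. p (y - x) < \<eta>" for y
      proof -
        have "y - x \<in> {y \<in> V. \<forall>p\<in>G. p y < \<eta>}" using y x by simp
        from subsetD[OF G(4) this] have *: "(\<Sum>q\<in>H. q (h (y - x))) < \<epsilon>" by simp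
        have "q (h y - h x) < \<epsilon>" if q: "q \<in> H" for q
        proof -
          have "q (h (y - x)) \<le> (\<Sum>q\<in>H. q (h (y - x)))"
            using H q x y seminorm_onD(1)[OF sem] by (intro member_le_sum) auto
          then show ?thesis using * h_diff x y by simp
        qed
        then have "h y \<in> {y \<in> W. \<forall>q\<in>H. q (y - h x) < \<epsilon>}"
          using y hW by (simp add: image_subset_iff)
        then show ?thesis by (rule subsetD[OF H(4)])
      qed
      then show "\<exists>G \<epsilon>. finite G \<and> G \<subseteq> P \<and> 0 < \<epsilon> \<and>
          {y \<in> V. \<forall>p\<in>G. p (y - x) < \<epsilon>} \<subseteq> {x \<in> V. h x \<in> U}"
        using G by (intro exI[of _ G] exI[of _ \<eta>]) auto
    qed auto
    then show "continuous_map (seminorm_topology V P) (seminorm_topology W Q) h"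
      using hW by (auto simp: continuous_map_def)
  qed
qed

lemma seminorm_family_scalars: "seminorm_family ((*) :: 'k::real_or_complex \<Rightarrow> _) UNIV {norm}"
proof -
  interpret vector_space "(*) :: 'k \<Rightarrow> 'k \<Rightarrow> 'k" by (rule vector_space_mult)
  show ?thesis
    by unfold_locales (auto simp: seminorm_on_def norm_triangle_ineq norm_mult)
qed

text \<open>Makes the scalar field a target space of the same kind as \<open>E\<close>, so that the
  strong dual becomes an instance of the general results on \<open>L_b\<close>.\<close>

lemma euclidean_scalars: "(euclidean :: 'k::real_or_complex topology) = seminorm_topology UNIV {norm}"
proof -
  interpret seminorm_family "(*) :: 'k \<Rightarrow> 'k \<Rightarrow> 'k" UNIV "{norm}" by (rule seminorm_family_scalars)
  have "openin euclidean U \<longleftrightarrow> openin (seminorm_topology UNIV {norm}) U" for U :: "'k set"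
  proof
    assume "openin (euclidean :: 'k topology) U"
    then have "\<exists>\<epsilon>>0. \<forall>y. norm (y - x) < \<epsilon> \<longrightarrow> y \<in> U" if "x \<in> U" for x
      using that by (auto simp: open_dist dist_norm)
    then have "\<exists>G \<epsilon>. finite G \<and> G \<subseteq> {norm} \<and> 0 < \<epsilon> \<and> {y \<in> UNIV. \<forall>p\<in>G. p (y - x) < \<epsilon>} \<subseteq> U"
      if x: "x \<in> U" for x
    proof -
      obtain \<epsilon> where "\<epsilon> > 0" "\<forall>y. norm (y - x) < \<epsilon> \<longrightarrow> y \<in> U"
        using \<open>\<And>x. x \<in> U \<Longrightarrow> \<exists>\<epsilon>>0. \<forall>y. norm (y - x) < \<epsilon> \<longrightarrow> y \<in> U\<close> x by blast
      then show ?thesis by (intro exI[of _ "{norm}"] exI[of _ \<epsilon>]) auto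
    qed
    then show "openin (seminorm_topology UNIV {norm}) U"
      unfolding openin_iff by blast
  next
    assume U: "openin (seminorm_topology UNIV {norm}) U"
    have "\<exists>\<epsilon>>0. \<forall>y. norm (y - x) < \<epsilon> \<longrightarrow> y \<in> U" if x: "x \<in> U" for x
    proof -
      from U x obtain G \<epsilon> where "G \<subseteq> {norm}" "0 < \<epsilon>" "{y \<in> UNIV. \<forall>p\<in>G. p (y - x) < \<epsilon>} \<subseteq> U"
        unfolding openin_iff by blast
      then show ?thesis by (intro exI[of _ \<epsilon>]) auto
    qed
    then show "openin (euclidean :: 'k topology) U"
      by (auto simp: open_dist dist_norm)
  qed
  then show ?thesis by (simp add: topology_eq)
qed

section \<open>Locally convex spaces\<close>

locale lcs = vector_space s
  for s :: "'k::real_or_complex \<Rightarrow> 'v::ab_group_add \<Rightarrow> 'v" +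
  fixes X :: "'v topology"
  assumes lc: "lc_hausdorff_space s X" and UNIV [simp]: "topspace X = UNIV"
begin

lemma continuous_add: "continuous_map (prod_topology X X) X (\<lambda>(x, y). x + y)"
  and continuous_scale: "continuous_map (prod_topology euclidean X) X (\<lambda>(a, x). s a x)"
  using lc by (auto simp: lc_hausdorff_space_def)

lemma openin_translate: "openin X U \<Longrightarrow> openin X {y. x + y \<in> U}"
proof -
  assume U: "openin X U"
  have "continuous_map X (prod_topology X X) (\<lambda>y. (x, y))"
    by (intro continuous_map_pairedI) auto
  then have "continuous_map X X ((\<lambda>(x, y). x + y) \<circ> (\<lambda>y. (x, y)))"
    using continuous_add by (rule continuous_map_compose)
  then have "continuous_map X X (\<lambda>y. x + y)" by (simp add: o_def)
  from openin_continuous_map_preimage[OF this U] show ?thesis by simp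
qed

lemma continuous_scale_right: "continuous_map X X (s a)"
proof -
  have "continuous_map X (prod_topology euclidean X) (\<lambda>y. (a, y))"
    by (intro continuous_map_pairedI) auto
  then have "continuous_map X X ((\<lambda>(a, x). s a x) \<circ> (\<lambda>y. (a, y)))"
    using continuous_scale by (rule continuous_map_compose)
  then show ?thesis by (simp add: o_def)
qed

lemma zero_nhd_alt: "zero_nhd X U \<longleftrightarrow> (\<exists>W. openin X W \<and> 0 \<in> W \<and> W \<subseteq> U)"
  by (simp add: zero_nhd_def)

lemma zero_nhd_mono: "zero_nhd X U \<Longrightarrow> U \<subseteq> W \<Longrightarrow> zero_nhd X W"
  unfolding zero_nhd_alt by (meson order_trans)

lemma zero_nhd_mem: "zero_nhd X U \<Longrightarrow> 0 \<in> U"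
  unfolding zero_nhd_alt by blast

lemma zero_nhd_Int: "zero_nhd X U \<Longrightarrow> zero_nhd X W \<Longrightarrow> zero_nhd X (U \<inter> W)"
  unfolding zero_nhd_alt by (meson IntI Int_mono openin_Int)

lemma zero_nhd_scale:
  assumes "zero_nhd X U"
  shows "zero_nhd X {y. s a y \<in> U}"
proof -
  obtain W where W: "openin X W" "0 \<in> W" "W \<subseteq> U" using assms zero_nhd_alt by blast
  have "openin X {y. s a y \<in> W}"
    using openin_continuous_map_preimage[OF continuous_scale_right W(1)] by simp
  then show ?thesis
    unfolding zero_nhd_alt using W by (intro exI[of _ "{y. s a y \<in> W}"]) auto
qed

lemma zero_nhd_openin: "openin X U \<Longrightarrow> x \<in> U \<Longrightarrow> zero_nhd X {z. x + z \<in> U}"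
  unfolding zero_nhd_alt by (intro exI[of _ "{z. x + z \<in> U}"]) (auto intro: openin_translate)

lemma openin_zero_nhdI:
  assumes "\<And>x. x \<in> U \<Longrightarrow> zero_nhd X {z. x + z \<in> U}"
  shows "openin X U"
proof (subst openin_subopen, intro ballI)
  fix x assume "x \<in> U"
  then obtain W where W: "openin X W" "0 \<in> W" "W \<subseteq> {z. x + z \<in> U}"
    using assms zero_nhd_alt by blast
  have "y \<in> U" if "- x + y \<in> W" for y
  proof -
    have "x + (- x + y) \<in> U" using W(3) that by blast
    then show ?thesis by simp
  qed
  then show "\<exists>T. openin X T \<and> x \<in> T \<and> T \<subseteq> U"
    using W openin_translate[OF W(1), of "- x"]
    by (intro exI[of _ "{y. - x + y \<in> W}"]) auto
qed

text \<open>Joint continuity of scalar multiplication at \<open>(0, x)\<close>. For general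
  \<open>x\<close> it yields that zero neighbourhoods are absorbing, for \<open>x = 0\<close> that
  they contain balanced ones up to shrinking.\<close>

lemma scale_continuous_at_zero:
  assumes "openin X U" "s 0 x \<in> U"
  obtains d W where "0 < d" "openin X W" "x \<in> W" "\<And>c z. norm c < d \<Longrightarrow> z \<in> W \<Longrightarrow> s c z \<in> U"
proof -
  have "openin (prod_topology euclidean X)
      {z \<in> topspace (prod_topology euclidean X). (case z of (a, x) \<Rightarrow> s a x) \<in> U}"
    by (rule openin_continuous_map_preimage[OF continuous_scale assms(1)])
  then have "openin (prod_topology euclidean X) {(a, x). s a x \<in> U}"
    by (simp add: split_def)
  moreover have "(0, x) \<in> {(a, x). s a x \<in> U}" using assms by simp
  ultimately have "\<exists>A W. openin euclidean A \<and> openin X W \<and> 0 \<in> A \<and> x \<in> W \<and>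
      A \<times> W \<subseteq> {(a, x). s a x \<in> U}"
    by (rule openin_prod_topology_alt[THEN iffD1, rule_format])
  then obtain A W where A: "openin euclidean A" "openin X W" "0 \<in> A" "x \<in> W"
      "A \<times> W \<subseteq> {(a, x). s a x \<in> U}"
    by (elim exE conjE)
  then obtain d where d: "0 < d" "\<And>c. norm c < d \<Longrightarrow> c \<in> A"
    unfolding open_openin[symmetric] open_dist by (metis dist_0_norm dist_commute)
  have "s c z \<in> U" if "norm c < d" "z \<in> W" for c z
    using A(5) d(2)[OF that(1)] that(2) by blast
  then show thesis using that d(1) A by blast
qed

lemma zero_nhd_absorbing:
  assumes "zero_nhd X U"
  obtains d where "0 < d" "\<And>c. norm c < d \<Longrightarrow> s c x \<in> U"
proof -
  obtain W where W: "openin X W" "0 \<in> W" "W \<subseteq> U" using assms zero_nhd_alt by blast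
  then have "s 0 x \<in> W" by simp
  from scale_continuous_at_zero[OF W(1) this] show thesis
    using that W(3) by (metis subsetD)
qed

lemma zero_nhd_balanced:
  assumes "zero_nhd X U"
  obtains W where "zero_nhd X W" "\<And>c z. norm c \<le> 1 \<Longrightarrow> z \<in> W \<Longrightarrow> s c z \<in> U"
proof -
  obtain U' where U': "openin X U'" "0 \<in> U'" "U' \<subseteq> U" using assms zero_nhd_alt by blast
  then have "s 0 0 \<in> U'" by simp
  from scale_continuous_at_zero[OF U'(1) this] obtain d W where
    W: "0 < d" "openin X W" "0 \<in> W" "\<And>c z. norm c < d \<Longrightarrow> z \<in> W \<Longrightarrow> s c z \<in> U'"
    by metis
  show thesis
  proof (rule that)
    have "zero_nhd X W" using W zero_nhd_alt by blast
    \<comment> \<open>Since \<open>c z\<close> is \<open>c d / 2\<close> times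
      \<open>(2 / d) z\<close>, and \<open>norm (c d / 2) \<le> d / 2 < d\<close>, scalars of norm
      up to 1 are brought into the range where \<open>W\<close> is known to work.\<close>
    then show "zero_nhd X {z. s (of_real (2 / d)) z \<in> W}" by (rule zero_nhd_scale)
    fix c :: 'k and z assume c: "norm c \<le> 1" and z: "z \<in> {z. s (of_real (2 / d)) z \<in> W}"
    have "norm (c * of_real (d / 2)) \<le> 1 * (d / 2)"
      unfolding norm_mult using c W(1) by (intro mult_mono) auto
    then have "norm (c * of_real (d / 2)) < d" using W(1) by simp
    then have "s (c * of_real (d / 2)) (s (of_real (2 / d)) z) \<in> U'" using z W by blast
    moreover have "(c * of_real (d / 2)) * of_real (2 / d) = c"
      using W(1) by (simp add: mult.assoc flip: of_real_mult)
    ultimately show "s c z \<in> U" using U' by (simp add: subsetD)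
  qed
qed

lemma absorbsI:
  assumes "\<And>c y. r \<le> norm c \<Longrightarrow> y \<in> B \<Longrightarrow> s (inverse c) y \<in> A" "0 < r"
  shows "absorbs s A B"
  unfolding absorbs_def
proof (intro exI[of _ r] conjI allI impI subsetI)
  fix c :: 'k and y assume c: "r \<le> norm c" "y \<in> B"
  then have "c \<noteq> 0" using assms(2) by auto
  then have "y = s c (s (inverse c) y)" by simp
  then show "y \<in> s c ` A" using assms(1)[OF c] by blast
qed (rule assms)

lemma absorbsD:
  assumes "absorbs s A B"
  obtains r where "0 < r" "\<And>y. y \<in> B \<Longrightarrow> s (of_real (1 / r)) y \<in> A"
proof -
  obtain r where r: "r > 0" "\<forall>c. r \<le> norm c \<longrightarrow> B \<subseteq> s c ` A"
    using assms by (auto simp: absorbs_def)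
  then have sub: "B \<subseteq> s (of_real r) ` A" by simp
  have "s (of_real (1 / r)) y \<in> A" if y: "y \<in> B" for y
  proof -
    obtain a where a: "a \<in> A" "y = s (of_real r) a" using sub y by blast
    have "s (of_real (1 / r)) y = s (of_real (1 / r) * of_real r) a" by (simp only: a scale_scale)
    also have "of_real (1 / r) * of_real r = (1 :: 'k)" using r by (simp flip: of_real_mult)
    finally show ?thesis using a by simp
  qed
  then show thesis using that r by blast
qed

lemma bounded_in_singleton: "bounded_in s X {x}"
  unfolding bounded_in_def
proof (intro conjI allI impI)
  fix U assume "zero_nhd X U"
  then obtain d where d: "0 < d" "\<And>c. norm c < d \<Longrightarrow> s c x \<in> U"
    using zero_nhd_absorbing by metis
  show "absorbs s U {x}"
  proof (rule absorbsI)
    \<comment> \<open>The factor 2 gives \<open>norm (inverse c) \<le> d / 2\<close>, strictly below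
      \<open>d\<close>.\<close>
    show "0 < 2 / d" using d by simp
    fix c :: 'k and y assume c: "2 / d \<le> norm c" "y \<in> {x}"
    then have "inverse (norm c) \<le> inverse (2 / d)" using d by (intro le_imp_inverse_le) auto
    also have "\<dots> < d" using d by simp
    finally show "s (inverse c) y \<in> U" using c d by (simp add: norm_inverse)
  qed
qed simp

lemma bounded_in_seminorm:
  assumes B: "bounded_in s X B" and U: "zero_nhd X {y. p y < 1}"
    and p: "seminorm_on s UNIV p"
  obtains M where "\<And>y. y \<in> B \<Longrightarrow> p y \<le> M"
proof -
  have "absorbs s {y. p y < 1} B" using B U by (simp add: bounded_in_def)
  then obtain r where r: "0 < r" "\<And>y. y \<in> B \<Longrightarrow> s (of_real (1 / r)) y \<in> {y. p y < 1}"
    using absorbsD by metis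
  have "p y \<le> r" if "y \<in> B" for y
    using r(2)[OF that] seminorm_onD(3)[OF p, of y "of_real (1 / r)"] r(1)
    by (simp add: norm_divide)
  then show thesis using that by blast
qed

text \<open>Barrels and polars deliver neighbourhoods on which \<open>q (u y) \<le> 1\<close>.
  Scaling by \<open>2 / \<epsilon>\<close> turns them into neighbourhoods with the strict bound
  \<open>\<epsilon>\<close>, and linearity moves these to every point.\<close>

lemma linear_continuousI:
  assumes u: "Vector_Spaces.linear s t u" and fam: "seminorm_family t UNIV \<Gamma>"
    and nhd: "\<And>q. q \<in> \<Gamma> \<Longrightarrow> zero_nhd X {y. q (u y) \<le> 1}"
  shows "continuous_map X (seminorm_topology UNIV \<Gamma>) u"
proof -
  interpret T: seminorm_family t UNIV \<Gamma> by fact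
  have small: "zero_nhd X {y. q (u y) < \<epsilon>}" if q: "q \<in> \<Gamma>" and \<epsilon>: "0 < \<epsilon>" for q \<epsilon>
  proof -
    have "zero_nhd X {y. s (of_real (2 / \<epsilon>)) y \<in> {y. q (u y) \<le> 1}}"
      by (rule zero_nhd_scale[OF nhd[OF q]])
    moreover have "q (u y) < \<epsilon>" if y: "q (u (s (of_real (2 / \<epsilon>)) y)) \<le> 1" for y
    proof -
      have "q (u (s (of_real (2 / \<epsilon>)) y)) = 2 / \<epsilon> * q (u y)"
        using seminorm_onD(3)[OF T.seminorm[OF q], of "u y" "of_real (2 / \<epsilon>)"] \<epsilon>
        by (simp add: linear_mapD(2)[OF u] norm_divide)
      then have "2 / \<epsilon> * q (u y) \<le> 1" using y by (simp only:)
      then have "2 * q (u y) \<le> \<epsilon>" using \<epsilon> by (simp add: field_simps)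
      then show ?thesis using \<epsilon> by simp
    qed
    ultimately show ?thesis by (elim zero_nhd_mono) auto
  qed
  have "openin X {x. u x \<in> U}" if U: "openin (seminorm_topology UNIV \<Gamma>) U" for U
  proof (rule openin_zero_nhdI)
    fix x assume "x \<in> {x. u x \<in> U}"
    then have "u x \<in> U" by simp
    then obtain G \<epsilon> where G: "finite G" "G \<subseteq> \<Gamma>" "0 < \<epsilon>" "{y \<in> UNIV. \<forall>p\<in>G. p (y - u x) < \<epsilon>} \<subseteq> U"
      using U unfolding T.openin_iff by blast
    have "zero_nhd X {y. \<forall>q\<in>G. q (u y) < \<epsilon>}"
      using G(1,2)
    proof induction
      case empty
      then show ?case unfolding zero_nhd_alt by (intro exI[of _ UNIV]) (use openin_topspace[of X] in simp)
    next
      case (insert q G)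
      have "zero_nhd X ({y. q (u y) < \<epsilon>} \<inter> {y. \<forall>q\<in>G. q (u y) < \<epsilon>})"
        using insert small[OF _ G(3)] by (intro zero_nhd_Int) auto
      then show ?case by (elim zero_nhd_mono) auto
    qed
    moreover have "{y. \<forall>q\<in>G. q (u y) < \<epsilon>} \<subseteq> {z. x + z \<in> {x. u x \<in> U}}"
    proof (intro subsetI CollectI)
      fix z assume "z \<in> {y. \<forall>q\<in>G. q (u y) < \<epsilon>}"
      then have "u (x + z) \<in> {y \<in> UNIV. \<forall>p\<in>G. p (y - u x) < \<epsilon>}"
        by (simp add: linear_mapD(1)[OF u])
      then show "u (x + z) \<in> U" by (rule subsetD[OF G(4)])
    qed
    ultimately show "zero_nhd X {z. x + z \<in> {x. u x \<in> U}}" by (rule zero_nhd_mono)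
  qed
  then show ?thesis by (simp add: continuous_map_def)
qed

end

section \<open>Gauges of convex sets and density of subspaces\<close>

definition gauge :: "('k::real_or_complex \<Rightarrow> 'v \<Rightarrow> 'v) \<Rightarrow> 'v set \<Rightarrow> 'v \<Rightarrow> real"
  where "gauge s D x = Inf {t. 0 < t \<and> s (of_real (1 / t)) x \<in> D}"

lemma gauge_bounds:
  fixes s :: "'k::real_or_complex \<Rightarrow> 'v::ab_group_add \<Rightarrow> 'v"
  assumes vs: "vector_space s" and conv: "convex_wrt s D" and D0: "0 \<in> D"
    and absorb: "\<And>x. \<exists>t>0. s (of_real (1 / t)) x \<in> D"
  shows "sublinear s (gauge s D)" "\<And>t x. 0 < t \<Longrightarrow> s (of_real (1 / t)) x \<in> D \<Longrightarrow> gauge s D x \<le> t"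
    "\<And>x. x \<notin> D \<Longrightarrow> 1 \<le> gauge s D x"
proof -
  interpret vector_space s by fact
  define S where "S x = {t. 0 < t \<and> s (of_real (1 / t)) x \<in> D}" for x
  have gauge: "gauge s D x = Inf (S x)" for x by (simp add: gauge_def S_def)
  have bdd: "bdd_below (S x)" for x by (auto simp: S_def intro: less_imp_le)
  have ne: "S x \<noteq> {}" for x using absorb by (auto simp: S_def)
  have le: "gauge s D x \<le> t" if "t \<in> S x" for t x
    unfolding gauge using that bdd by (rule cInf_lower)
  have ge: "b \<le> gauge s D x" if "\<And>t. t \<in> S x \<Longrightarrow> b \<le> t" for b x
    unfolding gauge using that by (intro cInf_greatest ne)
  show "gauge s D x \<le> t" if "0 < t" "s (of_real (1 / t)) x \<in> D" for t x
    using that le by (simp add: S_def)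
  have combine: "s (of_real (1 - r)) x + s (of_real r) y \<in> D"
    if "x \<in> D" "y \<in> D" "0 \<le> r" "r \<le> 1" for x y r
    using conv that by (simp add: convex_wrt_def)
  show "1 \<le> gauge s D x" if "x \<notin> D" for x
  proof (rule ge, rule ccontr)
    fix t assume t: "t \<in> S x" "\<not> 1 \<le> t"
    \<comment> \<open>With \<open>t < 1\<close>, the point \<open>x\<close> is a convex combination
      of 0 and \<open>x\<close> divided by \<open>t\<close>, both in \<open>D\<close>.\<close>
    then have "s (of_real (1 - t)) 0 + s (of_real t) (s (of_real (1 / t)) x) \<in> D"
      by (intro combine D0) (auto simp: S_def)
    moreover have "of_real t * of_real (1 / t) = (1 :: 'k)"
      using t by (simp add: S_def flip: of_real_mult)
    ultimately show False using that by simp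
  qed
  have add: "gauge s D (x + y) \<le> gauge s D x + gauge s D y" for x y
  proof -
    have sum: "t + u \<in> S (x + y)" if t: "t \<in> S x" and u: "u \<in> S y" for t u
    proof -
      have pos: "0 < t" "0 < u" using t u by (auto simp: S_def)
      \<comment> \<open>The weights \<open>t / (t + u)\<close> and \<open>u / (t + u)\<close> cancel
        the factors \<open>1 / t\<close> and \<open>1 / u\<close> and leave the common factor
        \<open>1 / (t + u)\<close>.\<close>
      have "s (of_real (1 - u / (t + u))) (s (of_real (1 / t)) x)
          + s (of_real (u / (t + u))) (s (of_real (1 / u)) y) \<in> D"
        using t u by (intro combine) (auto simp: S_def)
      moreover have "(1 - u / (t + u)) * (1 / t) = 1 / (t + u)" "u / (t + u) * (1 / u) = 1 / (t + u)"
        using pos by (auto simp: field_simps)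
      then have "of_real (1 - u / (t + u)) * of_real (1 / t) = (of_real (1 / (t + u)) :: 'k)"
          "of_real (u / (t + u)) * of_real (1 / u) = (of_real (1 / (t + u)) :: 'k)"
        by (metis of_real_mult)+
      ultimately have "s (of_real (1 / (t + u))) (x + y) \<in> D"
        by (simp only: scale_scale scale_right_distrib)
      then show ?thesis using pos by (simp add: S_def)
    qed
    have "gauge s D (x + y) - u \<le> gauge s D x" if u: "u \<in> S y" for u
      by (rule ge) (use le sum u in \<open>fastforce simp: algebra_simps\<close>)
    then have "gauge s D (x + y) - gauge s D x \<le> gauge s D y"
      by (intro ge) (fastforce simp: algebra_simps)
    then show ?thesis by simp
  qed
  have "gauge s D (s (of_real r) x) = r * gauge s D x" if "0 < r" for r x
    using _ that
  proof (rule sublinear_scaleI[OF vs])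
    fix r x assume r: "0 < (r::real)"
    have "gauge s D (s (of_real r) x) / r \<le> gauge s D x"
    proof (rule ge)
      fix t assume t: "t \<in> S x"
      have "1 / (r * t) * r = 1 / t" using r by simp
      then have "of_real (1 / (r * t)) * of_real r = (of_real (1 / t) :: 'k)"
        by (metis of_real_mult)
      then have "r * t \<in> S (s (of_real r) x)" using t r by (simp add: S_def)
      then have "gauge s D (s (of_real r) x) \<le> r * t" by (rule le)
      then show "gauge s D (s (of_real r) x) / r \<le> t" using r by (simp add: field_simps)
    qed
    then show "gauge s D (s (of_real r) x) \<le> r * gauge s D x" using r by (simp add: field_simps)
  qed
  with add show "sublinear s (gauge s D)" by (simp add: sublinear_def)
qed

context lcs
begin

text \<open>The separating functional is dominated by the gauge of \<open>C + M\<close>, where \<open>C\<close> is a convex zero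
  neighbourhood with \<open>y + C\<close> disjoint from \<open>M\<close>. It is at most \<open>0\<close> on \<open>M\<close>, hence vanishes there.\<close>

lemma dense_subspace:
  assumes M: "subspace M"
    and ann: "\<And>g z. g \<in> dual s X \<Longrightarrow> (\<And>m. m \<in> M \<Longrightarrow> g m = 0) \<Longrightarrow> g z = 0"
  shows "X closure_of M = UNIV"
proof (rule ccontr)
  assume "X closure_of M \<noteq> UNIV"
  then obtain y where "y \<notin> X closure_of M" by blast
  then obtain U where U: "openin X U" "y \<in> U" "\<And>m. m \<in> M \<Longrightarrow> m \<notin> U"
    by (auto simp: in_closure_of)
  obtain C where C: "zero_nhd X C" "convex_wrt s C" "C \<subseteq> {z. y + z \<in> U}"
    using lc zero_nhd_openin[OF U(1,2)] by (auto simp: lc_hausdorff_space_def)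
  define D where "D = {c + m | c m. c \<in> C \<and> m \<in> M}"
  have CD: "C \<subseteq> D" using subspace_0[OF M] by (force simp: D_def)
  have MD: "M \<subseteq> D" using zero_nhd_mem[OF C(1)] by (force simp: D_def)
  \<comment> \<open>The point to be separated is \<open>- y\<close>, as \<open>C\<close> need not be
    symmetric: \<open>- y = c + m\<close> puts \<open>y + c = - m\<close> into both \<open>U\<close>
    and \<open>M\<close>.\<close>
  have "- y \<notin> D"
  proof
    assume "- y \<in> D"
    then obtain c m where cm: "- y = c + m" "c \<in> C" "m \<in> M" by (auto simp: D_def)
    have "y + c = y + (c + m) - m" by simp
    also have "\<dots> = - m" by (simp flip: cm(1))
    finally have eq: "y + c = - m" .
    have "y + c \<in> U" using C(3) cm(2) by blast
    then show False using U(3) subspace_neg[OF M cm(3)] eq by metis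
  qed
  have conv: "convex_wrt s D"
    unfolding convex_wrt_def
  proof (intro ballI allI impI)
    fix a b and t :: real assume "a \<in> D" "b \<in> D" and t: "0 \<le> t \<and> t \<le> 1"
    then obtain c m c' m' where cm: "a = c + m" "b = c' + m'" "c \<in> C" "c' \<in> C" "m \<in> M" "m' \<in> M"
      by (auto simp: D_def)
    have "s (of_real (1 - t)) c + s (of_real t) c' \<in> C"
      using C(2) cm t unfolding convex_wrt_def by blast
    moreover have "s (of_real (1 - t)) m + s (of_real t) m' \<in> M"
      using M cm by (simp add: subspace_add subspace_scale)
    moreover have "s (of_real (1 - t)) a + s (of_real t) b =
        (s (of_real (1 - t)) c + s (of_real t) c') + (s (of_real (1 - t)) m + s (of_real t) m')"
      by (simp only: cm scale_right_distrib ac_simps)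
    ultimately show "s (of_real (1 - t)) a + s (of_real t) b \<in> D"
      unfolding D_def by blast
  qed
  have absorb: "\<exists>t>0. s (of_real (1 / t)) x \<in> D" for x
  proof -
    obtain d where d: "0 < d" "\<And>c. norm c < d \<Longrightarrow> s c x \<in> C"
      using zero_nhd_absorbing[OF C(1)] by metis
    have "s (of_real (1 / (2 / d))) x \<in> C" using d by (intro d(2)) simp
    then show ?thesis using d CD by (intro exI[of _ "2 / d"]) auto
  qed
  have D0: "0 \<in> D" using CD zero_nhd_mem[OF C(1)] by blast
  note g = gauge_bounds[OF vector_space_axioms conv D0 absorb]
  obtain f where f: "\<And>x y. f (x + y) = f x + f y" "\<And>r x. f (s (of_real r) x) = r * f x"
      "\<And>x. f x \<le> gauge s D x" "f (- y) = gauge s D (- y)"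
    using hahn_banach_sublinear[OF vector_space_axioms g(1)] by metis
  have f_le: "f x \<le> t" if "0 < t" "s (of_real (1 / t)) x \<in> D" for x t
    using f(3)[of x] g(2)[OF that] by simp
  obtain g where g': "Vector_Spaces.linear s (*) g"
      "\<And>z. \<exists>c. norm c = 1 \<and> norm (g z) = f (s c z)" "\<And>z. f z \<le> norm (g z)"
    using real_linear_imp_linear[OF vector_space_axioms f(1,2)] by metis
  have "g m = 0" if m: "m \<in> M" for m
  proof -
    obtain c where c: "norm (g m) = f (s c m)" using g'(2) by metis
    \<comment> \<open>As \<open>M\<close> is a subspace, every positive multiple of
      \<open>s c m\<close> stays in \<open>M\<close>, hence in \<open>D\<close>; so
      \<open>f (s c m)\<close> is below each positive \<open>t\<close>.\<close>
    have "norm (g m) \<le> t" if "0 < t" for t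
      unfolding c using M m MD that by (intro f_le) (auto intro: subspace_scale)
    then have "norm (g m) \<le> 0" by (rule dense_ge)
    then show ?thesis by simp
  qed
  moreover have "g \<in> dual s X"
  proof -
    \<comment> \<open>The rotation in \<open>norm (g z) = f (s c z)\<close> may leave the merely
      convex \<open>C\<close>; all multiples of points of \<open>W\<close> by unit scalars stay
      inside it.\<close>
    obtain W where W: "zero_nhd X W" "\<And>c z. norm c \<le> 1 \<Longrightarrow> z \<in> W \<Longrightarrow> s c z \<in> C"
      using zero_nhd_balanced[OF C(1)] by metis
    have "norm (g z) \<le> 1" if z: "z \<in> W" for z
    proof -
      obtain c where c: "norm c = 1" "norm (g z) = f (s c z)" using g'(2) by metis
      then have "s c z \<in> D" using W(2) z CD by (metis order_refl subsetD)
      then show ?thesis unfolding c by (intro f_le) simp_all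
    qed
    then have "zero_nhd X {z. norm (g z) \<le> 1}" by (intro zero_nhd_mono[OF W(1)]) auto
    then have "continuous_map X (seminorm_topology UNIV {norm}) g"
      by (intro linear_continuousI[OF g'(1) seminorm_family_scalars]) auto
    then show ?thesis using g'(1) by (simp add: dual_def cont_linear_maps_def euclidean_scalars)
  qed
  ultimately have "g (- y) = 0" using ann by blast
  moreover have "1 \<le> norm (g (- y))"
    using g(3)[OF \<open>- y \<notin> D\<close>] f(4) g'(3)[of "- y"] by simp
  ultimately show False by simp
qed

end

section \<open>Spaces of continuous linear maps\<close>

context seminorm_family
begin

lemma limitin_dominated:
  assumes lim: "limitin (seminorm_topology V P) f l F" and dom: "dominated V P q"
    and fV: "\<forall>\<^sub>F x in F. f x \<in> V" and "0 < \<epsilon>"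
  shows "\<forall>\<^sub>F x in F. q (f x - l) < \<epsilon>"
proof -
  have l: "l \<in> V" using lim limitin_topspace by fastforce
  obtain G \<eta> where G: "finite G" "G \<subseteq> P" "0 < \<eta>" "{y \<in> V. \<forall>p\<in>G. p y < \<eta>} \<subseteq> {x \<in> V. q x < \<epsilon>}"
    using dominated_zero_nhd[OF dom \<open>0 < \<epsilon>\<close>] unfolding zero_nhd_iff by blast
  have "\<forall>\<^sub>F x in F. \<forall>p\<in>G. p (f x - l) < \<eta>"
    using limitinD[OF lim subsetD[OF G(2)] G(3)] G(1) by (intro eventually_ball_finite) auto
  with fV show ?thesis
  proof eventually_elim
    case (elim x)
    then have "f x - l \<in> {y \<in> V. \<forall>p\<in>G. p y < \<eta>}" using l by simp
    from subsetD[OF G(4) this] show ?case by simp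
  qed
qed

lemma continuous_seminorm:
  assumes p: "p \<in> P"
  shows "continuous_map (seminorm_topology V P) euclidean p"
proof -
  have "openin (seminorm_topology V P) {x \<in> V. p x \<in> S}" if S: "open S" for S
    unfolding openin_iff
  proof (intro conjI ballI)
    fix x assume x: "x \<in> {x \<in> V. p x \<in> S}"
    then obtain \<epsilon> where \<epsilon>: "0 < \<epsilon>" "\<And>r. \<bar>r - p x\<bar> < \<epsilon> \<Longrightarrow> r \<in> S"
      using S unfolding open_dist dist_real_def by blast
    have "p y \<in> S" if y: "y \<in> V" "p (y - x) < \<epsilon>" for y
    proof -
      have "p y \<le> p (y - x) + p x" "p x \<le> p (x - y) + p y"
        using seminorm_onD(2)[OF seminorm[OF p], of "y - x" x]
          seminorm_onD(2)[OF seminorm[OF p], of "x - y" y] x y by auto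
      then have "\<bar>p y - p x\<bar> < \<epsilon>"
        using y x seminorm_facts(2)[OF seminorm[OF p], of x y] by auto
      then show ?thesis by (rule \<epsilon>)
    qed
    then show "\<exists>G \<epsilon>. finite G \<and> G \<subseteq> P \<and> 0 < \<epsilon> \<and>
        {y \<in> V. \<forall>p\<in>G. p (y - x) < \<epsilon>} \<subseteq> {x \<in> V. p x \<in> S}"
      using \<epsilon>(1) p by (intro exI[of _ "{p}"] exI[of _ \<epsilon>]) auto
  qed auto
  then show ?thesis by (simp add: continuous_map_def)
qed

lemma hausdorff_separates:
  assumes "Hausdorff_space (seminorm_topology V P)" "x \<in> V" "\<And>p. p \<in> P \<Longrightarrow> p x = 0"
  shows "x = 0"
proof (rule ccontr)
  assume "x \<noteq> 0"
  then obtain U W where UW: "openin (seminorm_topology V P) U" "openin (seminorm_topology V P) W"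
      "0 \<in> U" "x \<in> W" "disjnt U W"
    using assms(1,2) unfolding Hausdorff_space_def by (metis mem(1) topspace)
  then obtain G \<epsilon> where G: "G \<subseteq> P" "0 < \<epsilon>" "{y \<in> V. \<forall>p\<in>G. p (y - 0) < \<epsilon>} \<subseteq> U"
    unfolding openin_iff by meson
  have "p x < \<epsilon>" if "p \<in> G" for p
    using assms(3)[OF subsetD[OF G(1) that]] G(2) by simp
  then have "x \<in> {y \<in> V. \<forall>p\<in>G. p (y - 0) < \<epsilon>}" using assms(2) by simp
  from subsetD[OF G(3) this] show False using UW by (auto simp: disjnt_def)
qed

end

text \<open>The target is given by seminorms, so that besides \<open>E\<close> also the scalars with
  \<open>{norm}\<close> are an instance; the source \<open>Y\<close> is given by its topology
  alone.\<close>

locale lcs_operators = Y: lcs sY Y + E: seminorm_family sE UNIV \<Gamma>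
  for sY :: "'k::real_or_complex \<Rightarrow> 'y::ab_group_add \<Rightarrow> 'y" and Y :: "'y topology"
    and sE :: "'k \<Rightarrow> 'e::ab_group_add \<Rightarrow> 'e" and \<Gamma> :: "('e \<Rightarrow> real) set"
begin

abbreviation E :: "'e topology" where "E \<equiv> seminorm_topology UNIV \<Gamma>"
abbreviation CL :: "('y \<Rightarrow> 'e) set" where "CL \<equiv> cont_linear_maps sY Y sE E"

definition cont_seminorm :: "('e \<Rightarrow> real) \<Rightarrow> bool"
  where "cont_seminorm p \<longleftrightarrow> seminorm_on sE UNIV p \<and> continuous_map E euclidean p"

definition sup_seminorm :: "'y set \<Rightarrow> ('e \<Rightarrow> real) \<Rightarrow> ('y \<Rightarrow> 'e) \<Rightarrow> real"
  where "sup_seminorm B p u = (SUP y\<in>B. p (u y))"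

definition L_seminorms :: "(('y \<Rightarrow> 'e) \<Rightarrow> real) set"
  where "L_seminorms = {sup_seminorm B p | B p. B \<noteq> {} \<and> bounded_in sY Y B \<and> cont_seminorm p}"

lemma L_b_eq: "L_b sY Y sE E = seminorm_topology CL L_seminorms"
  by (simp add: L_b_def L_seminorms_def sup_seminorm_def[abs_def] cont_seminorm_def)

lemma CL_linear: "u \<in> CL \<Longrightarrow> Vector_Spaces.linear sY sE u"
  and CL_continuous: "u \<in> CL \<Longrightarrow> continuous_map Y E u"
  by (simp_all add: cont_linear_maps_def)

lemmas CL_simps = CL_linear[THEN linear_mapD(1)] CL_linear[THEN linear_mapD(2)] CL_linear[THEN linear_mapD(3)]
  CL_linear[THEN linear_mapD(4)]

lemma cont_seminorm_member: "p \<in> \<Gamma> \<Longrightarrow> cont_seminorm p"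
  by (simp add: cont_seminorm_def E.seminorm E.continuous_seminorm)

lemma cont_seminormD:
  assumes "cont_seminorm p"
  shows "0 \<le> p x" "p (x + y) \<le> p x + p y" "p (sE a x) = norm a * p x" "p (x - y) = p (y - x)" "p 0 = 0"
    and "p (x - z) \<le> p (x - y) + p (y - z)"
  using assms seminorm_onD[of sE UNIV p] E.seminorm_facts[of p]
  by (auto simp: cont_seminorm_def)

lemma cont_seminorm_compose: "cont_seminorm p \<Longrightarrow> u \<in> CL \<Longrightarrow> continuous_map Y euclidean (\<lambda>y. p (u y))"
  using continuous_map_compose[OF CL_continuous, of u euclidean p]
  by (simp add: cont_seminorm_def o_def)

lemma CL_zero_nhd:
  assumes "u \<in> CL" "cont_seminorm p" "0 < \<epsilon>"
  shows "zero_nhd Y {y. p (u y) < \<epsilon>}"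
proof -
  have "openin Y {y \<in> topspace Y. p (u y) \<in> {..<\<epsilon>}}"
    using cont_seminorm_compose[OF assms(2,1)] by (rule openin_continuous_map_preimage) simp
  then show ?thesis
    unfolding Y.zero_nhd_alt using assms
    by (intro exI[of _ "{y. p (u y) < \<epsilon>}"]) (simp add: cont_seminormD CL_simps)
qed

lemma CLI:
  assumes "Vector_Spaces.linear sY sE u" "\<And>p. p \<in> \<Gamma> \<Longrightarrow> zero_nhd Y {y. p (u y) \<le> 1}"
  shows "u \<in> CL"
  using Y.linear_continuousI[OF assms(1) E.seminorm_family_axioms] assms
  by (simp add: cont_linear_maps_def)

lemma CL_subspace: "module.subspace (fun_scale sE) CL"
proof -
  interpret fs: vector_space "fun_scale sE" by (rule vector_space_fun_scale) unfold_locales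
  show ?thesis
    unfolding fs.subspace_def
  proof (intro conjI ballI allI)
    have "zero_nhd Y UNIV"
      unfolding Y.zero_nhd_alt using openin_topspace[of Y] by auto
    then have "zero_nhd Y {y. p 0 \<le> 1}" if "p \<in> \<Gamma>" for p
      using cont_seminormD(5)[OF cont_seminorm_member[OF that]] by simp
    then have "(\<lambda>_. 0) \<in> CL"
      by (intro CLI linear_mapI Y.vector_space_axioms E.vector_space_axioms) simp_all
    then show "0 \<in> CL" by (simp add: zero_fun_def)
  next
    fix u v assume u: "u \<in> CL" and v: "v \<in> CL"
    show "u + v \<in> CL"
    proof (rule CLI)
      show "Vector_Spaces.linear sY sE (u + v)"
        using u v by (intro linear_mapI Y.vector_space_axioms E.vector_space_axioms)
          (simp_all add: CL_simps E.scale_right_distrib)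
      fix p assume "p \<in> \<Gamma>"
      then have p: "cont_seminorm p" by (rule cont_seminorm_member)
      have "p ((u + v) y) \<le> 1" if "p (u y) < 1 / 2" "p (v y) < 1 / 2" for y
        using cont_seminormD(2)[OF p, of "u y" "v y"] that by simp
      then show "zero_nhd Y {y. p ((u + v) y) \<le> 1}"
        by (intro Y.zero_nhd_mono[OF Y.zero_nhd_Int[OF CL_zero_nhd[OF u p, of "1/2"] CL_zero_nhd[OF v p, of "1/2"]]])
          auto
    qed
  next
    fix a u assume u: "u \<in> CL"
    show "fun_scale sE a u \<in> CL"
    proof (rule CLI)
      show "Vector_Spaces.linear sY sE (fun_scale sE a u)"
        using u by (intro linear_mapI Y.vector_space_axioms E.vector_space_axioms)
          (simp_all add: fun_scale_def CL_simps E.scale_right_distrib mult.commute)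
      fix p assume "p \<in> \<Gamma>"
      then have p: "cont_seminorm p" by (rule cont_seminorm_member)
      have "zero_nhd Y {y. sY a y \<in> {y. p (u y) < 1}}"
        by (intro Y.zero_nhd_scale CL_zero_nhd u p) simp
      then show "zero_nhd Y {y. p (fun_scale sE a u y) \<le> 1}"
        by (elim Y.zero_nhd_mono) (auto simp: fun_scale_def CL_simps u)
    qed
  qed
qed

lemma CL_bdd_above:
  assumes "u \<in> CL" "cont_seminorm p" "bounded_in sY Y B"
  shows "bdd_above ((\<lambda>y. p (u y)) ` B)"
proof -
  have "seminorm_on sY UNIV (\<lambda>y. p (u y))"
    using assms by (simp add: seminorm_on_def CL_simps cont_seminormD)
  then obtain M where "\<And>y. y \<in> B \<Longrightarrow> p (u y) \<le> M"
    using Y.bounded_in_seminorm[OF assms(3) CL_zero_nhd[OF assms(1,2)]] by auto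
  then show ?thesis by (intro bdd_aboveI2)
qed

lemma le_sup_seminorm:
  "u \<in> CL \<Longrightarrow> cont_seminorm p \<Longrightarrow> bounded_in sY Y B \<Longrightarrow> y \<in> B \<Longrightarrow> p (u y) \<le> sup_seminorm B p u"
  unfolding sup_seminorm_def by (intro cSUP_upper CL_bdd_above)

lemma sup_seminorm_le: "B \<noteq> {} \<Longrightarrow> (\<And>y. y \<in> B \<Longrightarrow> p (u y) \<le> M) \<Longrightarrow> sup_seminorm B p u \<le> M"
  unfolding sup_seminorm_def by (rule cSUP_least)

lemma L_seminormsI: "B \<noteq> {} \<Longrightarrow> bounded_in sY Y B \<Longrightarrow> cont_seminorm p \<Longrightarrow> sup_seminorm B p \<in> L_seminorms"
  by (auto simp: L_seminorms_def)

lemma seminorm_family_L: "seminorm_family (fun_scale sE) CL L_seminorms"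
proof -
  interpret fs: vector_space "fun_scale sE" by (rule vector_space_fun_scale) unfold_locales
  show ?thesis
  proof
    show "fs.subspace CL" by (rule CL_subspace)
    fix r assume "r \<in> L_seminorms"
    then obtain B p where B: "r = sup_seminorm B p" "B \<noteq> {}" "bounded_in sY Y B" and p: "cont_seminorm p"
      by (auto simp: L_seminorms_def)
    have "seminorm_on (fun_scale sE) CL (\<lambda>u. SUP y\<in>B. p (u y))"
    proof (rule seminorm_on_SUP[OF B(2)])
      show "seminorm_on (fun_scale sE) CL (\<lambda>u. p (u y))" for y
        using cont_seminormD(1-3)[OF p] by (simp add: seminorm_on_def fun_scale_def)
      show "bdd_above ((\<lambda>y. p (u y)) ` B)" if "u \<in> CL" for u
        using that p B(3) by (rule CL_bdd_above)
      show "fun_scale sE a u \<in> CL" if "u \<in> CL" for a u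
        using that by (rule fs.subspace_scale[OF CL_subspace])
    qed
    then show "seminorm_on (fun_scale sE) CL r"
      by (simp add: B(1) sup_seminorm_def[abs_def])
  qed
qed

sublocale L: seminorm_family "fun_scale sE" CL L_seminorms
  by (rule seminorm_family_L)

text \<open>The set in the conclusion is an intersection of preimages of closed unit balls, hence
  closed and absolutely convex. Uniform boundedness of \<open>H\<close> on bounded sets is exactly
  what makes it bornivorous, so it is one of the barrels that quasi-barrelledness speaks of.\<close>

lemma quasi_barrelled_equicontinuous:
  assumes qb: "quasi_barrelled sY Y" and H: "H \<subseteq> CL" and p: "cont_seminorm p"
    and bound: "\<And>B. bounded_in sY Y B \<Longrightarrow> \<exists>M. \<forall>v\<in>H. \<forall>y\<in>B. p (v y) \<le> M"
  shows "zero_nhd Y {y. \<forall>v\<in>H. p (v y) \<le> 1}"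
proof -
  define A where "A = {y. \<forall>v\<in>H. p (v y) \<le> 1}"
  have absorb: "absorbs sY A B" if B: "bounded_in sY Y B" for B
  proof -
    obtain M where M: "\<forall>v\<in>H. \<forall>y\<in>B. p (v y) \<le> M" using bound[OF B] by blast
    show ?thesis
    proof (rule Y.absorbsI)
      \<comment> \<open>\<open>M\<close> may be negative or zero, and absorption asks for a positive
        radius.\<close>
      show "0 < max 1 M" by simp
      fix c :: 'k and y assume c: "max 1 M \<le> norm c" and y: "y \<in> B"
      have "p (v (sY (inverse c) y)) \<le> 1" if v: "v \<in> H" for v
      proof -
        have "p (v y) \<le> norm c" using M v y c by force
        moreover have "p (v (sY (inverse c) y)) = p (v y) / norm c"
          using H v by (simp add: CL_simps subsetD cont_seminormD(3)[OF p] norm_inverse divide_inverse mult.commute)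
        ultimately show ?thesis using c by (simp add: divide_le_eq_1)
      qed
      then show "sY (inverse c) y \<in> A" by (simp add: A_def)
    qed
  qed
  have "closedin Y A"
  proof (cases "H = {}")
    case True
    then show ?thesis using closedin_topspace[of Y] by (simp add: A_def)
  next
    case False
    have "closedin Y {y. p (v y) \<le> 1}" if "v \<in> H" for v
    proof -
      have "closedin Y {y \<in> topspace Y. p (v y) \<in> {..1}}"
        using cont_seminorm_compose[OF p subsetD[OF H that]]
        by (rule closedin_continuous_map_preimage) simp
      then show ?thesis by simp
    qed
    then have "closedin Y (\<Inter>v\<in>H. {y. p (v y) \<le> 1})"
      using False by (intro closedin_INT) auto
    moreover have "(\<Inter>v\<in>H. {y. p (v y) \<le> 1}) = A" by (auto simp: A_def)
    ultimately show ?thesis by simp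
  qed
  moreover have "absolutely_convex sY A"
    unfolding absolutely_convex_def
  proof (intro ballI allI impI)
    fix x y and a b :: 'k assume xy: "x \<in> A" "y \<in> A" and ab: "norm a + norm b \<le> 1"
    have "p (v (sY a x + sY b y)) \<le> 1" if v: "v \<in> H" for v
    proof -
      have "p (v (sY a x + sY b y)) \<le> norm a * p (v x) + norm b * p (v y)"
        using cont_seminormD(2)[OF p, of "sE a (v x)" "sE b (v y)"] H v
        by (simp add: CL_simps subsetD cont_seminormD(3)[OF p])
      also have "\<dots> \<le> norm a * 1 + norm b * 1"
        using xy v by (intro add_mono mult_left_mono) (auto simp: A_def)
      finally show ?thesis using ab by simp
    qed
    then show "sY a x + sY b y \<in> A" by (simp add: A_def)
  qed
  ultimately have "barrel sY Y A" "bornivorous sY Y A"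
    using absorb Y.bounded_in_singleton by (auto simp: barrel_def bornivorous_def)
  then show ?thesis using qb by (simp add: quasi_barrelled_def A_def)
qed

text \<open>Links the two descriptions of \<open>E\<close>: \<open>L_b\<close> ranges over all
  continuous seminorms, whereas limits in \<open>E\<close> and the seminorms of
  \<open>F_sigma_b\<close> involve only members of \<open>\<Gamma>\<close>.\<close>

lemma cont_seminorm_dominated:
  assumes p: "cont_seminorm p"
  shows "dominated UNIV \<Gamma> p"
proof (rule E.zero_nhd_dominated)
  show "seminorm_on sE UNIV p" using p by (simp add: cont_seminorm_def)
  have "openin E {x \<in> topspace E. p x \<in> {..<1}}"
    using p by (intro openin_continuous_map_preimage) (auto simp: cont_seminorm_def)
  then show "zero_nhd E {x \<in> UNIV. p x < 1}"
    using cont_seminormD(5)[OF p] by (auto simp: zero_nhd_def)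
qed

text \<open>Singletons are bounded, so the filter is Cauchy at each point and has pointwise limits
  in \<open>E\<close>. Continuity of \<open>u\<close> is left open here, because the reason for it
  depends on \<open>Y\<close>.\<close>

lemma cauchy_filter_L_limit:
  assumes complete: "complete_lcs E" and hausdorff: "Hausdorff_space E"
    and F: "F \<noteq> bot" "F \<le> principal CL" "cauchy_filter_in (L_b sY Y sE E) F"
  obtains u where "Vector_Spaces.linear sY sE u"
    "\<And>B p \<epsilon>. bounded_in sY Y B \<Longrightarrow> cont_seminorm p \<Longrightarrow> 0 < \<epsilon> \<Longrightarrow>
      \<forall>\<^sub>F v in F. \<forall>y\<in>B. p (v y - u y) \<le> \<epsilon>"
proof -
  have FCL: "\<forall>\<^sub>F v in F. v \<in> CL"
    using F(2) by (metis eventually_principal filter_leD)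
  have uniform: "\<exists>Q. eventually Q F \<and> (\<forall>v w. Q v \<longrightarrow> Q w \<longrightarrow> (\<forall>y\<in>B. p (v y - w y) < \<epsilon>))"
    if B: "bounded_in sY Y B" and p: "cont_seminorm p" and \<epsilon>: "0 < \<epsilon>" for B p \<epsilon>
  proof (cases "B = {}")
    case True
    then show ?thesis by (intro exI[of _ "\<lambda>_. True"]) simp
  next
    case False
    then have r: "sup_seminorm B p \<in> L_seminorms" using B p by (rule L_seminormsI)
    have "\<forall>\<^sub>F (v, w) in F \<times>\<^sub>F F. v - w \<in> {u \<in> CL. sup_seminorm B p u < \<epsilon>}"
      using F(3) L.zero_nhd_ball[OF r \<epsilon>] unfolding cauchy_filter_in_def L_b_eq by blast
    then obtain Q where Q: "eventually Q F"
        "\<And>v w. Q v \<Longrightarrow> Q w \<Longrightarrow> v - w \<in> {u \<in> CL. sup_seminorm B p u < \<epsilon>}"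
      unfolding eventually_prod_same by auto
    have "p (v y - w y) < \<epsilon>" if "Q v" "Q w" "y \<in> B" for v w y
      using Q(2)[OF that(1,2)] le_sup_seminorm[OF _ p B that(3), of "v - w"] by simp
    then show ?thesis using Q(1) by (intro exI[of _ Q]) blast
  qed
  have "\<exists>l. limitin E (\<lambda>v. v y) l F" for y
  proof -
    have "cauchy_filter_in E (filtermap (\<lambda>v. v y) F)"
    proof (rule E.cauchy_filter_inI)
      fix p \<epsilon> assume p: "p \<in> \<Gamma>" and \<epsilon>: "0 < (\<epsilon> :: real)"
      obtain Q where Q: "eventually Q F" "\<And>v w. Q v \<Longrightarrow> Q w \<Longrightarrow> p (v y - w y) < \<epsilon>"
        using uniform[OF Y.bounded_in_singleton cont_seminorm_member[OF p] \<epsilon>, of y] by blast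
      have "eventually (\<lambda>x. \<exists>v. Q v \<and> x = v y) (filtermap (\<lambda>v. v y) F)"
        unfolding eventually_filtermap using Q(1) by eventually_elim auto
      then show "\<forall>\<^sub>F (x, z) in filtermap (\<lambda>v. v y) F \<times>\<^sub>F filtermap (\<lambda>v. v y) F. p (x - z) < \<epsilon>"
        unfolding eventually_prod_same
        using Q(2) by (intro exI[of _ "\<lambda>x. \<exists>v. Q v \<and> x = v y"]) auto
    qed (simp add: split_def)
    moreover have "filtermap (\<lambda>v. v y) F \<noteq> bot" using F(1) by (simp add: filtermap_bot_iff)
    ultimately obtain l where "limitin E (\<lambda>z. z) l (filtermap (\<lambda>v. v y) F)"
      using complete unfolding complete_lcs_def complete_in_def by auto
    then show ?thesis by (auto simp: limitin_def eventually_filtermap)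
  qed
  then obtain u where u: "\<And>y. limitin E (\<lambda>v. v y) (u y) F" by metis
  have lim: "\<forall>\<^sub>F v in F. p (v y - u y) < \<epsilon>" if "cont_seminorm p" "0 < \<epsilon>" for p y \<epsilon>
    using E.limitin_dominated[OF u cont_seminorm_dominated[OF that(1)] _ that(2)] by simp
  have zero: "x = 0" if x: "\<And>p \<epsilon>. cont_seminorm p \<Longrightarrow> 0 < \<epsilon> \<Longrightarrow> p x \<le> \<epsilon>" for x
  proof (rule E.hausdorff_separates[OF hausdorff])
    fix p assume "p \<in> \<Gamma>"
    then have p: "cont_seminorm p" by (rule cont_seminorm_member)
    have "p x \<le> 0" by (rule dense_ge) (rule x[OF p])
    then show "p x = 0" using cont_seminormD(1)[OF p, of x] by simp
  qed simp
  show thesis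
  proof (rule that)
    show "Vector_Spaces.linear sY sE u"
    proof (rule linear_mapI[OF Y.vector_space_axioms E.vector_space_axioms])
      fix x y
      \<comment> \<open>Each \<open>v\<close> is additive, so the defect of \<open>u\<close> splits
        into three errors against \<open>v\<close>, each below \<open>\<epsilon> / 3\<close>. The
        resulting estimate no longer mentions \<open>v\<close> and hence holds outright, the filter
        being nontrivial.\<close>
      have "u x + u y - u (x + y) = 0"
      proof (rule zero)
        fix p and \<epsilon> :: real assume p: "cont_seminorm p" and "0 < \<epsilon>"
        then have "0 < \<epsilon> / 3" by simp
        note ev = lim[OF p this]
        have "\<forall>\<^sub>F v in F. p (u x + u y - u (x + y)) \<le> \<epsilon>"
          using FCL ev[of x] ev[of y] ev[of "x + y"]
        proof eventually_elim
          case (elim v)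
          have "u x + u y - u (x + y) = ((u x - v x) + (u y - v y)) + (v (x + y) - u (x + y))"
            using elim(1) by (simp add: CL_simps)
          then have "p (u x + u y - u (x + y)) \<le> p (u x - v x) + p (u y - v y) + p (v (x + y) - u (x + y))"
            using cont_seminormD(2)[OF p] by (smt (verit, best))
          also have "\<dots> \<le> \<epsilon>"
            using elim cont_seminormD(4)[OF p, of "u x" "v x"] cont_seminormD(4)[OF p, of "u y" "v y"] by linarith
          finally show ?case .
        qed
        then show "p (u x + u y - u (x + y)) \<le> \<epsilon>" using F(1) by (simp add: eventually_const_iff)
      qed
      then show "u (x + y) = u x + u y" by simp
    next
      fix a x
      have "sE a (u x) - u (sY a x) = 0"
      proof (rule zero)
        fix p and \<epsilon> :: real assume p: "cont_seminorm p" and \<epsilon>: "0 < \<epsilon>"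
        \<comment> \<open>Two errors occur, one of them multiplied by \<open>norm a\<close>:
          together \<open>norm a * \<eta> + \<eta> = \<epsilon>\<close>.\<close>
        define \<eta> where "\<eta> = \<epsilon> / (norm a + 1)"
        have pos: "0 < norm a + 1" by (simp add: add_nonneg_pos)
        have \<eta>: "0 < \<eta>" "(norm a + 1) * \<eta> = \<epsilon>" using pos \<epsilon> by (auto simp: \<eta>_def)
        have "\<forall>\<^sub>F v in F. p (sE a (u x) - u (sY a x)) \<le> \<epsilon>"
          using FCL lim[OF p \<eta>(1), of x] lim[OF p \<eta>(1), of "sY a x"]
        proof eventually_elim
          case (elim v)
          have "sE a (u x) - u (sY a x) = sE a (u x - v x) + (v (sY a x) - u (sY a x))"
            using elim(1) by (simp add: CL_simps E.scale_right_diff_distrib)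
          then have "p (sE a (u x) - u (sY a x)) \<le> norm a * p (u x - v x) + p (v (sY a x) - u (sY a x))"
            using cont_seminormD(2)[OF p, of "sE a (u x - v x)" "v (sY a x) - u (sY a x)"]
            by (simp only: cont_seminormD(3)[OF p])
          also have "\<dots> \<le> norm a * \<eta> + \<eta>"
            using elim cont_seminormD(4)[OF p, of "u x" "v x"] by (intro add_mono mult_left_mono) auto
          finally show ?case using \<eta>(2) by (simp add: algebra_simps)
        qed
        then show "p (sE a (u x) - u (sY a x)) \<le> \<epsilon>" using F(1) by (simp add: eventually_const_iff)
      qed
      then show "u (sY a x) = sE a (u x)" by simp
    qed
  next
    fix B p and \<epsilon> :: real assume B: "bounded_in sY Y B" and p: "cont_seminorm p" and "0 < \<epsilon>"
    then have \<epsilon>: "0 < \<epsilon> / 2" by simp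
    obtain Q where Q: "eventually Q F" "\<And>v w y. Q v \<Longrightarrow> Q w \<Longrightarrow> y \<in> B \<Longrightarrow> p (v y - w y) < \<epsilon> / 2"
      using uniform[OF B p \<epsilon>] by blast
    have "p (v y - u y) \<le> \<epsilon>" if v: "Q v" and y: "y \<in> B" for v y
    proof -
      \<comment> \<open>Here \<open>v\<close> is fixed and \<open>w\<close> runs to the limit. The
        event \<open>Q\<close> was chosen for all of \<open>B\<close>, so it does not depend on
        \<open>y\<close>; this gives uniformity.\<close>
      have "\<forall>\<^sub>F w in F. p (v y - u y) \<le> \<epsilon>"
        using Q(1) lim[OF p \<epsilon>, of y]
      proof eventually_elim
        case (elim w)
        then show ?case
          using Q(2)[OF v elim(1) y] cont_seminormD(6)[OF p, of "v y" "u y" "w y"] by simp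
      qed
      then show ?thesis using F(1) by (simp add: eventually_const_iff)
    qed
    then show "\<forall>\<^sub>F v in F. \<forall>y\<in>B. p (v y - u y) \<le> \<epsilon>" using Q(1) by (auto elim: eventually_mono)
  qed
qed

lemma limitin_L_bI:
  assumes F: "F \<le> principal CL" and u: "u \<in> CL"
    and unif: "\<And>B p \<epsilon>. bounded_in sY Y B \<Longrightarrow> cont_seminorm p \<Longrightarrow> 0 < \<epsilon> \<Longrightarrow>
      \<forall>\<^sub>F v in F. \<forall>y\<in>B. p (v y - u y) \<le> \<epsilon>"
  shows "limitin (L_b sY Y sE E) (\<lambda>v. v) u F"
  unfolding L_b_eq
proof (rule L.limitinI[OF u])
  show "\<forall>\<^sub>F v in F. v \<in> CL" using F by (metis eventually_principal filter_leD)
  fix r and \<epsilon> :: real assume "r \<in> L_seminorms" "0 < \<epsilon>"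
  then obtain B p where B: "r = sup_seminorm B p" "B \<noteq> {}" "bounded_in sY Y B" "cont_seminorm p"
    by (auto simp: L_seminorms_def)
  \<comment> \<open>Half of \<open>\<epsilon>\<close> is kept because the supremum over
    \<open>B\<close> preserves only the non-strict bound.\<close>
  have "\<forall>\<^sub>F v in F. \<forall>y\<in>B. p (v y - u y) \<le> \<epsilon> / 2"
    using \<open>0 < \<epsilon>\<close> by (intro unif B) simp
  then show "\<forall>\<^sub>F v in F. r (v - u) < \<epsilon>"
  proof eventually_elim
    case (elim v)
    then have "sup_seminorm B p (v - u) \<le> \<epsilon> / 2"
      by (intro sup_seminorm_le B) simp
    then show ?case using B(1) \<open>0 < \<epsilon>\<close> by simp
  qed
qed

lemma bornological_complete_L_b:
  assumes complete: "complete_lcs E" and hausdorff: "Hausdorff_space E" and born: "bornological sY Y"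
  shows "complete_lcs (L_b sY Y sE E)"
  unfolding complete_lcs_def complete_in_def
proof (intro allI impI)
  fix F assume "F \<noteq> bot \<and> F \<le> principal (topspace (L_b sY Y sE E)) \<and> cauchy_filter_in (L_b sY Y sE E) F"
  then have F: "F \<noteq> bot" "F \<le> principal CL" "cauchy_filter_in (L_b sY Y sE E) F"
    by (simp_all add: L_b_eq)
  obtain u where u: "Vector_Spaces.linear sY sE u"
    "\<And>B p \<epsilon>. bounded_in sY Y B \<Longrightarrow> cont_seminorm p \<Longrightarrow> 0 < \<epsilon> \<Longrightarrow>
      \<forall>\<^sub>F v in F. \<forall>y\<in>B. p (v y - u y) \<le> \<epsilon>"
    using cauchy_filter_L_limit[OF complete hausdorff F] by blast
  have "u \<in> CL"
  proof (rule CLI[OF u(1)])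
    fix p assume "p \<in> \<Gamma>"
    then have p: "cont_seminorm p" by (rule cont_seminorm_member)
    have "absolutely_convex sY {y. p (u y) \<le> 1}"
      unfolding absolutely_convex_def
    proof (intro ballI allI impI CollectI)
      fix x y and a b :: 'k
      assume xy: "x \<in> {y. p (u y) \<le> 1}" "y \<in> {y. p (u y) \<le> 1}" and ab: "norm a + norm b \<le> 1"
      have "p (u (sY a x + sY b y)) \<le> norm a * p (u x) + norm b * p (u y)"
        using cont_seminormD(2)[OF p, of "sE a (u x)" "sE b (u y)"]
        by (simp add: linear_mapD[OF u(1)] cont_seminormD(3)[OF p])
      also have "\<dots> \<le> norm a * 1 + norm b * 1"
        using xy by (intro add_mono mult_left_mono) auto
      finally show "p (u (sY a x + sY b y)) \<le> 1" using ab by simp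
    qed
    moreover have "absorbs sY {y. p (u y) \<le> 1} B" if B: "bounded_in sY Y B" for B
    proof -
      have "\<forall>\<^sub>F v in F. v \<in> CL \<and> (\<forall>y\<in>B. p (v y - u y) \<le> 1)"
        using F(2) u(2)[OF B p, of 1] by (intro eventually_conj) (auto simp: le_principal)
      then obtain v where v: "v \<in> CL" "\<And>y. y \<in> B \<Longrightarrow> p (v y - u y) \<le> 1"
        using F(1) eventually_happens' by blast
      obtain M where M: "\<And>y. y \<in> B \<Longrightarrow> p (v y) \<le> M"
        using CL_bdd_above[OF v(1) p B] by (auto simp: bdd_above_def)
      have bound: "p (u y) \<le> M + 1" if "y \<in> B" for y
        using M[OF that] v(2)[OF that] cont_seminormD(2)[OF p, of "v y" "u y - v y"]
          cont_seminormD(4)[OF p, of "u y" "v y"] by simp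
      show ?thesis
      proof (rule Y.absorbsI)
        show "0 < max 1 (M + 1)" by simp
        fix c :: 'k and y assume c: "max 1 (M + 1) \<le> norm c" and y: "y \<in> B"
        have "p (u (sY (inverse c) y)) = p (u y) / norm c"
          by (simp add: linear_mapD[OF u(1)] cont_seminormD(3)[OF p] norm_inverse divide_inverse mult.commute)
        then show "sY (inverse c) y \<in> {y. p (u y) \<le> 1}"
          using bound[OF y] c by (simp add: divide_le_eq_1)
      qed
    qed
    ultimately show "zero_nhd Y {y. p (u y) \<le> 1}"
      using born by (simp add: bornological_def bornivorous_def)
  qed
  then show "\<exists>x\<in>topspace (L_b sY Y sE E). limitin (L_b sY Y sE E) (\<lambda>z. z) x F"
    using limitin_L_bI[OF F(2) _ u(2)] by (auto simp: L_b_eq)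
qed

text \<open>A bounded subset \<open>A\<close> of \<open>L_b\<close> is uniformly bounded on bounded
  sets of \<open>Y\<close>, hence equicontinuous. Wherever all members of \<open>A\<close> satisfy
  \<open>p (v y) \<le> 1\<close>, so does their pointwise limit; thus the equicontinuity
  neighbourhood also serves \<open>u\<close>.\<close>

lemma quasi_barrelled_quasi_complete_L_b:
  assumes complete: "complete_lcs E" and hausdorff: "Hausdorff_space E" and qb: "quasi_barrelled sY Y"
  shows "quasi_complete_lcs (fun_scale sE) (L_b sY Y sE E)"
  unfolding quasi_complete_lcs_def complete_in_def
proof (intro allI impI)
  fix A F assume "closedin (L_b sY Y sE E) A \<and> bounded_in (fun_scale sE) (L_b sY Y sE E) A"
    and *: "F \<noteq> bot \<and> F \<le> principal A \<and> cauchy_filter_in (L_b sY Y sE E) F"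
  then have A: "closedin (L_b sY Y sE E) A" "bounded_in (fun_scale sE) (L_b sY Y sE E) A" by auto
  have ACL: "A \<subseteq> CL" using closedin_subset[OF A(1)] by (simp add: L_b_eq)
  then have F: "F \<noteq> bot" "F \<le> principal CL" "cauchy_filter_in (L_b sY Y sE E) F"
    using * by (auto intro: order_trans)
  have FA: "\<forall>\<^sub>F v in F. v \<in> A" using * by (simp add: le_principal)
  obtain u where u: "Vector_Spaces.linear sY sE u"
    "\<And>B p \<epsilon>. bounded_in sY Y B \<Longrightarrow> cont_seminorm p \<Longrightarrow> 0 < \<epsilon> \<Longrightarrow>
      \<forall>\<^sub>F v in F. \<forall>y\<in>B. p (v y - u y) \<le> \<epsilon>"
    using cauchy_filter_L_limit[OF complete hausdorff F] by blast
  have "u \<in> CL"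
  proof (rule CLI[OF u(1)])
    fix p assume "p \<in> \<Gamma>"
    then have p: "cont_seminorm p" by (rule cont_seminorm_member)
    have "\<exists>M. \<forall>v\<in>A. \<forall>y\<in>B. p (v y) \<le> M" if B: "bounded_in sY Y B" for B
    proof (cases "B = {}")
      case False
      then have r: "sup_seminorm B p \<in> L_seminorms" using B p by (rule L_seminormsI)
      \<comment> \<open>The radius with which this ball absorbs \<open>A\<close> is a common bound
        for \<open>p (v y)\<close> over \<open>v\<close> in \<open>A\<close> and \<open>y\<close> in
        \<open>B\<close>.\<close>
      have "absorbs (fun_scale sE) {u \<in> CL. sup_seminorm B p u < 1} A"
        using A(2) L.zero_nhd_ball[OF r, of 1] by (simp add: bounded_in_def L_b_eq)
      then obtain R where "0 < R"
          "\<And>c. R \<le> norm c \<Longrightarrow> A \<subseteq> fun_scale sE c ` {u \<in> CL. sup_seminorm B p u < 1}"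
        unfolding absorbs_def by blast
      then have R: "0 < R" "A \<subseteq> fun_scale sE (of_real R) ` {u \<in> CL. sup_seminorm B p u < 1}"
        by simp_all
      have "p (v y) \<le> R" if v: "v \<in> A" and y: "y \<in> B" for v y
      proof -
        obtain w where w: "w \<in> CL" "sup_seminorm B p w < 1" "v = fun_scale sE (of_real R) w"
          using R(2) v by blast
        then have "p (w y) \<le> 1" using le_sup_seminorm[OF w(1) p B y] by simp
        then show ?thesis using R(1) by (simp add: w(3) fun_scale_def cont_seminormD(3)[OF p])
      qed
      then show ?thesis by blast
    qed simp
    then have nhd: "zero_nhd Y {y. \<forall>v\<in>A. p (v y) \<le> 1}"
      by (rule quasi_barrelled_equicontinuous[OF qb ACL p])
    have "p (u y) \<le> 1" if y: "\<forall>v\<in>A. p (v y) \<le> 1" for y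
    proof (rule field_le_epsilon)
      fix \<epsilon> :: real assume "0 < \<epsilon>"
      have "\<forall>\<^sub>F v in F. p (u y) \<le> 1 + \<epsilon>"
        using FA u(2)[OF Y.bounded_in_singleton p \<open>0 < \<epsilon>\<close>, of y]
      proof eventually_elim
        case (elim v)
        then have "p (v y) \<le> 1" "p (v y - u y) \<le> \<epsilon>" using y by auto
        then show ?case
          using cont_seminormD(2)[OF p, of "v y" "u y - v y"] cont_seminormD(4)[OF p, of "u y" "v y"] by simp
      qed
      then show "p (u y) \<le> 1 + \<epsilon>" using F(1) by (simp add: eventually_const_iff)
    qed
    then show "zero_nhd Y {y. p (u y) \<le> 1}" by (intro Y.zero_nhd_mono[OF nhd]) auto
  qed
  then have lim: "limitin (L_b sY Y sE E) (\<lambda>v. v) u F"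
    using limitin_L_bI[OF F(2) _ u(2)] by blast
  have "u \<in> A"
  proof (rule ccontr)
    assume "u \<notin> A"
    moreover have "openin (L_b sY Y sE E) (topspace (L_b sY Y sE E) - A)"
      using A(1) by (simp add: closedin_def)
    ultimately have "\<forall>\<^sub>F v in F. v \<in> topspace (L_b sY Y sE E) - A"
      using lim \<open>u \<in> CL\<close> by (auto simp: limitin_def L_b_eq)
    with FA have "\<forall>\<^sub>F v in F. False" by eventually_elim simp
    then show False using F(1) by simp
  qed
  with lim show "\<exists>x\<in>A. limitin (L_b sY Y sE E) (\<lambda>z. z) x F" by blast
qed

end

section \<open>Completeness under topological isomorphisms\<close>

locale linear_homeomorphism =
  fixes s :: "'k::real_or_complex \<Rightarrow> 'v::ab_group_add \<Rightarrow> 'v" and X :: "'v topology"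
    and t :: "'k \<Rightarrow> 'w::ab_group_add \<Rightarrow> 'w" and Z :: "'w topology" and h :: "'v \<Rightarrow> 'w"
  assumes vs: "vector_space s" and sub: "module.subspace s (topspace X)"
    and iso: "topological_isomorphism s X t Z h"
begin

lemma homeo: "homeomorphic_map X Z h"
  and h_add: "x \<in> topspace X \<Longrightarrow> y \<in> topspace X \<Longrightarrow> h (x + y) = h x + h y"
  and h_scale: "x \<in> topspace X \<Longrightarrow> h (s a x) = t a (h x)"
  using iso by (auto simp: topological_isomorphism_def)

lemma scale_mem: "x \<in> topspace X \<Longrightarrow> s a x \<in> topspace X"
  and diff_mem: "x \<in> topspace X \<Longrightarrow> y \<in> topspace X \<Longrightarrow> x - y \<in> topspace X"
  and zero_mem: "0 \<in> topspace X"
proof -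
  interpret vector_space s by (rule vs)
  show "x \<in> topspace X \<Longrightarrow> s a x \<in> topspace X"
    "x \<in> topspace X \<Longrightarrow> y \<in> topspace X \<Longrightarrow> x - y \<in> topspace X" "0 \<in> topspace X"
    using sub by (auto intro: subspace_scale subspace_diff subspace_0)
qed

lemma h_diff: "x \<in> topspace X \<Longrightarrow> y \<in> topspace X \<Longrightarrow> h (x - y) = h x - h y"
  using h_add[of "x - y" y] diff_mem[of x y] by (simp add: algebra_simps)

lemma h_inj: "inj_on h (topspace X)"
  and h_image: "h ` topspace X = topspace Z"
  using homeo by (auto simp: homeomorphic_eq_everything_map)

lemma zero_nhd_image:
  assumes "zero_nhd X U"
  shows "zero_nhd Z (h ` U)"
proof -
  obtain W where W: "U \<subseteq> topspace X" "openin X W" "0 \<in> W" "W \<subseteq> U"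
    using assms by (auto simp: zero_nhd_def)
  have "openin Z (h ` W)"
    using homeo W(2) by (metis homeomorphic_imp_open_map open_map_def)
  moreover have "0 \<in> h ` W" using W(3) h_diff[OF zero_mem zero_mem] by (auto simp: image_iff)
  ultimately show ?thesis using W h_image unfolding zero_nhd_def by blast
qed

text \<open>The filter is pulled back along the inverse \<open>g\<close>. By linearity of
  \<open>h\<close>, differences upstairs are detected by images of zero neighbourhoods, so the
  Cauchy property survives, and continuity of \<open>h\<close> returns the limit.\<close>

lemma complete_in_image:
  assumes A: "A \<subseteq> topspace X" and comp: "complete_in X A"
  shows "complete_in Z (h ` A)"
  unfolding complete_in_def
proof (intro allI impI)
  fix F assume F: "F \<noteq> bot \<and> F \<le> principal (h ` A) \<and> cauchy_filter_in Z F"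
  then have FA: "\<forall>\<^sub>F z in F. z \<in> h ` A" by (simp add: le_principal)
  define g where "g = inv_into (topspace X) h"
  have gh: "g (h a) = a" if "a \<in> A" for a
    using that A h_inj by (auto simp: g_def)
  have "cauchy_filter_in X (filtermap g F)"
    unfolding cauchy_filter_in_def
  proof (intro allI impI)
    fix U assume U: "zero_nhd X U"
    then have UX: "U \<subseteq> topspace X" by (simp add: zero_nhd_def)
    have "\<forall>\<^sub>F (z, w) in F \<times>\<^sub>F F. z - w \<in> h ` U"
      using F zero_nhd_image[OF U] by (auto simp: cauchy_filter_in_def)
    then obtain Q where Q: "eventually Q F" "\<And>z w. Q z \<Longrightarrow> Q w \<Longrightarrow> z - w \<in> h ` U"
      unfolding eventually_prod_same by auto
    have "\<forall>\<^sub>F x in filtermap g F. x \<in> A \<and> Q (h x)"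
      unfolding eventually_filtermap using FA Q(1) by eventually_elim (auto simp: gh)
    moreover have "x - y \<in> U" if "x \<in> A \<and> Q (h x)" "y \<in> A \<and> Q (h y)" for x y
    proof -
      have xy: "x \<in> topspace X" "y \<in> topspace X" using that A by auto
      then have "h (x - y) \<in> h ` U" using that Q(2) by (simp add: h_diff)
      then show ?thesis using inj_on_image_mem_iff[OF h_inj diff_mem[OF xy] UX] by simp
    qed
    ultimately show "\<forall>\<^sub>F (x, y) in filtermap g F \<times>\<^sub>F filtermap g F. x - y \<in> U"
      unfolding eventually_prod_same
      by (intro exI[of _ "\<lambda>x. x \<in> A \<and> Q (h x)"]) simp
  qed
  moreover have "filtermap g F \<le> principal A"
    unfolding le_principal eventually_filtermap using FA by eventually_elim (auto simp: gh)
  moreover have "filtermap g F \<noteq> bot" using F by (simp add: filtermap_bot_iff)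
  ultimately obtain x where x: "x \<in> A" "limitin X (\<lambda>z. z) x (filtermap g F)"
    using comp unfolding complete_in_def by blast
  then have "limitin X g x F" by (simp add: limitin_def eventually_filtermap)
  then have "limitin Z (h \<circ> g) (h x) F"
    by (rule continuous_map_limit[OF homeomorphic_imp_continuous_map[OF homeo]])
  moreover have "\<forall>\<^sub>F z in F. (h \<circ> g) z = z"
    using FA by eventually_elim (auto simp: gh)
  ultimately have "limitin Z (\<lambda>z. z) (h x) F"
    by (rule limitin_transform_eventually[rotated])
  then show "\<exists>z\<in>h ` A. limitin Z (\<lambda>z. z) z F" using x(1) by blast
qed

lemma complete_lcs_image: "complete_lcs X \<Longrightarrow> complete_lcs Z"
  using complete_in_image[of "topspace X"] by (simp add: complete_lcs_def h_image)

lemma quasi_complete_lcs_image: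
  assumes "quasi_complete_lcs s X"
  shows "quasi_complete_lcs t Z"
  unfolding quasi_complete_lcs_def
proof (intro allI impI)
  fix A assume A: "closedin Z A \<and> bounded_in t Z A"
  define A' where "A' = {x \<in> topspace X. h x \<in> A}"
  have "closedin X A'"
    unfolding A'_def using A homeomorphic_imp_continuous_map[OF homeo]
    by (intro closedin_continuous_map_preimage) auto
  moreover have "absorbs s U A'" if U: "zero_nhd X U" for U
  proof -
    have UX: "U \<subseteq> topspace X" using U by (simp add: zero_nhd_def)
    obtain r where r: "r > 0" "\<And>c. r \<le> norm c \<Longrightarrow> A \<subseteq> t c ` h ` U"
      using A zero_nhd_image[OF U] unfolding bounded_in_def absorbs_def by meson
    have "x \<in> s c ` U" if c: "r \<le> norm c" and x: "x \<in> A'" for c x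
    proof -
      obtain w where w: "w \<in> U" "h x = t c (h w)" using r(2)[OF c] x by (auto simp: A'_def)
      then have "h x = h (s c w)" using UX by (simp add: h_scale subsetD)
      moreover have "x \<in> topspace X" "s c w \<in> topspace X"
        using x w(1) UX scale_mem by (auto simp: A'_def)
      ultimately have "x = s c w" using h_inj by (simp add: inj_on_def)
      then show ?thesis using w by blast
    qed
    then show ?thesis unfolding absorbs_def using r(1) by blast
  qed
  ultimately have "complete_in X A'"
    using assms by (auto simp: quasi_complete_lcs_def bounded_in_def A'_def)
  then have "complete_in Z (h ` A')" by (intro complete_in_image) (auto simp: A'_def)
  moreover have "h ` A' = A" using A h_image by (auto simp: A'_def bounded_in_def)
  ultimately show "complete_in Z A" by simp
qed

end

section \<open>Strong linearisations\<close>

locale linearisation =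
  lcs_operators sY Y sE \<Gamma> + LE: lcs sE "seminorm_topology UNIV \<Gamma>" +
  FF: seminorm_family "fun_scale (*)" V \<Gamma>\<^sub>F
  for sY :: "'k::real_or_complex \<Rightarrow> 'y::ab_group_add \<Rightarrow> 'y" and Y :: "'y topology"
    and sE :: "'k \<Rightarrow> 'e::ab_group_add \<Rightarrow> 'e" and \<Gamma> :: "('e \<Rightarrow> real) set"
    and V :: "('x \<Rightarrow> 'k) set" and \<Gamma>\<^sub>F :: "(('x \<Rightarrow> 'k) \<Rightarrow> real) set" +
  fixes \<delta> :: "'x \<Rightarrow> 'y" and T :: "('x \<Rightarrow> 'k) \<Rightarrow> 'y \<Rightarrow> 'k"
  assumes T: "topological_isomorphism (fun_scale (*)) (seminorm_topology V \<Gamma>\<^sub>F) (fun_scale (*)) (dual_b sY Y) T"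
    and T_delta: "f \<in> V \<Longrightarrow> T f \<circ> \<delta> = f"
    and qb: "quasi_barrelled sY Y"
    and complete: "complete_lcs (seminorm_topology UNIV \<Gamma>)"
begin

text \<open>\<open>K.CL\<close> is the dual of \<open>Y\<close>, with \<open>K.L_seminorms\<close>
  defining its strong topology; in the next instance \<open>D.CL\<close> is the dual of
  \<open>E\<close>.\<close>

sublocale K: lcs_operators sY Y "(*)" "{norm}"
  by (intro lcs_operators.intro Y.lcs_axioms seminorm_family_scalars)

sublocale D: lcs_operators sE E "(*)" "{norm}"
  by (intro lcs_operators.intro LE.lcs_axioms seminorm_family_scalars)

abbreviation F :: "('x \<Rightarrow> 'k) topology" where "F \<equiv> seminorm_topology V \<Gamma>\<^sub>F"

lemma dual_Y: "dual sY Y = K.CL" and dual_E: "dual sE E = D.CL"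
  by (simp_all only: dual_def euclidean_scalars)

lemma dual_b_Y: "dual_b sY Y = seminorm_topology K.CL K.L_seminorms"
  by (simp only: dual_b_def euclidean_scalars K.L_b_eq)

lemma cont_seminorm_norm: "K.cont_seminorm norm"
  by (rule K.cont_seminorm_member) simp

lemma hausdorff: "Hausdorff_space E"
  using LE.lc by (simp add: lc_hausdorff_space_def)

lemma T_add: "f \<in> V \<Longrightarrow> g \<in> V \<Longrightarrow> T (f + g) = T f + T g"
  and T_scale: "f \<in> V \<Longrightarrow> T (fun_scale (*) a f) = fun_scale (*) a (T f)"
  and T_homeo: "homeomorphic_map F (dual_b sY Y) T"
  using T by (auto simp: topological_isomorphism_def)

lemma T_image: "T ` V = K.CL"
  using T_homeo by (auto simp: homeomorphic_eq_everything_map dual_b_Y)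

lemma T_mem: "f \<in> V \<Longrightarrow> T f \<in> K.CL"
  using T_image by blast

lemma T_zero: "T 0 = 0"
  using T_add[of 0 0] by simp

text \<open>Because \<open>T\<close> is onto the dual of \<open>Y\<close>, the identity
  \<open>T f \<circ> \<delta> = f\<close> says that precomposition with \<open>\<delta>\<close> is
  the inverse of \<open>T\<close>. In particular a functional is determined by its values at the
  points \<open>\<delta> x\<close>.\<close>

lemma compose_delta:
  assumes "g \<in> K.CL"
  shows "g \<circ> \<delta> \<in> V" "T (g \<circ> \<delta>) = g"
  using assms T_delta unfolding T_image[symmetric] by auto

lemma dominated_T:
  assumes "B \<noteq> {}" "bounded_in sY Y B"
  shows "dominated V \<Gamma>\<^sub>F (\<lambda>f. K.sup_seminorm B norm (T f))"
proof -
  have "continuous_map F (seminorm_topology K.CL K.L_seminorms) T"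
    using homeomorphic_imp_continuous_map[OF T_homeo] by (simp add: dual_b_Y)
  then have "\<forall>r\<in>K.L_seminorms. dominated V \<Gamma>\<^sub>F (\<lambda>f. r (T f))"
    using continuous_map_seminorm_topology_iff[OF FF.seminorm_family_axioms K.seminorm_family_L, of T]
      T_image T_add T_scale by blast
  then show ?thesis using K.L_seminormsI[OF assms cont_seminorm_norm] by blast
qed

text \<open>Continuity of the inverse of \<open>T\<close> as an estimate; together with
  \<open>dominated_T\<close> it makes the homeomorphism quantitative in both directions.\<close>

lemma dominated_compose_delta:
  assumes "q \<in> \<Gamma>\<^sub>F"
  shows "dominated K.CL K.L_seminorms (\<lambda>g. q (g \<circ> \<delta>))"
proof -
  obtain S where S: "homeomorphic_maps F (dual_b sY Y) T S"
    using T_homeo homeomorphic_map_maps by blast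
  have "continuous_map (dual_b sY Y) F (\<lambda>g. g \<circ> \<delta>)"
  proof (rule continuous_map_eq)
    show "continuous_map (dual_b sY Y) F S" using S by (simp add: homeomorphic_maps_def)
    fix g assume g: "g \<in> topspace (dual_b sY Y)"
    then have "g \<in> K.CL" by (simp add: dual_b_Y)
    then show "S g = g \<circ> \<delta>"
      using S compose_delta[of g] by (metis FF.topspace homeomorphic_maps_def)
  qed
  then have "continuous_map (seminorm_topology K.CL K.L_seminorms) F (\<lambda>g. g \<circ> \<delta>)"
    by (simp only: dual_b_Y)
  then have "\<forall>q\<in>\<Gamma>\<^sub>F. dominated K.CL K.L_seminorms (\<lambda>g. q (g \<circ> \<delta>))"
    using continuous_map_seminorm_topology_iff[OF K.seminorm_family_L FF.seminorm_family_axioms, of "\<lambda>g. g \<circ> \<delta>"]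
      compose_delta(1) by (auto simp: fun_scale_def plus_fun_def o_def image_subset_iff)
  then show ?thesis using assms by blast
qed

section \<open>Polars of unit balls and norming functionals\<close>

abbreviation U :: "('e \<Rightarrow> real) \<Rightarrow> ('e \<Rightarrow> 'k) set" where "U p \<equiv> U_polar sE E p"

lemma U_dual: "e' \<in> U p \<Longrightarrow> e' \<in> D.CL"
  by (simp add: U_polar_def polar_def dual_E)

lemma U_zero: "0 \<in> U p"
  using D.L.mem(1) by (simp add: U_polar_def polar_def dual_E)

lemma U_ne: "U p \<noteq> {}"
  using U_zero by blast

lemma U_le:
  assumes p: "p \<in> \<Gamma>" and e': "e' \<in> U p"
  shows "norm (e' x) \<le> p x"
\<comment> \<open>For \<open>t > p x\<close> the vector \<open>x\<close> divided by \<open>t\<close>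
  lies in the open unit ball of \<open>p\<close>. Using all such \<open>t\<close> avoids dividing by
  \<open>p x\<close>, which may be 0.\<close>
proof (rule dense_ge)
  fix t assume t: "p x < t"
  have pos: "0 < t" using t seminorm_onD(1)[OF E.seminorm[OF p], of x] by simp
  have "p (sE (of_real (1 / t)) x) = p x / t"
    using seminorm_onD(3)[OF E.seminorm[OF p], of x "of_real (1 / t)"] pos by (simp add: norm_divide)
  then have "norm (e' (sE (of_real (1 / t)) x)) \<le> 1"
    using e' t pos by (simp add: U_polar_def polar_def)
  then have "norm (of_real (1 / t) * e' x) \<le> 1"
    by (simp only: D.CL_simps(2)[OF U_dual[OF e']])
  then show "norm (e' x) \<le> t" using pos by (simp add: norm_mult norm_divide divide_le_eq)
qed

text \<open>The Hahn-Banach functional \<open>f\<close> is dominated by the seminorm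
  \<open>p\<close>, which does not change under unit scalars; so \<open>norm (g z) \<le> p z\<close>
  everywhere, while \<open>f x = p x\<close> gives the lower bound at \<open>x\<close>.\<close>

lemma U_norming:
  assumes p: "p \<in> \<Gamma>"
  obtains e' where "e' \<in> U p" "p x \<le> norm (e' x)"
proof -
  note pD = seminorm_onD[OF E.seminorm[OF p], simplified]
  have "sublinear sE p" using pD by (simp add: sublinear_def)
  then obtain f where f: "\<And>x y. f (x + y) = f x + f y" "\<And>r x. f (sE (of_real r) x) = r * f x"
      "\<And>x. f x \<le> p x" "f x = p x"
    using hahn_banach_sublinear[OF E.vector_space_axioms] by metis
  obtain g where g: "Vector_Spaces.linear sE (*) g"
      "\<And>z. \<exists>c. norm c = 1 \<and> norm (g z) = f (sE c z)" "\<And>z. f z \<le> norm (g z)"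
    using real_linear_imp_linear[OF E.vector_space_axioms f(1,2)] by metis
  have g_le: "norm (g z) \<le> p z" for z
  proof -
    obtain c where "norm c = 1" "norm (g z) = f (sE c z)" using g(2) by metis
    then show ?thesis using f(3)[of "sE c z"] pD(3)[of c z] by simp
  qed
  have "g \<in> D.CL"
  proof (rule D.CLI[OF g(1)])
    show "zero_nhd E {z. r (g z) \<le> 1}" if "r \<in> {norm}" for r
    proof (rule LE.zero_nhd_mono)
      show "zero_nhd E {z \<in> UNIV. p z < 1}" using p by (rule E.zero_nhd_ball) simp
      show "{z \<in> UNIV. p z < 1} \<subseteq> {z. r (g z) \<le> 1}"
        using that g_le by (auto intro: order_trans less_imp_le)
    qed
  qed
  moreover have "norm (g z) \<le> 1" if "p z < 1" for z using g_le[of z] that by simp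
  ultimately have "g \<in> U p" by (simp add: U_polar_def polar_def dual_E)
  then show thesis using that g(3)[of x] f(4) by simp
qed

lemma dual_separates:
  assumes "\<And>e'. e' \<in> D.CL \<Longrightarrow> e' x = e' z"
  shows "x = z"
proof -
  have "x - z = 0"
  proof (rule E.hausdorff_separates[OF hausdorff])
    fix p assume p: "p \<in> \<Gamma>"
    obtain e' where "e' \<in> U p" "p (x - z) \<le> norm (e' (x - z))" using U_norming[OF p] by metis
    moreover from this have "e' x = e' z" by (intro assms U_dual)
    ultimately have "p (x - z) \<le> 0" using U_dual by (simp add: D.CL_simps)
    then show "p (x - z) = 0" using seminorm_onD(1)[OF E.seminorm[OF p], of "x - z"] by simp
  qed simp
  then show ?thesis by simp
qed

lemma dual_compose: "e' \<in> D.CL \<Longrightarrow> u \<in> CL \<Longrightarrow> e' \<circ> u \<in> K.CL"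
  unfolding cont_linear_maps_def
  using continuous_map_compose by (auto intro!: linear_mapI Y.vector_space_axioms vector_space_mult simp: linear_mapD)

section \<open>The weak function space and uniform estimates over polars\<close>

definition W :: "('x \<Rightarrow> 'e) set" where
  "W = {f. (\<forall>e'\<in>D.CL. e' \<circ> f \<in> V) \<and> (\<forall>q\<in>\<Gamma>\<^sub>F. \<forall>p\<in>\<Gamma>. bdd_above ((\<lambda>e'. q (e' \<circ> f)) ` U p))}"

definition Q :: "(('x \<Rightarrow> 'e) \<Rightarrow> real) set" where
  "Q = {sigma_seminorm sE E q p | q p. q \<in> \<Gamma>\<^sub>F \<and> p \<in> \<Gamma>}"

lemma F_sigma_b_eq: "F_sigma_b F \<Gamma>\<^sub>F sE E \<Gamma> = seminorm_topology W Q"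
  by (simp add: F_sigma_b_def W_def Q_def F_sigma_def dual_E)

text \<open>The bound \<open>m\<close> is chosen before \<open>u\<close> and \<open>e'\<close>.
  Independence of \<open>e'\<close> gives finiteness of the suprema for
  \<open>u \<circ> \<delta>\<close>; domination of \<open>m\<close> gives continuity of
  \<open>chi\<close>.\<close>

lemma bound_compose_delta:
  assumes q: "q \<in> \<Gamma>\<^sub>F" and p: "p \<in> \<Gamma>"
  obtains m where "dominated CL L_seminorms m"
    "\<And>u e'. u \<in> CL \<Longrightarrow> e' \<in> U p \<Longrightarrow> q (e' \<circ> (u \<circ> \<delta>)) \<le> m u"
proof -
  obtain G C where G: "finite G" "G \<subseteq> K.L_seminorms" "0 \<le> C"
      "\<And>g. g \<in> K.CL \<Longrightarrow> q (g \<circ> \<delta>) \<le> C * (\<Sum>r\<in>G. r g)"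
    using dominated_compose_delta[OF q] by (auto simp: dominated_def)
  have "\<exists>m. dominated CL L_seminorms m \<and> (\<forall>u\<in>CL. \<forall>e'\<in>U p. r (e' \<circ> u) \<le> m u)" if r: "r \<in> G" for r
  proof -
    obtain B \<rho> where B: "r = K.sup_seminorm B \<rho>" "B \<noteq> {}" "bounded_in sY Y B" and \<rho>: "K.cont_seminorm \<rho>"
      using r G(2) unfolding K.L_seminorms_def by blast
    note cp = cont_seminorm_member[OF p]
    \<comment> \<open>The strong dual admits any continuous seminorm \<open>\<rho>\<close> on the
      scalars, and homogeneity makes it \<open>\<rho> 1\<close> times \<open>norm\<close>.\<close>
    have "r (e' \<circ> u) \<le> \<rho> 1 * sup_seminorm B p u" if u: "u \<in> CL" and e': "e' \<in> U p" for u e'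
      unfolding B(1)
    proof (rule K.sup_seminorm_le[OF B(2)])
      fix y assume y: "y \<in> B"
      have "\<rho> ((e' \<circ> u) y) = norm (e' (u y)) * \<rho> 1"
        using K.cont_seminormD(3)[OF \<rho>, of "e' (u y)" 1] by simp
      also have "\<dots> \<le> sup_seminorm B p u * \<rho> 1"
        using U_le[OF p e', of "u y"] le_sup_seminorm[OF u cp B(3) y] K.cont_seminormD(1)[OF \<rho>]
        by (intro mult_right_mono) auto
      finally show "\<rho> ((e' \<circ> u) y) \<le> \<rho> 1 * sup_seminorm B p u" by (simp add: mult.commute)
    qed
    moreover have "dominated CL L_seminorms (\<lambda>u. \<rho> 1 * sup_seminorm B p u)"
      by (rule L.dominated_le[OF L.dominated_member[OF L_seminormsI[OF B(2,3) cp]] K.cont_seminormD(1)[OF \<rho>]])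
        (rule order_refl)
    ultimately show ?thesis by blast
  qed
  then have "\<forall>r\<in>G. \<exists>m. dominated CL L_seminorms m \<and> (\<forall>u\<in>CL. \<forall>e'\<in>U p. r (e' \<circ> u) \<le> m u)" ..
  from bchoice[OF this] obtain m where m: "\<And>r. r \<in> G \<Longrightarrow> dominated CL L_seminorms (m r)"
      "\<And>r u e'. r \<in> G \<Longrightarrow> u \<in> CL \<Longrightarrow> e' \<in> U p \<Longrightarrow> r (e' \<circ> u) \<le> m r u"
    by blast
  show thesis
  proof (rule that)
    show "dominated CL L_seminorms (\<lambda>u. C * (\<Sum>r\<in>G. m r u))"
      using L.dominated_sum[OF G(1) m(1) G(3)] by simp
    fix u e' assume u: "u \<in> CL" and e': "e' \<in> U p"
    have "q ((e' \<circ> u) \<circ> \<delta>) \<le> C * (\<Sum>r\<in>G. r (e' \<circ> u))"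
      by (intro G(4) dual_compose U_dual[OF e'] u)
    also have "\<dots> \<le> C * (\<Sum>r\<in>G. m r u)"
      using m(2) u e' by (intro mult_left_mono G(3) sum_mono) auto
    finally show "q (e' \<circ> (u \<circ> \<delta>)) \<le> C * (\<Sum>r\<in>G. m r u)" by (simp add: comp_assoc)
  qed
qed

lemma compose_delta_mem:
  assumes u: "u \<in> CL"
  shows "u \<circ> \<delta> \<in> W"
  unfolding W_def
proof (intro CollectI conjI ballI)
  fix e' assume "e' \<in> D.CL"
  then have "(e' \<circ> u) \<circ> \<delta> \<in> V" by (intro compose_delta dual_compose u)
  then show "e' \<circ> (u \<circ> \<delta>) \<in> V" by (simp add: comp_assoc)
next
  fix q p assume "q \<in> \<Gamma>\<^sub>F" "p \<in> \<Gamma>"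
  then obtain m where "\<And>u e'. u \<in> CL \<Longrightarrow> e' \<in> U p \<Longrightarrow> q (e' \<circ> (u \<circ> \<delta>)) \<le> m u"
    using bound_compose_delta by metis
  then show "bdd_above ((\<lambda>e'. q (e' \<circ> (u \<circ> \<delta>))) ` U p)"
    using u by (intro bdd_aboveI2)
qed

lemma dual_eq_T:
  assumes "u \<in> CL" "e' \<in> D.CL"
  shows "e' (u y) = T (e' \<circ> (u \<circ> \<delta>)) y"
  using compose_delta(2)[OF dual_compose[OF assms(2,1)]] by (metis comp_apply comp_assoc)

lemma sigma_seminorm_upper:
  "f \<in> W \<Longrightarrow> q \<in> \<Gamma>\<^sub>F \<Longrightarrow> p \<in> \<Gamma> \<Longrightarrow> e' \<in> U p \<Longrightarrow> q (e' \<circ> f) \<le> sigma_seminorm sE E q p f"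
  unfolding sigma_seminorm_def by (rule cSUP_upper) (auto simp: W_def)

text \<open>\<open>G\<close> and \<open>C\<close> depend only on \<open>B\<close>, not on
  \<open>f\<close>, \<open>e'\<close> or \<open>y\<close>. With \<open>f\<close> fixed this gives
  the uniform bound behind equicontinuity, with \<open>f\<close> varying the continuity of the
  inverse of \<open>chi\<close>.\<close>

lemma bound_T:
  assumes p: "p \<in> \<Gamma>" and B: "B \<noteq> {}" "bounded_in sY Y B"
  obtains G C where "finite G" "G \<subseteq> \<Gamma>\<^sub>F" "0 \<le> C"
    "\<And>f e' y. f \<in> W \<Longrightarrow> e' \<in> U p \<Longrightarrow> y \<in> B \<Longrightarrow>
      norm (T (e' \<circ> f) y) \<le> C * (\<Sum>q\<in>G. sigma_seminorm sE E q p f)"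
proof -
  obtain G C where G: "finite G" "G \<subseteq> \<Gamma>\<^sub>F" "0 \<le> C"
      "\<And>f. f \<in> V \<Longrightarrow> K.sup_seminorm B norm (T f) \<le> C * (\<Sum>q\<in>G. q f)"
    using dominated_T[OF B] by (auto simp: dominated_def)
  have "norm (T (e' \<circ> f) y) \<le> C * (\<Sum>q\<in>G. sigma_seminorm sE E q p f)"
    if f: "f \<in> W" and e': "e' \<in> U p" and y: "y \<in> B" for f e' y
  proof -
    have fV: "e' \<circ> f \<in> V" using f U_dual[OF e'] by (auto simp: W_def)
    have "norm (T (e' \<circ> f) y) \<le> K.sup_seminorm B norm (T (e' \<circ> f))"
      by (rule K.le_sup_seminorm[OF T_mem[OF fV] cont_seminorm_norm B(2) y])
    also have "\<dots> \<le> C * (\<Sum>q\<in>G. q (e' \<circ> f))" by (rule G(4)[OF fV])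
    also have "\<dots> \<le> C * (\<Sum>q\<in>G. sigma_seminorm sE E q p f)"
      using G(2) f p e' by (intro mult_left_mono G(3) sum_mono sigma_seminorm_upper) auto
    finally show ?thesis .
  qed
  then show thesis using that G(1-3) by blast
qed

section \<open>Construction of a continuous linear preimage of a weak function\<close>

lemma equicontinuous_T:
  assumes f: "f \<in> W" and p: "p \<in> \<Gamma>"
  shows "zero_nhd Y {y. \<forall>e'\<in>U p. norm (T (e' \<circ> f) y) \<le> 1}"
proof -
  have H: "(\<lambda>e'. T (e' \<circ> f)) ` U p \<subseteq> K.CL"
    using f U_dual T_mem by (auto simp: W_def)
  have "\<exists>M. \<forall>v\<in>(\<lambda>e'. T (e' \<circ> f)) ` U p. \<forall>y\<in>B. norm (v y) \<le> M" if B: "bounded_in sY Y B" for B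
  proof (cases "B = {}")
    case False
    then obtain G C where "\<And>e' y. e' \<in> U p \<Longrightarrow> y \<in> B \<Longrightarrow>
        norm (T (e' \<circ> f) y) \<le> C * (\<Sum>q\<in>G. sigma_seminorm sE E q p f)"
      using bound_T[OF p False B] f by metis
    then show ?thesis by blast
  qed simp
  from K.quasi_barrelled_equicontinuous[OF qb H cont_seminorm_norm this]
  show ?thesis by (simp only: ball_simps)
qed

text \<open>Near \<open>y\<close> the points \<open>w z\<close> found for \<open>z\<close> in
  \<open>R\<close> form a Cauchy filter: a functional norming \<open>w z - w z'\<close> converts its
  seminorm into the difference of \<open>T (e' \<circ> f) (z - y)\<close> and
  \<open>T (e' \<circ> f) (z' - y)\<close>, small uniformly in \<open>e'\<close>. Its limit
  represents the functional belonging to \<open>y\<close>.\<close>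

lemma pointwise_preimage:
  assumes f: "f \<in> W"
  shows "\<exists>x. \<forall>e'\<in>D.CL. e' x = T (e' \<circ> f) y"
proof -
  define R where "R = {z. \<exists>x. \<forall>e'\<in>D.CL. e' x = T (e' \<circ> f) z}"
  have \<Phi>: "T (e' \<circ> f) \<in> K.CL" if "e' \<in> D.CL" for e'
    using f that T_mem by (auto simp: W_def)
  have "Y.subspace R"
    unfolding Y.subspace_def
  proof (intro conjI ballI allI)
    show "0 \<in> R" unfolding R_def using K.CL_simps(4)[OF \<Phi>] D.CL_simps(4) by auto
  next
    fix z w assume "z \<in> R" "w \<in> R"
    then obtain a b where "\<forall>e'\<in>D.CL. e' a = T (e' \<circ> f) z" "\<forall>e'\<in>D.CL. e' b = T (e' \<circ> f) w"
      by (auto simp: R_def)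
    then have "\<forall>e'\<in>D.CL. e' (a + b) = T (e' \<circ> f) (z + w)"
      using K.CL_simps(1)[OF \<Phi>] by (simp add: D.CL_simps)
    then show "z + w \<in> R" by (auto simp: R_def)
  next
    fix c z assume "z \<in> R"
    then obtain a where "\<forall>e'\<in>D.CL. e' a = T (e' \<circ> f) z" by (auto simp: R_def)
    then have "\<forall>e'\<in>D.CL. e' (sE c a) = T (e' \<circ> f) (sY c z)"
      using K.CL_simps(2)[OF \<Phi>] by (simp add: D.CL_simps)
    then show "sY c z \<in> R" by (auto simp: R_def)
  qed
  moreover have "g z = 0" if g: "g \<in> dual sY Y" and ann: "\<And>m. m \<in> R \<Longrightarrow> g m = 0" for g z
  proof -
    have gCL: "g \<in> K.CL" using g dual_Y by simp
    have "\<delta> x \<in> R" for x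
    proof -
      have "e' (f x) = T (e' \<circ> f) (\<delta> x)" if "e' \<in> D.CL" for e'
        using T_delta[of "e' \<circ> f"] f that by (auto simp: W_def o_def fun_eq_iff)
      then show ?thesis by (auto simp: R_def)
    qed
    then have "g \<circ> \<delta> = 0" using ann by (simp add: fun_eq_iff)
    then show ?thesis using compose_delta(2)[OF gCL] T_zero by simp
  qed
  ultimately have "Y closure_of R = UNIV" by (rule Y.dense_subspace)
  then have y: "y \<in> Y closure_of R" by simp
  have "\<forall>z\<in>R. \<exists>x. \<forall>e'\<in>D.CL. e' x = T (e' \<circ> f) z" by (simp add: R_def)
  from bchoice[OF this]
  obtain w where w: "\<And>z e'. z \<in> R \<Longrightarrow> e' \<in> D.CL \<Longrightarrow> e' (w z) = T (e' \<circ> f) z" by blast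
  \<comment> \<open>The trace on \<open>R\<close> of the neighbourhoods of \<open>y\<close>,
    nontrivial because \<open>y\<close> lies in the closure of \<open>R\<close>.\<close>
  define N where "N = inf (nhdsin Y y) (principal R)"
  have ev_N: "eventually P N \<longleftrightarrow> (\<exists>S. openin Y S \<and> y \<in> S \<and> (\<forall>x\<in>S. x \<in> R \<longrightarrow> P x))" for P
    by (simp add: N_def eventually_inf_principal eventually_nhdsin)
  have N_bot: "N \<noteq> bot"
    using y ev_N[of "\<lambda>_. False"] by (auto simp: in_closure_of trivial_limit_def)
  have N_R: "\<forall>\<^sub>F z in N. z \<in> R"
    unfolding ev_N using openin_topspace[of Y] by (intro exI[of _ UNIV]) simp
  have "cauchy_filter_in E (filtermap w N)"
  proof (rule E.cauchy_filter_inI)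
    fix p and \<epsilon> :: real assume p: "p \<in> \<Gamma>" and \<epsilon>: "0 < \<epsilon>"
    \<comment> \<open>The equicontinuity neighbourhood shrunk by \<open>\<epsilon> / 3\<close>: the
      two errors met below then add up to at most \<open>2 \<epsilon> / 3\<close>, strictly less
      than \<open>\<epsilon>\<close>.\<close>
    define A where "A = {z. sY (of_real (3 / \<epsilon>)) z \<in> {z. \<forall>e'\<in>U p. norm (T (e' \<circ> f) z) \<le> 1}}"
    have small: "norm (T (e' \<circ> f) z) \<le> \<epsilon> / 3" if z: "z \<in> A" and e': "e' \<in> U p" for z e'
    proof -
      have "norm (T (e' \<circ> f) (sY (of_real (3 / \<epsilon>)) z)) \<le> 1" using z e' by (auto simp: A_def)
      then have "norm (of_real (3 / \<epsilon>) * T (e' \<circ> f) z) \<le> 1"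
        by (simp only: K.CL_simps(2)[OF \<Phi>[OF U_dual[OF e']]])
      then show ?thesis using \<epsilon> by (simp add: norm_mult norm_divide field_simps)
    qed
    have "zero_nhd Y A"
      unfolding A_def by (rule Y.zero_nhd_scale[OF equicontinuous_T[OF f p]])
    then obtain S where S: "openin Y S" "0 \<in> S" "S \<subseteq> A" unfolding Y.zero_nhd_alt by blast
    have "\<forall>\<^sub>F z in N. z \<in> R \<and> z - y \<in> A"
      unfolding ev_N using S Y.openin_translate[OF S(1), of "- y"]
      by (intro exI[of _ "{z. - y + z \<in> S}"]) auto
    then have "\<forall>\<^sub>F x in filtermap w N. \<exists>z. z \<in> R \<and> z - y \<in> A \<and> x = w z"
      unfolding eventually_filtermap by eventually_elim auto
    moreover have "p (w z - w z') < \<epsilon>" if z: "z \<in> R" "z - y \<in> A" "z' \<in> R" "z' - y \<in> A" for z z'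
    proof -
      obtain e' where e': "e' \<in> U p" "p (w z - w z') \<le> norm (e' (w z - w z'))"
        using U_norming[OF p] by metis
      have "e' (w z - w z') = T (e' \<circ> f) (z - y) - T (e' \<circ> f) (z' - y)"
        using U_dual[OF e'(1)] by (simp add: D.CL_simps w z K.CL_simps(3)[OF \<Phi>])
      then have "norm (e' (w z - w z')) \<le> \<epsilon> / 3 + \<epsilon> / 3"
        using norm_triangle_ineq4[of "T (e' \<circ> f) (z - y)" "T (e' \<circ> f) (z' - y)"]
          small[OF z(2) e'(1)] small[OF z(4) e'(1)] by simp
      then show ?thesis using e'(2) \<epsilon> by simp
    qed
    ultimately show "\<forall>\<^sub>F (x, x') in filtermap w N \<times>\<^sub>F filtermap w N. p (x - x') < \<epsilon>"
      unfolding eventually_prod_same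
      by (intro exI[of _ "\<lambda>x. \<exists>z. z \<in> R \<and> z - y \<in> A \<and> x = w z"]) auto
  qed (simp add: split_def)
  moreover have "filtermap w N \<noteq> bot" using N_bot by (simp add: filtermap_bot_iff)
  ultimately obtain x where "limitin E (\<lambda>z. z) x (filtermap w N)"
    using complete unfolding complete_lcs_def complete_in_def by auto
  then have x: "limitin E w x N" by (simp add: limitin_def eventually_filtermap)
  have "e' x = T (e' \<circ> f) y" if e': "e' \<in> D.CL" for e'
  \<comment> \<open>On \<open>R\<close> the functions \<open>e' \<circ> w\<close> and
    \<open>T (e' \<circ> f)\<close> agree; along \<open>N\<close> one tends to \<open>e' x\<close>,
    the other to \<open>T (e' \<circ> f) y\<close>, by continuity of \<open>e'\<close> and of
    \<open>T (e' \<circ> f)\<close>.\<close>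
  proof (rule tendsto_unique[OF N_bot])
    have "limitin (seminorm_topology UNIV {norm}) (e' \<circ> w) (e' x) N"
      using x by (rule continuous_map_limit[OF D.CL_continuous[OF e']])
    then have "limitin euclidean (e' \<circ> w) (e' x) N" by (simp only: euclidean_scalars)
    then have "((e' \<circ> w) \<longlongrightarrow> e' x) N" by simp
    moreover have "\<forall>\<^sub>F z in N. (e' \<circ> w) z = T (e' \<circ> f) z"
      using N_R by eventually_elim (simp add: w e')
    ultimately show "((\<lambda>z. T (e' \<circ> f) z) \<longlongrightarrow> e' x) N"
      by (rule Lim_transform_eventually)
    have "limitin Y (\<lambda>z. z) y N"
      unfolding limitin_def ev_N by auto
    then have "limitin (seminorm_topology UNIV {norm}) (T (e' \<circ> f) \<circ> (\<lambda>z. z)) (T (e' \<circ> f) y) N"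
      by (rule continuous_map_limit[OF K.CL_continuous[OF \<Phi>[OF e']]])
    then have "limitin euclidean (T (e' \<circ> f) \<circ> (\<lambda>z. z)) (T (e' \<circ> f) y) N"
      by (simp only: euclidean_scalars)
    then show "((\<lambda>z. T (e' \<circ> f) z) \<longlongrightarrow> T (e' \<circ> f) y) N" by (simp add: o_def)
  qed
  then show ?thesis by blast
qed

text \<open>The values of \<open>u\<close> are chosen point by point, but the dual of
  \<open>E\<close> separates points, so linearity and \<open>u \<circ> \<delta> = f\<close> may be
  checked after applying each \<open>e'\<close>. Continuity follows from equicontinuity, a norming
  functional replacing \<open>p (u y)\<close> by a value of some
  \<open>T (e' \<circ> f)\<close>.\<close>

lemma preimage:
  assumes f: "f \<in> W"
  obtains u where "u \<in> CL" "u \<circ> \<delta> = f"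
proof -
  obtain u where u: "\<And>y e'. e' \<in> D.CL \<Longrightarrow> e' (u y) = T (e' \<circ> f) y"
    using pointwise_preimage[OF f] by metis
  have \<Phi>: "T (e' \<circ> f) \<in> K.CL" if "e' \<in> D.CL" for e'
    using f that T_mem by (auto simp: W_def)
  show thesis
  proof (rule that)
    show "u \<circ> \<delta> = f"
    proof
      fix x show "(u \<circ> \<delta>) x = f x"
      proof (rule dual_separates)
        fix e' assume e': "e' \<in> D.CL"
        then have "T (e' \<circ> f) \<circ> \<delta> = e' \<circ> f" using T_delta f by (auto simp: W_def)
        then show "e' ((u \<circ> \<delta>) x) = e' (f x)" using u[OF e'] by (simp add: fun_eq_iff)
      qed
    qed
    show "u \<in> CL"
    proof (rule CLI)
      show "Vector_Spaces.linear sY sE u"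
      proof (rule linear_mapI[OF Y.vector_space_axioms E.vector_space_axioms])
        show "u (x + y) = u x + u y" for x y
          by (rule dual_separates) (simp add: u D.CL_simps K.CL_simps[OF \<Phi>])
        show "u (sY a x) = sE a (u x)" for a x
          by (rule dual_separates) (simp add: u D.CL_simps K.CL_simps[OF \<Phi>])
      qed
      fix p assume p: "p \<in> \<Gamma>"
      have "p (u y) \<le> 1" if "\<forall>e'\<in>U p. norm (T (e' \<circ> f) y) \<le> 1" for y
      proof -
        obtain e' where "e' \<in> U p" "p (u y) \<le> norm (e' (u y))" using U_norming[OF p] by metis
        then show ?thesis using that u[OF U_dual, of e' p y] by force
      qed
      then show "zero_nhd Y {y. p (u y) \<le> 1}"
        by (intro Y.zero_nhd_mono[OF equicontinuous_T[OF f p]]) auto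
    qed
  qed
qed

section \<open>The isomorphism and its inverse\<close>

abbreviation chi :: "('y \<Rightarrow> 'e) \<Rightarrow> 'x \<Rightarrow> 'e" where "chi \<equiv> (\<lambda>u. u \<circ> \<delta>)"

lemma chi_image: "chi ` CL = W"
  using preimage compose_delta_mem by (auto simp: image_iff)

text \<open>By \<open>dual_eq_T\<close> the values \<open>e' (u y)\<close> depend on
  \<open>u \<circ> \<delta>\<close> only, and the functionals \<open>e'\<close> separate
  points.\<close>

lemma chi_inj: "inj_on chi CL"
proof (rule inj_onI)
  fix u v assume uv: "u \<in> CL" "v \<in> CL" "u \<circ> \<delta> = v \<circ> \<delta>"
  show "u = v"
  proof
    fix y show "u y = v y"
      by (rule dual_separates) (simp add: dual_eq_T uv)
  qed
qed

text \<open>That \<open>W\<close> is a subspace is read off from \<open>CL\<close> through the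
  surjection \<open>chi\<close>, rather than by estimating suprema.\<close>

lemma seminorm_family_W: "seminorm_family (fun_scale sE) W Q"
proof -
  interpret fs: vector_space "fun_scale sE" by (rule vector_space_fun_scale) unfold_locales
  show ?thesis
  proof
    show sub: "fs.subspace W"
      unfolding fs.subspace_def
    proof (intro conjI ballI allI)
      show "0 \<in> W" using compose_delta_mem[OF L.mem(1)] by (simp add: zero_fun_def o_def)
    next
      fix f g assume "f \<in> W" "g \<in> W"
      then obtain u v where uv: "u \<in> CL" "v \<in> CL" "f = chi u" "g = chi v" using preimage by metis
      then have "f + g = chi (u + v)" by (simp add: plus_fun_def o_def)
      then show "f + g \<in> W" using compose_delta_mem uv L.mem(3) by metis
    next
      fix a f assume "f \<in> W"
      then obtain u where u: "u \<in> CL" "f = chi u" using preimage by metis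
      then have "fun_scale sE a f = chi (fun_scale sE a u)" by (simp add: fun_scale_def o_def)
      then show "fun_scale sE a f \<in> W" using compose_delta_mem u L.mem(4) by metis
    qed
    fix r assume "r \<in> Q"
    then obtain q p where r: "r = sigma_seminorm sE E q p" and q: "q \<in> \<Gamma>\<^sub>F" and p: "p \<in> \<Gamma>"
      by (auto simp: Q_def)
    have "seminorm_on (fun_scale sE) W (\<lambda>f. SUP e'\<in>U p. q (e' \<circ> f))"
    proof (rule seminorm_on_SUP[OF U_ne])
      fix e' assume "e' \<in> U p"
      then have e': "e' \<in> D.CL" by (rule U_dual)
      note qD = seminorm_onD[OF FF.seminorm[OF q]]
      have V: "e' \<circ> f \<in> V" if "f \<in> W" for f using that e' by (simp add: W_def)
      have "e' \<circ> (f + g) = (e' \<circ> f) + (e' \<circ> g)" for f g :: "'x \<Rightarrow> 'e"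
        using e' by (simp add: fun_eq_iff D.CL_simps)
      moreover have "e' \<circ> fun_scale sE a f = fun_scale (*) a (e' \<circ> f)" for a and f :: "'x \<Rightarrow> 'e"
        using e' by (simp add: fun_eq_iff D.CL_simps fun_scale_def)
      ultimately show "seminorm_on (fun_scale sE) W (\<lambda>f. q (e' \<circ> f))"
        using qD V by (simp add: seminorm_on_def)
    next
      show "bdd_above ((\<lambda>e'. q (e' \<circ> f)) ` U p)" if "f \<in> W" for f
        using that q p by (simp add: W_def)
      show "fun_scale sE a f \<in> W" if "f \<in> W" for a f
        using sub that by (rule fs.subspace_scale)
    qed
    then show "seminorm_on (fun_scale sE) W r" by (simp add: r sigma_seminorm_def[abs_def])
  qed
qed

sublocale W: seminorm_family "fun_scale sE" W Q
  by (rule seminorm_family_W)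

lemma chi_add: "chi (u + v) = chi u + chi v" and chi_scale: "chi (fun_scale sE a u) = fun_scale sE a (chi u)"
  by (simp_all add: fun_eq_iff fun_scale_def)

lemma continuous_chi: "continuous_map (seminorm_topology CL L_seminorms) (seminorm_topology W Q) chi"
proof (subst continuous_map_seminorm_topology_iff[OF seminorm_family_L seminorm_family_W])
  show "\<forall>r\<in>Q. dominated CL L_seminorms (\<lambda>u. r (chi u))"
  proof
    fix r assume "r \<in> Q"
    then obtain q p where r: "r = sigma_seminorm sE E q p" and q: "q \<in> \<Gamma>\<^sub>F" and p: "p \<in> \<Gamma>"
      by (auto simp: Q_def)
    obtain m where m: "dominated CL L_seminorms m"
        "\<And>u e'. u \<in> CL \<Longrightarrow> e' \<in> U p \<Longrightarrow> q (e' \<circ> (u \<circ> \<delta>)) \<le> m u"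
      using bound_compose_delta[OF q p] by metis
    have "r (chi u) \<le> m u" if "u \<in> CL" for u
      unfolding r sigma_seminorm_def using m(2)[OF that] by (intro cSUP_least U_ne)
    then show "dominated CL L_seminorms (\<lambda>u. r (chi u))"
      by (intro L.dominated_le[OF m(1), of 1]) simp_all
  qed
qed (use chi_image chi_add chi_scale in auto)

text \<open>A norming functional at \<open>g f y\<close> turns \<open>p (g f y)\<close> into a bound
  by some \<open>norm (T (e' \<circ> f) y)\<close>, which \<open>bound_T\<close> estimates uniformly
  over \<open>y\<close> in \<open>B\<close> by seminorms of \<open>f\<close>.\<close>

lemma continuous_inv_chi:
  "continuous_map (seminorm_topology W Q) (seminorm_topology CL L_seminorms) (inv_into CL chi)"
proof -
  define g where "g = inv_into CL chi"
  have g: "g f \<in> CL" "chi (g f) = f" if "f \<in> W" for f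
    using that unfolding chi_image[symmetric] g_def by (rule inv_into_into, rule f_inv_into_f)
  have gI: "g (chi u) = u" if "u \<in> CL" for u
    unfolding g_def using chi_inj that by (rule inv_into_f_f)
  have "dominated W Q (\<lambda>f. r (g f))" if "r \<in> L_seminorms" for r
  proof -
    obtain B p where B: "r = sup_seminorm B p" "B \<noteq> {}" "bounded_in sY Y B" and p: "cont_seminorm p"
      using \<open>r \<in> L_seminorms\<close> by (auto simp: L_seminorms_def)
    \<comment> \<open>The seminorm in \<open>L_b\<close> is an arbitrary continuous one; norming
      functionals are available for members of \<open>\<Gamma>\<close>, so it is first replaced by
      finitely many of these.\<close>
    obtain H C where H: "finite H" "H \<subseteq> \<Gamma>" "0 \<le> C" "\<And>x. p x \<le> C * (\<Sum>p\<in>H. p x)"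
      using cont_seminorm_dominated[OF p] by (auto simp: dominated_def)
    have "\<exists>m. dominated W Q m \<and> (\<forall>f\<in>W. \<forall>y\<in>B. p (g f y) \<le> m f)" if "p \<in> H" for p
    proof -
      have p: "p \<in> \<Gamma>" using that H(2) by blast
      obtain G D where G: "finite G" "G \<subseteq> \<Gamma>\<^sub>F" "0 \<le> D"
          "\<And>f e' y. f \<in> W \<Longrightarrow> e' \<in> U p \<Longrightarrow> y \<in> B \<Longrightarrow>
            norm (T (e' \<circ> f) y) \<le> D * (\<Sum>q\<in>G. sigma_seminorm sE E q p f)"
        using bound_T[OF p B(2,3)] by metis
      have "p (g f y) \<le> D * (\<Sum>q\<in>G. sigma_seminorm sE E q p f)" if f: "f \<in> W" and y: "y \<in> B" for f y
      proof -
        obtain e' where e': "e' \<in> U p" "p (g f y) \<le> norm (e' (g f y))" using U_norming[OF p] by metis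
        have "e' (g f y) = T (e' \<circ> f) y"
          using dual_eq_T[OF g(1)[OF f] U_dual[OF e'(1)], of y] g(2)[OF f] by simp
        then show ?thesis using e' G(4)[OF f e'(1) y] by simp
      qed
      moreover have "dominated W Q (\<lambda>f. D * (\<Sum>q\<in>G. sigma_seminorm sE E q p f))"
      proof (rule W.dominated_sum[OF G(1) _ G(3)])
        show "dominated W Q (sigma_seminorm sE E q p)" if "q \<in> G" for q
          using that G(2) p by (intro W.dominated_member) (auto simp: Q_def)
      qed simp
      ultimately show ?thesis by blast
    qed
    then have "\<forall>p\<in>H. \<exists>m. dominated W Q m \<and> (\<forall>f\<in>W. \<forall>y\<in>B. p (g f y) \<le> m f)" ..
    from bchoice[OF this] obtain m where m: "\<And>p. p \<in> H \<Longrightarrow> dominated W Q (m p)"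
        "\<And>p f y. p \<in> H \<Longrightarrow> f \<in> W \<Longrightarrow> y \<in> B \<Longrightarrow> p (g f y) \<le> m p f"
      by blast
    have le: "r (g f) \<le> C * (\<Sum>p\<in>H. m p f)" if f: "f \<in> W" for f
      unfolding B(1)
    proof (rule sup_seminorm_le[OF B(2)])
      fix y assume y: "y \<in> B"
      have "(\<Sum>p\<in>H. p (g f y)) \<le> (\<Sum>p\<in>H. m p f)" using m(2) f y by (intro sum_mono)
      then show "p (g f y) \<le> C * (\<Sum>p\<in>H. m p f)"
        using H(4)[of "g f y"] mult_left_mono[OF _ H(3)] by (meson order_trans)
    qed
    show ?thesis
    proof (rule W.dominated_sum[where I = H and r = m and C = C])
      show "dominated W Q (m p)" if "p \<in> H" for p using that by (rule m(1))
      show "r (g f) \<le> C * (\<Sum>p\<in>H. m p f)" if "f \<in> W" for f using that by (rule le)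
    qed (fact H)+
  qed
  moreover have "g (f + f') = g f + g f'" if "f \<in> W" "f' \<in> W" for f f'
    using gI[of "g f + g f'"] g[OF that(1)] g[OF that(2)] by (simp add: chi_add)
  moreover have "g (fun_scale sE a f) = fun_scale sE a (g f)" if "f \<in> W" for a f
    using gI[of "fun_scale sE a (g f)"] g[OF that] by (simp add: chi_scale)
  ultimately show ?thesis
    unfolding g_def[symmetric]
    using continuous_map_seminorm_topology_iff[OF seminorm_family_W seminorm_family_L, of g] g(1)
    by (simp add: image_subset_iff)
qed

lemma topological_isomorphism_chi:
  "topological_isomorphism (fun_scale sE) (L_b sY Y sE E) (fun_scale sE) (F_sigma_b F \<Gamma>\<^sub>F sE E \<Gamma>) chi"
proof -
  have "homeomorphic_maps (seminorm_topology CL L_seminorms) (seminorm_topology W Q) chi (inv_into CL chi)"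
    unfolding homeomorphic_maps_def
  proof (intro conjI ballI continuous_chi continuous_inv_chi)
    show "inv_into CL chi (chi u) = u" if "u \<in> topspace (seminorm_topology CL L_seminorms)" for u
      using chi_inj that unfolding L.topspace by (rule inv_into_f_f)
    show "chi (inv_into CL chi f) = f" if "f \<in> topspace (seminorm_topology W Q)" for f
      using that unfolding W.topspace unfolding chi_image[symmetric] by (rule f_inv_into_f)
  qed
  then have "homeomorphic_map (seminorm_topology CL L_seminorms) (seminorm_topology W Q) chi"
    using homeomorphic_map_maps by blast
  then show ?thesis
    using chi_add chi_scale by (simp add: topological_isomorphism_def L_b_eq F_sigma_b_eq)
qed

lemma inv_chi:
  assumes "f \<in> W" "e' \<in> dual sE E"
  shows "e' (inv_into CL chi f y) = T (e' \<circ> f) y"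
proof -
  have "inv_into CL chi f \<in> CL" "chi (inv_into CL chi f) = f"
    using assms(1) unfolding chi_image[symmetric] by (rule inv_into_into, rule f_inv_into_f)
  then show ?thesis using dual_eq_T[of "inv_into CL chi f" e' y] assms(2) dual_E by simp
qed

sublocale chi: linear_homeomorphism "fun_scale sE" "L_b sY Y sE E" "fun_scale sE" "F_sigma_b F \<Gamma>\<^sub>F sE E \<Gamma>" chi
  by unfold_locales
    (simp_all add: vector_space_fun_scale E.vector_space_axioms L_b_eq CL_subspace
      topological_isomorphism_chi[unfolded L_b_eq])

end

theorem theorem4p5:
  fixes F :: "('x \<Rightarrow> 'k::real_or_complex) topology"
    and \<Gamma>\<^sub>F :: "(('x \<Rightarrow> 'k) \<Rightarrow> real) set"
    and sY :: "'k \<Rightarrow> 'y::ab_group_add \<Rightarrow> 'y" and Y :: "'y topology"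
    and sE :: "'k \<Rightarrow> 'e::ab_group_add \<Rightarrow> 'e" and E :: "'e topology"
    and \<Gamma>\<^sub>E :: "('e \<Rightarrow> real) set"
    and \<delta> :: "'x \<Rightarrow> 'y" and T :: "('x \<Rightarrow> 'k) \<Rightarrow> 'y \<Rightarrow> 'k"
  assumes F: "lc_hausdorff_space (fun_scale (*)) F"
    and fundF: "fundamental_system (fun_scale (*)) F \<Gamma>\<^sub>F"
    and lin: "strong_linearisation F \<delta> sY Y T"
    and qb: "quasi_barrelled sY Y"
    and E: "lc_hausdorff_space sE E" "topspace E = UNIV" "complete_lcs E"
    and fundE: "fundamental_system sE E \<Gamma>\<^sub>E"
  shows "let chi = (\<lambda>u. u \<circ> \<delta>);
             L = L_b sY Y sE E;
             FE = F_sigma_b F \<Gamma>\<^sub>F sE E \<Gamma>\<^sub>E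
         in topological_isomorphism (fun_scale sE) L (fun_scale sE) FE chi \<and>
            (\<forall>f\<in>topspace FE. \<forall>y. \<forall>e'\<in>dual sE E.
               e' (inv_into (topspace L) chi f y) = T (e' \<circ> f) y) \<and>
            quasi_complete_lcs (fun_scale sE) FE \<and>
            (bornological sY Y \<longrightarrow> complete_lcs FE)"
proof -
  \<comment> \<open>The given topologies are replaced by those of their fundamental systems, the
    form in which the locale treats them.\<close>
  have E_eq: "E = seminorm_topology UNIV \<Gamma>\<^sub>E" and semE: "\<And>p. p \<in> \<Gamma>\<^sub>E \<Longrightarrow> seminorm_on sE UNIV p"
    using fundE E(2) by (auto simp: fundamental_system_def)
  define V where "V = topspace F"
  have F_eq: "F = seminorm_topology V \<Gamma>\<^sub>F" and semF: "\<And>q. q \<in> \<Gamma>\<^sub>F \<Longrightarrow> seminorm_on (fun_scale (*)) V q"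
    using fundF by (auto simp: fundamental_system_def V_def)
  interpret Y: lcs sY Y
    using lin by (auto simp: lcs_def lcs_axioms_def strong_linearisation_def lc_hausdorff_space_def)
  interpret LE: lcs sE E
    using E by (auto simp: lcs_def lcs_axioms_def lc_hausdorff_space_def)
  interpret ES: seminorm_family sE UNIV \<Gamma>\<^sub>E
    by unfold_locales (auto simp: semE)
  interpret FF: seminorm_family "fun_scale (*)" V \<Gamma>\<^sub>F
    using F semF by (auto simp: seminorm_family_def seminorm_family_axioms_def lc_hausdorff_space_def V_def)
  interpret linearisation sY Y sE \<Gamma>\<^sub>E V \<Gamma>\<^sub>F \<delta> T
  proof (intro linearisation.intro lcs_operators.intro linearisation_axioms.intro)
    show "lcs sE (seminorm_topology UNIV \<Gamma>\<^sub>E)" using LE.lcs_axioms by (simp only: E_eq)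
    show "topological_isomorphism (fun_scale (*)) (seminorm_topology V \<Gamma>\<^sub>F) (fun_scale (*)) (dual_b sY Y) T"
      using lin by (simp add: strong_linearisation_def flip: F_eq)
    show "T f \<circ> \<delta> = f" if "f \<in> V" for f
      using lin that by (simp add: strong_linearisation_def V_def)
    show "complete_lcs (seminorm_topology UNIV \<Gamma>\<^sub>E)" using E(3) by (simp only: E_eq)
  qed (fact Y.lcs_axioms ES.seminorm_family_axioms FF.seminorm_family_axioms qb)+
  have top: "topspace (L_b sY Y sE (seminorm_topology UNIV \<Gamma>\<^sub>E)) = CL"
    "topspace (F_sigma_b (seminorm_topology V \<Gamma>\<^sub>F) \<Gamma>\<^sub>F sE (seminorm_topology UNIV \<Gamma>\<^sub>E) \<Gamma>\<^sub>E) = W"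
    by (simp_all add: L_b_eq F_sigma_b_eq)
  show ?thesis
    unfolding E_eq F_eq Let_def top
    using topological_isomorphism_chi inv_chi
      chi.quasi_complete_lcs_image[OF quasi_barrelled_quasi_complete_L_b[OF complete hausdorff qb]]
      chi.complete_lcs_image[OF bornological_complete_L_b[OF complete hausdorff]]
    by blast
qed

end
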